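(* There exists a complex affine algebra $R$ equipped with a derivation $\delta$ such that (i) the field of constants $\{f\in\operatorname{Frac}(R):\delta(f)=0\}$ of $(\operatorname{Frac}(R),\delta)$ is $\mathbb C$, and (ii) the intersection of all nonzero prime differential ideals of $R$ is zero. Moreover, for every integer $n\ge 3$ such an example exists with $R$ of Krull dimension $n$.
   Context: A complex affine algebra is a finitely generated commutative $\mathbb C$-algebra that is an integral domain. The derivation $\delta$ extends uniquely to $\operatorname{Frac}(R)$ by the quotient rule. A differential ideal of $R$ is an ideal $I$ with $\delta(I)\subseteq I$. *)

theory Defs
  imports "HOL-Algebra.Algebra" Complex_Main
begin

definition complex_affine_algebra :: "('a, 'b) ring_scheme \<Rightarrow> (complex \<Rightarrow> 'a) \<Rightarrow> bool" where
  "complex_affine_algebra R \<iota> \<longleftrightarrow>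
     domain R \<and>
     (\<forall>c. \<iota> c \<in> carrier R) \<and>
     (\<forall>c d. \<iota> (c + d) = \<iota> c \<oplus>\<^bsub>R\<^esub> \<iota> d) \<and>
     (\<forall>c d. \<iota> (c * d) = \<iota> c \<otimes>\<^bsub>R\<^esub> \<iota> d) \<and>
     \<iota> 1 = \<one>\<^bsub>R\<^esub> \<and>
     (\<exists>S. finite S \<and> S \<subseteq> carrier R \<and> generate_ring R (range \<iota> \<union> S) = carrier R)"

definition is_derivation :: "('a, 'b) ring_scheme \<Rightarrow> (complex \<Rightarrow> 'a) \<Rightarrow> ('a \<Rightarrow> 'a) \<Rightarrow> bool" where
  "is_derivation R \<iota> \<delta> \<longleftrightarrow>
     \<delta> \<in> carrier R \<rightarrow> carrier R \<and>
     (\<forall>a\<in>carrier R. \<forall>b\<in>carrier R. \<delta> (a \<oplus>\<^bsub>R\<^esub> b) = \<delta> a \<oplus>\<^bsub>R\<^esub> \<delta> b) \<and>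
     (\<forall>a\<in>carrier R. \<forall>b\<in>carrier R.
        \<delta> (a \<otimes>\<^bsub>R\<^esub> b) = (\<delta> a \<otimes>\<^bsub>R\<^esub> b) \<oplus>\<^bsub>R\<^esub> (a \<otimes>\<^bsub>R\<^esub> \<delta> b)) \<and>
     (\<forall>c a. a \<in> carrier R \<longrightarrow> \<delta> (\<iota> c \<otimes>\<^bsub>R\<^esub> a) = \<iota> c \<otimes>\<^bsub>R\<^esub> \<delta> a)"

text \<open>Field of constants of (Frac R, delta) equals C.  An element of Frac R is a
  fraction a/b with b nonzero; by the quotient rule delta(a/b) = (delta a * b - a * delta b)/b^2,
  so a/b is a constant iff delta a * b = a * delta b; and a/b lies in C iff a/b = iota c,
  i.e. a = iota c * b.  (Written out in terms of representatives.)\<close>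
definition frac_constants_are_C :: "('a, 'b) ring_scheme \<Rightarrow> (complex \<Rightarrow> 'a) \<Rightarrow> ('a \<Rightarrow> 'a) \<Rightarrow> bool" where
  "frac_constants_are_C R \<iota> \<delta> \<longleftrightarrow>
     (\<forall>a\<in>carrier R. \<forall>b\<in>carrier R. b \<noteq> \<zero>\<^bsub>R\<^esub> \<longrightarrow>
        \<delta> a \<otimes>\<^bsub>R\<^esub> b = a \<otimes>\<^bsub>R\<^esub> \<delta> b \<longrightarrow>
        (\<exists>c. a = \<iota> c \<otimes>\<^bsub>R\<^esub> b))"

definition differential_ideal :: "('a, 'b) ring_scheme \<Rightarrow> ('a \<Rightarrow> 'a) \<Rightarrow> 'a set \<Rightarrow> bool" where
  "differential_ideal R \<delta> I \<longleftrightarrow> ideal I R \<and> \<delta> ` I \<subseteq> I"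

definition nonzero_prime_diff_ideals_meet_zero :: "('a, 'b) ring_scheme \<Rightarrow> ('a \<Rightarrow> 'a) \<Rightarrow> bool" where
  "nonzero_prime_diff_ideals_meet_zero R \<delta> \<longleftrightarrow>
     \<Inter> {P. primeideal P R \<and> differential_ideal R \<delta> P \<and> P \<noteq> {\<zero>\<^bsub>R\<^esub>}} = {\<zero>\<^bsub>R\<^esub>}"

definition prime_chain :: "('a, 'b) ring_scheme \<Rightarrow> (nat \<Rightarrow> 'a set) \<Rightarrow> nat \<Rightarrow> bool" where
  "prime_chain R P n \<longleftrightarrow> (\<forall>i\<le>n. primeideal (P i) R) \<and> (\<forall>i<n. P i \<subset> P (Suc i))"

definition krull_dim_eq :: "('a, 'b) ring_scheme \<Rightarrow> nat \<Rightarrow> bool" where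
  "krull_dim_eq R n \<longleftrightarrow> (\<exists>P. prime_chain R P n) \<and> \<not> (\<exists>P. prime_chain R P (Suc n))"

end

theory Submission
  imports Defs "HOL-Computational_Algebra.Computational_Algebra"
    "HOL-Computational_Algebra.Field_as_Ring" "HOL-Library.Poly_Mapping"
begin

text \<open>Let \<open>E\<close> be the Legendre curve \<open>s\<^sup>2 = F(y) = y (y - 1) (y - t)\<close> over \<open>\<complex>(t)\<close>.  Its universal vector
  extension carries the Gauss-Manin vector field
  \<open>t' = 2 t (t - 1)\<close>, \<open>y' = 2 y (y - 1) + 2 s V\<close>, \<open>V' = - (y - t) V - s\<close>,
  whose algebraic solutions are the torsion points (up to coordinates it is Picard's case of the sixth Painleve equation).
  In terms of \<open>v = V / s\<close> the square root disappears and the vector field becomes a polynomial derivation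
  of \<open>\<complex>[t, y, v]\<close>.

  There are no rational constants: comparing the top two powers of \<open>v\<close> in a constant \<open>f / g\<close> gives a
  rational solution \<open>z\<close> of \<open>2 F z' + F' z = j y + e\<close>, and its poles and its degree force \<open>j = e = 0\<close>.

  The kernels of the 2-power torsion solutions, viewed as homomorphisms to a power series ring, are nonzero
  differential primes.  They intersect in zero: otherwise specialization at \<open>t = -1\<close> gives a plane curve
  that contains a sequence of torsion points of one fibre and is, generically over the \<open>y\<close>-line, stable
  under doubling; the mean of its \<open>v\<close>-coordinates is then a rational function obeying a functional equation
  whose set of finite poles is stable under taking halves, hence empty, and which has no polynomial solution.

  Further variables with \<open>x\<^sub>i' = 2 t (t - 1) t\<^sup>i x\<^sub>i\<close> raise the dimension without creating constants.\<close>

section \<open>Homogenization, derivations and homomorphisms of polynomial rings\<close>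

text \<open>By Jouanolou's theorem, infinitely many invariant hypersurfaces would produce a rational
  constant. Almost all invariant primes must therefore have height at least two, which is why three
  variables are used and the solutions are curves, algebraic over the \<open>t\<close>-line. Both
  hard steps say that the vector extension is nontrivial. With \<open>s ^ 2 = F\<close>, the
  equation \<open>2 * F * z' + F' * z = j * y + e\<close> means
  \<open>d (s * z) = (j * y + e) * dy / (2 * s)\<close>; that \<open>j = e = 0\<close> is forced
  expresses the independence of \<open>dy / s\<close> and \<open>y * dy / s\<close> in de Rham
  cohomology. The functional equation in the fibre asks for a rational section of the extension
  compatible with doubling, and a non-split extension has none. Torsion of 2-power order is
  convenient because halving is explicit once square roots of \<open>y\<close>, \<open>y - 1\<close>
  and \<open>y - t\<close> are given. Along the sequence these have nonzero constant terms at
  \<open>tau = i\<close>, so all solutions live in one power series ring.\<close>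

definition homogenize :: "'a::comm_ring_1 poly \<Rightarrow> 'a poly \<Rightarrow> nat \<Rightarrow> 'a poly \<Rightarrow> 'a poly" where
  "homogenize n f d a = (\<Sum>i\<le>d. smult (coeff a i) (n ^ i * f ^ (d - i)))"

text \<open>\<open>homogenize n f d a\<close> is \<open>f ^ d * a (n / f)\<close> with denominators
  cleared. As \<open>n\<close> has the larger degree, only the term \<open>i = d\<close> reaches
  degree \<open>d * degree n\<close>; later this shows that clearing denominators does not produce
  zero.\<close>

lemma homogenize_degree:
  fixes n f :: "'a::idom poly"
  assumes "degree f < degree n" "lead_coeff n = 1"
  shows "coeff (homogenize n f d a) (d * degree n) = coeff a d"
    "degree (homogenize n f d a) \<le> d * degree n"
proof -
  have deg: "degree (n ^ i * f ^ (d - i)) \<le> i * degree n + (d - i) * degree f" for i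
    using degree_mult_le[of "n ^ i" "f ^ (d - i)"] degree_power_le[of n i] degree_power_le[of f "d - i"]
    by (simp add: mult.commute)
  have eq: "i * degree n + (d - i) * degree n = d * degree n" if "i \<le> d" for i
    using that by (simp flip: add_mult_distrib)
  have "coeff (n ^ i * f ^ (d - i)) (d * degree n) = (if i = d then 1 else 0)" if "i \<le> d" for i
  proof (cases "i = d")
    case True
    have n0: "n \<noteq> 0" using assms by auto
    have "lead_coeff (n ^ d) = 1" unfolding lead_coeff_power assms(2) by simp
    then show ?thesis using True n0 by (simp add: degree_power_eq mult.commute)
  next
    case False
    then have "(d - i) * degree f < (d - i) * degree n" using that assms(1) by simp
    then have "degree (n ^ i * f ^ (d - i)) < d * degree n" using deg[of i] eq[OF that] by linarith
    then show ?thesis using False coeff_eq_0 by auto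
  qed
  then show "coeff (homogenize n f d a) (d * degree n) = coeff a d"
    by (simp add: homogenize_def coeff_sum if_distrib[of "\<lambda>x. _ * x"] cong: if_cong)
  have "degree (n ^ i * f ^ (d - i)) \<le> d * degree n" if "i \<le> d" for i
  proof -
    have "(d - i) * degree f \<le> (d - i) * degree n" using assms(1) by simp
    then show ?thesis using deg[of i] eq[OF that] by linarith
  qed
  then show "degree (homogenize n f d a) \<le> d * degree n" unfolding homogenize_def
    by (intro degree_sum_le) (auto intro: order.trans[OF degree_smult_le])
qed

section \<open>Derivations and unital homomorphisms as predicates\<close>

definition derivation :: "('a::comm_ring_1 \<Rightarrow> 'a) \<Rightarrow> bool" where
  "derivation d \<longleftrightarrow> (\<forall>a b. d (a + b) = d a + d b) \<and> (\<forall>a b. d (a * b) = d a * b + a * d b)"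

definition unital_hom :: "('a::comm_ring_1 \<Rightarrow> 'b::comm_ring_1) \<Rightarrow> bool" where
  "unital_hom h \<longleftrightarrow> h 1 = 1 \<and> (\<forall>a b. h (a + b) = h a + h b) \<and> (\<forall>a b. h (a * b) = h a * h b)"

lemma derivation_rules:
  assumes "derivation d"
  shows "d (a + b) = d a + d b" "d (a * b) = d a * b + a * d b" "d 0 = 0" "d 1 = 0"
    "d (- a) = - d a" "d (a - b) = d a - d b" "d (sum f I) = (\<Sum>i\<in>I. d (f i))"
proof -
  show add: "d (a + b) = d a + d b" for a b using assms by (simp add: derivation_def)
  show mult: "d (a * b) = d a * b + a * d b" for a b using assms by (simp add: derivation_def)
  show z: "d 0 = 0" using add[of 0 0] by simp
  show "d 1 = 0" using mult[of 1 1] by simp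
  show m: "d (- a) = - d a" for a using add[of a "- a"] z by (simp add: eq_neg_iff_add_eq_0 add.commute)
  show "d (a - b) = d a - d b" using add[of a "- b"] m[of b] by simp
  show "d (sum f I) = (\<Sum>i\<in>I. d (f i))"
    by (induction I rule: infinite_finite_induct) (simp_all add: z add)
qed

lemma derivation_pderiv: "derivation (pderiv :: 'a::idom poly \<Rightarrow> 'a poly)"
  by (simp add: derivation_def pderiv_add pderiv_mult algebra_simps)

lemma derivation_add: "derivation d \<Longrightarrow> derivation e \<Longrightarrow> derivation (\<lambda>a. d a + e a)"
  by (simp add: derivation_def algebra_simps)

lemma derivation_scale: "derivation d \<Longrightarrow> derivation (\<lambda>a. c * d a)"
  by (simp add: derivation_def algebra_simps)

lemma derivation_map_poly:
  assumes "derivation d"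
  shows "derivation (map_poly d)"
proof -
  note d = derivation_rules[OF assms]
  have "map_poly d (p + q) = map_poly d p + map_poly d q" for p q
    by (intro poly_eqI) (simp add: coeff_map_poly d)
  moreover have "map_poly d (p * q) = map_poly d p * q + p * map_poly d q" for p q
    by (intro poly_eqI) (simp add: coeff_map_poly coeff_mult d sum.distrib)
  ultimately show ?thesis by (simp add: derivation_def)
qed

lemma unital_hom_rules:
  assumes "unital_hom h"
  shows "h (a + b) = h a + h b" "h (a * b) = h a * h b" "h 0 = 0" "h 1 = 1"
    "h (- a) = - h a" "h (a - b) = h a - h b" "h (a ^ n) = h a ^ n" "h (sum f I) = (\<Sum>i\<in>I. h (f i))"
    "h (numeral k) = numeral k"
proof -
  show add: "h (a + b) = h a + h b" for a b using assms by (simp add: unital_hom_def)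
  show mult: "h (a * b) = h a * h b" for a b using assms by (simp add: unital_hom_def)
  show one: "h 1 = 1" using assms by (simp add: unital_hom_def)
  show z: "h 0 = 0" using add[of 0 0] by simp
  show m: "h (- a) = - h a" for a using add[of a "- a"] z by (simp add: eq_neg_iff_add_eq_0 add.commute)
  show "h (a - b) = h a - h b" using add[of a "- b"] m[of b] by simp
  show "h (a ^ n) = h a ^ n" by (induction n) (simp_all add: one mult)
  show "h (sum f I) = (\<Sum>i\<in>I. h (f i))"
    by (induction I rule: infinite_finite_induct) (simp_all add: z add)
  have "h (of_nat n) = of_nat n" for n by (induction n) (simp_all add: z one add)
  then show "h (numeral k) = numeral k" by (metis of_nat_numeral)
qed

definition poly_ev :: "('a::comm_ring_1 \<Rightarrow> 'b::comm_ring_1) \<Rightarrow> 'b \<Rightarrow> 'a poly \<Rightarrow> 'b" where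
  "poly_ev h x p = poly (map_poly h p) x"

lemma unital_hom_map_poly:
  assumes "unital_hom h"
  shows "unital_hom (map_poly h)"
proof -
  note h = unital_hom_rules[OF assms]
  have "map_poly h (p + q) = map_poly h p + map_poly h q" for p q
    by (intro poly_eqI) (simp add: coeff_map_poly h)
  moreover have "map_poly h (p * q) = map_poly h p * map_poly h q" for p q
    by (intro poly_eqI) (simp add: coeff_map_poly coeff_mult h)
  ultimately show ?thesis by (simp add: unital_hom_def h)
qed

lemma unital_hom_poly_ev:
  assumes "unital_hom h"
  shows "unital_hom (poly_ev h x)"
  using unital_hom_rules[OF unital_hom_map_poly[OF assms]] by (simp add: unital_hom_def poly_ev_def)

lemma poly_ev_pCons [simp]: "h 0 = 0 \<Longrightarrow> poly_ev h x (pCons a p) = h a + x * poly_ev h x p"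
  by (simp add: poly_ev_def map_poly_pCons)

lemma unital_hom_poly:
  assumes "unital_hom h"
  shows "h (poly p x) = poly (map_poly h p) (h x)"
  by (induction p) (simp_all add: unital_hom_rules[OF assms] map_poly_pCons)

lemma poly_ev_0 [simp]: "poly_ev h x 0 = 0"
  by (simp add: poly_ev_def)

text \<open>That a derivation commutes with an evaluation need only be checked on constants and on
  the variable. This is applied to \<open>t\<close>, \<open>y\<close> and \<open>v\<close> in turn,
  \<open>E1\<close> and \<open>E2\<close> being the two ways round the square.\<close>

lemma derivations_along_hom_eqI:
  fixes h E1 E2 :: "'a::comm_ring_1 poly \<Rightarrow> 'b::comm_ring_1"
  assumes "\<And>p q. E1 (p + q) = E1 p + E1 q" "\<And>p q. E1 (p * q) = E1 p * h q + h p * E1 q"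
    and "\<And>p q. E2 (p + q) = E2 p + E2 q" "\<And>p q. E2 (p * q) = E2 p * h q + h p * E2 q"
    and const: "\<And>a. E1 [:a:] = E2 [:a:]" and var: "E1 [:0, 1:] = E2 [:0, 1:]"
  shows "E1 p = E2 p"
proof (induction p)
  case 0
  show ?case using const[of 0] by simp
next
  case (pCons a p)
  have "pCons a p = [:a:] + [:0, 1:] * p" by simp
  then show ?case using assms pCons by metis
qed

section \<open>A first order linear equation with branch points\<close>

text \<open>\<open>N / B\<close> solves \<open>2 * F * z' + F' * z = E\<close>. At a pole where
  \<open>F\<close> does not vanish, \<open>F * z'\<close> has a pole of higher order that nothing
  cancels. At a simple root of \<open>F\<close> the equation is, to leading order,
  \<open>2 * x * z' + z = 0\<close> with solution \<open>x ^ (-1/2)\<close>, so no integral pole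
  order is possible.\<close>

lemma linear_ode_coprime_denominator_constant:
  fixes N B F E :: "complex poly"
  assumes cop: "coprime N B" and B0: "B \<noteq> 0"
    and sqf: "\<And>r. poly F r = 0 \<Longrightarrow> poly (pderiv F) r \<noteq> 0"
    and eq: "2 * F * (pderiv N * B - N * pderiv B) + pderiv F * N * B = B\<^sup>2 * E"
  shows "degree B = 0"
proof (rule ccontr)
  assume "degree B \<noteq> 0"
  then obtain r where r: "poly B r = 0"
    by (metis constant_degree fundamental_theorem_of_algebra)
  define l where "l = [:-r, 1:]"
  obtain b where b: "B = l ^ order r B * b" "\<not> l dvd b"
    using order_decomp[OF B0, of r] unfolding l_def by auto
  have "order r B > 0" using r B0 by (simp add: order_root)
  then obtain e where e: "order r B = Suc e" using gr0_implies_Suc by blast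
  have B: "B = l * l ^ e * b" using b e by simp
  have br: "poly b r \<noteq> 0" using b(2) by (simp add: poly_eq_0_iff_dvd l_def)
  have Nr: "poly N r \<noteq> 0"
  proof
    assume "poly N r = 0"
    then have "l dvd N" "l dvd B" using r by (simp_all add: poly_eq_0_iff_dvd l_def)
    then have "is_unit l" using cop coprime_common_divisor by blast
    then show False by (simp add: l_def is_unit_iff_degree)
  qed
  have dl: "pderiv l = 1" by (simp add: l_def pderiv_pCons)
  have lr: "poly l r = 0" by (simp add: l_def)
  have l0: "l \<noteq> 0" by (simp add: l_def)
  have dle: "pderiv (l * l ^ e) = of_nat (Suc e) * l ^ e"
    using pderiv_power_Suc[of l e] dl by (simp add: of_nat_poly del: of_nat_Suc)
  have dB: "pderiv B = l ^ e * (of_nat (Suc e) * b + l * pderiv b)"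
    unfolding B pderiv_mult[of "l * l ^ e" b] dle by (simp add: algebra_simps)
  have "l ^ e * (2 * F * (pderiv N * l * b - N * (of_nat (Suc e) * b + l * pderiv b)) + pderiv F * N * l * b)
     = l ^ e * (l * l * l ^ e * b\<^sup>2 * E)"
    using eq unfolding dB unfolding B by (simp add: algebra_simps power2_eq_square)
  then have eq1: "2 * F * (pderiv N * l * b - N * (of_nat (Suc e) * b + l * pderiv b)) + pderiv F * N * l * b
     = l * l * l ^ e * b\<^sup>2 * E"
    using l0 by simp
  have "poly F r * poly N r * (of_nat (Suc e) * poly b r) = 0"
    using arg_cong[OF eq1, of "\<lambda>p. poly p r"] lr by simp
  then have Fr: "poly F r = 0" using Nr br by (simp del: of_nat_Suc)
  then obtain G where G: "F = l * G" by (auto simp: poly_eq_0_iff_dvd l_def elim: dvdE)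
  have "l * (2 * G * (pderiv N * l * b - N * (of_nat (Suc e) * b + l * pderiv b)) + pderiv F * N * b)
     = l * (l * l ^ e * b\<^sup>2 * E)"
    using eq1 unfolding G by (simp add: algebra_simps)
  then have eq2: "2 * G * (pderiv N * l * b - N * (of_nat (Suc e) * b + l * pderiv b)) + pderiv F * N * b
     = l * l ^ e * b\<^sup>2 * E"
    using l0 by simp
  have dFr: "poly (pderiv F) r = poly G r" unfolding G by (simp add: pderiv_mult dl lr)
  then have Gr: "poly G r \<noteq> 0" using sqf[OF Fr] by simp
  \<comment> \<open>The last factor is the indicial polynomial at pole order \<open>Suc e\<close>;
    its root would be pole order 1/2.\<close>
  have "poly G r * poly N r * poly b r * (1 - 2 * of_nat (Suc e)) = 0"
    using arg_cong[OF eq2, of "\<lambda>p. poly p r"] lr dFr by (simp add: algebra_simps)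
  then have "1 - 2 * of_nat (Suc e) = (0::complex)" using Gr Nr br by (metis mult_eq_0_iff)
  then have "(2::complex) * of_nat (Suc e) = 1" by (metis eq_iff_diff_eq_0)
  then have "2 * real (Suc e) = 1"
    by (metis Re_complex_of_real of_real_1 of_real_mult of_real_numeral of_real_of_nat_eq)
  then show False by simp
qed

text \<open>Homogeneous solutions are multiples of \<open>F ^ (-1/2)\<close>, of degree -3/2. For
  \<open>N\<close> of degree \<open>d\<close> the top coefficient thus carries the factor
  \<open>2 * d + 3\<close>, which is never zero, so the left side has degree
  \<open>d + 2 > 1\<close> unless \<open>N = 0\<close>.\<close>

lemma linear_ode_polynomial_solution:
  fixes N F E :: "'a :: field_char_0 poly"
  assumes deg: "degree F = 3" "degree E \<le> 1"
    and eq: "2 * F * pderiv N + pderiv F * N = E"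
  shows "E = 0"
proof (cases "N = 0")
  case True then show ?thesis using eq by simp
next
  case False
  define d where "d = degree N"
  have "F \<noteq> 0" using deg by auto
  then have F0: "lead_coeff F \<noteq> 0" by simp
  have cF: "coeff (pderiv F) 2 = 3 * lead_coeff F" using deg(1) by (simp add: coeff_pderiv eval_nat_numeral)
  have dF: "degree (pderiv F) = 2" using deg(1) by (simp add: degree_pderiv)
  have "coeff (F * pderiv N) (d + 2) = of_nat d * lead_coeff F * lead_coeff N"
  proof (cases "d = 0")
    case True
    then have "pderiv N = 0" by (simp add: d_def pderiv_eq_0_iff)
    then show ?thesis using True by simp
  next
    case False
    then have "coeff (F * pderiv N) (3 + (d - 1)) = coeff F 3 * coeff (pderiv N) (d - 1)"
      using coeff_mult_degree_sum[of F "pderiv N"] deg by (simp add: degree_pderiv d_def)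
    moreover have "3 + (d - 1) = d + 2" using False by simp
    ultimately show ?thesis using False deg by (simp add: coeff_pderiv d_def)
  qed
  moreover have "coeff (pderiv F * N) (2 + d) = 3 * lead_coeff F * lead_coeff N"
    using coeff_mult_degree_sum[of "pderiv F" N] dF cF by (simp add: d_def)
  moreover have "coeff E (d + 2) = 0" using deg(2) by (simp add: coeff_eq_0)
  ultimately have "2 * (of_nat d * lead_coeff F * lead_coeff N) + 3 * lead_coeff F * lead_coeff N = 0"
    using arg_cong[OF eq, of "\<lambda>p. coeff p (d + 2)"]
    by (simp add: mult.assoc add.commute numeral_poly)
  then have "(2 * of_nat d + 3) * (lead_coeff F * lead_coeff N) = 0" by (simp add: algebra_simps)
  moreover have "(2 * of_nat d + 3 :: 'a) \<noteq> 0"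
    by (metis of_nat_add of_nat_eq_0_iff of_nat_mult of_nat_numeral add_is_0 zero_neq_numeral)
  ultimately show ?thesis using F0 False by simp
qed

lemma linear_ode_rational_solution:
  fixes N B F E :: "complex poly"
  assumes B0: "B \<noteq> 0" and deg: "degree F = 3" "degree E \<le> 1"
    and sqf: "\<And>r. poly F r = 0 \<Longrightarrow> poly (pderiv F) r \<noteq> 0"
    and eq: "2 * F * (pderiv N * B - N * pderiv B) + pderiv F * N * B = B\<^sup>2 * E"
  shows "E = 0"
proof -
  define d where "d = gcd N B"
  obtain N1 B1 where nb: "N = N1 * d" "B = B1 * d" "coprime N1 B1"
    using gcd_coprime_exists[of N B] B0 unfolding d_def by auto
  have d0: "d \<noteq> 0" "B1 \<noteq> 0" using B0 nb by auto
  have "d\<^sup>2 * (2 * F * (pderiv N1 * B1 - N1 * pderiv B1) + pderiv F * N1 * B1) = d\<^sup>2 * (B1\<^sup>2 * E)"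
    using eq unfolding nb(1,2) by (simp add: pderiv_mult algebra_simps power2_eq_square)
  then have eq1: "2 * F * (pderiv N1 * B1 - N1 * pderiv B1) + pderiv F * N1 * B1 = B1\<^sup>2 * E"
    using d0 by simp
  then have "degree B1 = 0"
    using linear_ode_coprime_denominator_constant nb(3) d0(2) sqf by blast
  then obtain k where k: "B1 = [:k:]" using degree_eq_zeroE by blast
  have k0: "k \<noteq> 0" using d0 k by auto
  have "[:k:] * (2 * F * pderiv N1 + pderiv F * N1) = [:k:] * ([:k:] * E)"
    using eq1 unfolding k by (simp add: pderiv_pCons algebra_simps power2_eq_square)
  then have "2 * F * pderiv N1 + pderiv F * N1 = [:k:] * E" using k0
    by (metis mult_left_cancel pCons_eq_0_iff)
  moreover have "degree ([:k:] * E) \<le> 1" using deg by simp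
  ultimately have "[:k:] * E = 0" using linear_ode_polynomial_solution deg(1) by blast
  then show ?thesis using k0 by simp
qed

section \<open>Density of torsion points in one fibre\<close>

text \<open>In the fibre \<open>t = -1\<close>, doubling a point sends its abscissa \<open>y\<close> to \<open>fibre_double y\<close>, with derivative
  \<open>fibre_ram y / (4 (fibre_cubic y)\<^sup>2)\<close>.\<close>

definition fibre_cubic :: "complex poly" where "fibre_cubic = [:0, -1, 0, 1:]"
definition fibre_num :: "complex poly" where "fibre_num = [:1, 0, 2, 0, 1:]"
definition fibre_ram :: "complex poly" where "fibre_ram = [:1, 0, -5, 0, -5, 0, 1:]"
definition fibre_double :: "complex \<Rightarrow> complex" where "fibre_double y = poly fibre_num y / (4 * poly fibre_cubic y)"

text \<open>The roots of \<open>fibre_ram\<close> are the abscissae of the points of order 4: their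
  doubles lie over the branch points 0, 1, -1, and there doubling is critical as a map of the
  \<open>y\<close>-line.\<close>

lemma poly_fibre:
  "poly fibre_cubic y = y ^ 3 - y" "poly fibre_num y = (y\<^sup>2 + 1)\<^sup>2"
  "poly fibre_ram y = (y\<^sup>2 + 1) * (y ^ 4 - 6 * y\<^sup>2 + 1)" "poly (pderiv fibre_cubic) y = 3 * y\<^sup>2 - 1"
  "poly (pderiv fibre_num) y = 4 * y * (y\<^sup>2 + 1)" "poly (pderiv fibre_ram) y = 6 * y ^ 5 - 20 * y ^ 3 - 10 * y"
  by (simp_all add: fibre_cubic_def fibre_num_def fibre_ram_def pderiv_pCons algebra_simps power2_eq_square power3_eq_cube eval_nat_numeral)

lemma fibre_preimages:
  "\<exists>y z. y \<noteq> z \<and> poly fibre_cubic y \<noteq> 0 \<and> poly fibre_cubic z \<noteq> 0 \<and> fibre_double y = p \<and> fibre_double z = p"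
proof -
  have nz: "poly fibre_cubic y \<noteq> 0" if "poly fibre_num y = 4 * p * poly fibre_cubic y" for y
  proof
    assume F: "poly fibre_cubic y = 0"
    then have "(y\<^sup>2 + 1)\<^sup>2 = 0" using that by (simp add: poly_fibre)
    then have y2: "y * y = -1" by (simp add: power2_eq_square eq_neg_iff_add_eq_0)
    have "y * (y * y) - y = 0" using F by (simp add: poly_fibre power3_eq_cube)
    then show False using y2 by auto
  qed
  have Y: "fibre_double y = p" if "poly fibre_num y = 4 * p * poly fibre_cubic y" for y
    using nz[OF that] that by (simp add: fibre_double_def field_simps)
  have "degree (fibre_num - smult (4 * p) fibre_cubic) = 4"
    by (simp add: fibre_num_def fibre_cubic_def)
  then have "\<not> constant (poly (fibre_num - smult (4 * p) fibre_cubic))" by (simp add: constant_degree)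
  then obtain y where "poly (fibre_num - smult (4 * p) fibre_cubic) y = 0"
    using fundamental_theorem_of_algebra by blast
  then have y: "poly fibre_num y = 4 * p * poly fibre_cubic y" by simp
  have y0: "y \<noteq> 0" using nz[OF y] by (auto simp: poly_fibre)
  show ?thesis
  proof (cases "y * y = -1")
    \<comment> \<open>These are the fixed points of the involution \<open>y -> -1 / y\<close> used
      in the other case. They lie over \<open>p = 0\<close>, and \<open>-y\<close> is the second
      preimage.\<close>
    case True
    then have "poly fibre_num y = 0" by (simp add: poly_fibre power2_eq_square)
    then have "p = 0" using y nz[OF y] by simp
    moreover have "poly fibre_num (-y) = 0" using True by (simp add: poly_fibre power2_eq_square)
    ultimately have my: "poly fibre_num (-y) = 4 * p * poly fibre_cubic (-y)" by simp
    have "y \<noteq> -y" using y0 by simp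
    then show ?thesis using nz Y y my by blast
  next
    case False
    \<comment> \<open>Translation by the 2-torsion point over \<open>y = 0\<close> acts on abscissae
      by \<open>y -> -1 / y\<close> and leaves the double unchanged.\<close>
    define z where "z = - 1 / y"
    have "y \<noteq> z" using False y0 by (auto simp: z_def field_simps)
    have "y ^ 4 * (poly fibre_num z - 4 * p * poly fibre_cubic z) = poly fibre_num y - 4 * p * poly fibre_cubic y"
      using y0 unfolding poly_fibre z_def by (simp add: field_simps power2_eq_square power3_eq_cube eval_nat_numeral)
    then have "poly fibre_num z = 4 * p * poly fibre_cubic z" using y y0 by simp
    then show ?thesis using \<open>y \<noteq> z\<close> nz Y y by blast
  qed
qed

definition homog :: "nat \<Rightarrow> complex poly \<Rightarrow> complex poly" where
  "homog = homogenize fibre_num (4 * fibre_cubic)"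

lemma poly_homog:
  assumes "degree a \<le> d" "poly fibre_cubic y \<noteq> 0"
  shows "poly (homog d a) y = (4 * poly fibre_cubic y) ^ d * poly a (fibre_double y)"
proof -
  have "poly a (fibre_double y) = (\<Sum>i\<le>d. coeff a i * fibre_double y ^ i)"
    unfolding poly_altdef using assms(1)
    by (intro sum.mono_neutral_left) (auto simp: coeff_eq_0)
  moreover have "poly fibre_num y ^ i * (4 * poly fibre_cubic y) ^ (d - i) = (4 * poly fibre_cubic y) ^ d * fibre_double y ^ i" if "i \<le> d" for i
  proof -
    have "(4 * poly fibre_cubic y) ^ d = (4 * poly fibre_cubic y) ^ (d - i) * (4 * poly fibre_cubic y) ^ i"
      using that power_add[of "4 * poly fibre_cubic y" "d - i" i] by simp
    then show ?thesis using assms(2) by (simp add: fibre_double_def power_divide)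
  qed
  ultimately show ?thesis
    by (simp add: homog_def homogenize_def poly_sum sum_distrib_left mult.left_commute)
qed

lemma fibre_infinite_zeros:
  assumes "\<And>y. poly fibre_cubic y \<noteq> 0 \<Longrightarrow> poly q y = 0"
  shows "q = 0"
proof -
  have "poly (fibre_cubic * q) y = 0" for y using assms by auto
  then have "fibre_cubic * q = 0" using poly_all_0_iff_0 by blast
  moreover have "fibre_cubic \<noteq> 0" by (simp add: fibre_cubic_def)
  ultimately show ?thesis by simp
qed

text \<open>Every preimage under doubling of a root of \<open>b\<close> is a root of \<open>b\<close>, also over the branch points, where one
  has to differentiate.  As each point has at least two preimages, there are no roots.\<close>

lemma fibre_coprime_eq_denominator:
  assumes cop: "coprime a b" and b0: "b \<noteq> 0"
    and eq: "\<And>y. poly fibre_cubic y \<noteq> 0 \<Longrightarrow> poly b (fibre_double y) * (16 * (poly fibre_cubic y)\<^sup>2 * poly a y)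
      = poly b y * (poly a (fibre_double y) * poly fibre_ram y + c * poly b (fibre_double y) * poly fibre_cubic y * poly (pderiv fibre_cubic) y)"
  shows "degree b = 0"
proof -
  define A where "A = {p. poly b p = 0}"
  have finA: "finite A" unfolding A_def using b0 by (rule poly_roots_finite)
  have closed: "y \<in> A" if p: "fibre_double y \<in> A" and F: "poly fibre_cubic y \<noteq> 0" for y
  proof -
    have bp: "poly b (fibre_double y) = 0" using p by (simp add: A_def)
    have ap: "poly a (fibre_double y) \<noteq> 0"
      using cop bp by (metis coprime_common_divisor dvd_refl is_unit_pCons_iff one_neq_zero poly_eq_0_iff_dvd pCons_eq_0_iff is_unit_poly_iff pCons_eq_iff)
    have e: "poly b y * (poly a (fibre_double y) * poly fibre_ram y) = 0" using eq[OF F] bp by simp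
    show ?thesis
    proof (cases "poly fibre_ram y = 0")
      case False
      then show ?thesis using e ap by (simp add: A_def)
    next
      \<comment> \<open>At a critical point both sides of the equation vanish, so it is
        differentiated. Every term containing the derivative of \<open>fibre_double\<close> or the
        factor \<open>poly b (fibre_double y)\<close> drops out, and a simple root of
        \<open>fibre_ram\<close> leaves \<open>poly b y = 0\<close>.\<close>
      case S: True
      have dY: "(fibre_double has_field_derivative 0) (at y)"
      proof -
        have "(fibre_double has_field_derivative ((poly (pderiv fibre_num) y * (4 * poly fibre_cubic y) - poly fibre_num y * (4 * poly (pderiv fibre_cubic) y))
           / (4 * poly fibre_cubic y * (4 * poly fibre_cubic y)))) (at y)"
          unfolding fibre_double_def[abs_def] using F
          by (intro derivative_eq_intros poly_DERIV | simp)+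
        moreover have "poly (pderiv fibre_num) y * (4 * poly fibre_cubic y) - poly fibre_num y * (4 * poly (pderiv fibre_cubic) y) = 4 * poly fibre_ram y"
          unfolding poly_fibre by (simp add: algebra_simps power2_eq_square power3_eq_cube eval_nat_numeral)
        ultimately show ?thesis using S by simp
      qed
      have comp: "((\<lambda>x. poly q (fibre_double x)) has_field_derivative 0) (at y)" for q
        using DERIV_chain2[OF poly_DERIV dY, of q] by simp
      define \<Psi> where "\<Psi> = (\<lambda>x. poly b (fibre_double x) * poly (16 * fibre_cubic\<^sup>2 * a) x
         - (poly a (fibre_double x) * poly (b * fibre_ram) x + poly b (fibre_double x) * poly (smult c (b * fibre_cubic * pderiv fibre_cubic)) x))"
      have "(\<Psi> has_field_derivative (- (poly a (fibre_double y) * poly (pderiv (b * fibre_ram)) y))) (at y)"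
        unfolding \<Psi>_def
        by (rule derivative_eq_intros comp poly_DERIV refl)+ (simp add: bp)
      moreover have "(\<Psi> has_field_derivative 0) (at y)"
      proof -
        have "open {x. poly fibre_cubic x \<noteq> 0}" by (intro open_Collect_neq continuous_intros)
        moreover have "\<Psi> x = 0" if "x \<in> {x. poly fibre_cubic x \<noteq> 0}" for x
          using eq[of x] that by (simp add: \<Psi>_def algebra_simps)
        ultimately show ?thesis
          using has_field_derivative_transform_within_open[of "\<lambda>_. 0" 0 y "{x. poly fibre_cubic x \<noteq> 0}" \<Psi>] F by auto
      qed
      ultimately have "poly a (fibre_double y) * poly (pderiv (b * fibre_ram)) y = 0"
        using DERIV_unique by fastforce
      then have "poly b y * poly (pderiv fibre_ram) y = 0" using ap S by (simp add: pderiv_mult)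
      moreover have "poly (pderiv fibre_ram) y \<noteq> 0"
      proof
        assume S': "poly (pderiv fibre_ram) y = 0"
        define z where "z = y\<^sup>2"
        have 1: "(z + 1) * (z\<^sup>2 - 6 * z + 1) = 0" using S unfolding poly_fibre z_def by (simp flip: power_mult)
        have "y * (6 * z\<^sup>2 - 20 * z - 10) = 0" using S' unfolding poly_fibre z_def
          by (simp add: algebra_simps power2_eq_square eval_nat_numeral)
        moreover have "y \<noteq> 0" using F by (auto simp: poly_fibre)
        ultimately have 2: "6 * z\<^sup>2 - 20 * z - 10 = 0" by simp
        show False
        proof (cases "z + 1 = 0")
          case True
          then have "z = -1" by (simp add: eq_neg_iff_add_eq_0)
          then show False using 2 by simp
        next
          case False
          then have "z\<^sup>2 - 6 * z + 1 = 0" using 1 by (metis mult_eq_0_iff)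
          then have 3: "z\<^sup>2 = 6 * z - 1" by (simp add: algebra_simps)
          then have "6 * (6 * z - 1) - 20 * z - 10 = 0" using 2 by simp
          then have "z = 1" by (simp add: algebra_simps)
          then show False using 3 by simp
        qed
      qed
      ultimately show ?thesis by (simp add: A_def)
    qed
  qed
  \<comment> \<open>The finite set \<open>A\<close> is contained in its image under doubling, so
    doubling is injective on \<open>A\<close>; but a point of \<open>A\<close> has two distinct
    preimages, both in \<open>A\<close>.\<close>
  have "A \<subseteq> fibre_double ` A"
  proof
    fix p assume "p \<in> A"
    moreover obtain y where "poly fibre_cubic y \<noteq> 0" "fibre_double y = p" using fibre_preimages by blast
    ultimately show "p \<in> fibre_double ` A" using closed by blast
  qed
  then have inj: "inj_on fibre_double A" by (rule finite_surj_inj[OF finA])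
  have "A = {}"
  proof (rule ccontr)
    assume "A \<noteq> {}"
    then obtain p where "p \<in> A" by blast
    moreover obtain y z where "y \<noteq> z" "poly fibre_cubic y \<noteq> 0" "poly fibre_cubic z \<noteq> 0" "fibre_double y = p" "fibre_double z = p"
      using fibre_preimages by blast
    ultimately show False using closed inj by (metis inj_on_contraD)
  qed
  then show ?thesis
    using fundamental_theorem_of_algebra[of b] by (auto simp: A_def constant_degree)
qed

lemma degree_fibre: "degree fibre_cubic = 3" "degree fibre_num = 4" "degree fibre_ram = 6" "degree (pderiv fibre_cubic) = 2"
  "lead_coeff fibre_cubic = 1" "lead_coeff fibre_num = 1" "lead_coeff fibre_ram = 1"
  by (simp_all add: fibre_cubic_def fibre_num_def fibre_ram_def pderiv_pCons)

lemma coeff_homog: "coeff (homog d a) (4 * d) = coeff a d" "degree (homog d a) \<le> 4 * d"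
proof -
  have "degree (4 * fibre_cubic) < degree fibre_num" by (simp add: degree_fibre numeral_poly)
  from homogenize_degree[OF this degree_fibre(6)]
  show "coeff (homog d a) (4 * d) = coeff a d" "degree (homog d a) \<le> 4 * d"
    unfolding homog_def degree_fibre(2) by (metis mult.commute)+
qed

text \<open>For \<open>z = a / b\<close> and \<open>Y = fibre_double y\<close> the equation reads
  \<open>16 * F ^ 2 * z y = R * z Y + c * F * F'\<close>, with \<open>R\<close> for
  \<open>fibre_ram\<close>. Poles are excluded by the preceding lemma. For a polynomial
  \<open>z\<close> of degree \<open>e\<close>, the behaviour \<open>Y ~ y / 4\<close> at infinity
  turns the top coefficients into \<open>16 * 4 ^ e = 1\<close>; and \<open>z = 0\<close> would
  force \<open>c = 0\<close>.\<close>

lemma fibre_functional_equation_unsolvable: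
  assumes b0: "b \<noteq> 0" and c0: "c \<noteq> 0"
    and eq: "\<And>y. poly fibre_cubic y \<noteq> 0 \<Longrightarrow> poly b (fibre_double y) * (16 * (poly fibre_cubic y)\<^sup>2 * poly a y)
      = poly b y * (poly a (fibre_double y) * poly fibre_ram y + c * poly b (fibre_double y) * poly fibre_cubic y * poly (pderiv fibre_cubic) y)"
  shows False
proof -
  define d where "d = gcd a b"
  obtain a1 b1 where ab: "a = a1 * d" "b = b1 * d" "coprime a1 b1"
    using gcd_coprime_exists[of a b] b0 unfolding d_def by auto
  have d0: "d \<noteq> 0" "b1 \<noteq> 0" using b0 ab by auto
  have hd: "homog (degree d) d \<noteq> 0"
  proof
    assume h: "homog (degree d) d = 0"
    have "poly d p = 0" for p
    proof -
      obtain y where "poly fibre_cubic y \<noteq> 0" "fibre_double y = p" using fibre_preimages by blast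
      then show ?thesis using poly_homog[of d "degree d" y] h by simp
    qed
    then show False using d0 poly_all_0_iff_0 by blast
  qed
  define D where "D = max (degree a1) (degree b1)"
  define Q where "Q = homog D b1 * (16 * fibre_cubic\<^sup>2 * a1) - b1 * (homog D a1 * fibre_ram + smult c (homog D b1 * fibre_cubic * pderiv fibre_cubic))"
  have pQ: "poly Q y = (4 * poly fibre_cubic y) ^ D * (poly b1 (fibre_double y) * (16 * (poly fibre_cubic y)\<^sup>2 * poly a1 y)
      - poly b1 y * (poly a1 (fibre_double y) * poly fibre_ram y + c * poly b1 (fibre_double y) * poly fibre_cubic y * poly (pderiv fibre_cubic) y))"
    if "poly fibre_cubic y \<noteq> 0" for y
    using that by (simp add: Q_def poly_homog D_def algebra_simps)
  \<comment> \<open>The common factor \<open>d\<close> enters both at \<open>y\<close> and at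
    \<open>fibre_double y\<close>. As polynomials both occurrences are nonzero, the second because
    doubling is onto, so they can be cancelled.\<close>
  have "poly (Q * d * homog (degree d) d) y = 0" if F: "poly fibre_cubic y \<noteq> 0" for y
  proof -
    define Z where "Z = poly b1 (fibre_double y) * (16 * (poly fibre_cubic y)\<^sup>2 * poly a1 y)
      - poly b1 y * (poly a1 (fibre_double y) * poly fibre_ram y + c * poly b1 (fibre_double y) * poly fibre_cubic y * poly (pderiv fibre_cubic) y)"
    have "Z * (poly d y * poly d (fibre_double y)) = 0"
      using eq[OF F] unfolding ab Z_def by (simp add: algebra_simps)
    then show ?thesis using pQ[OF F] poly_homog[of d "degree d", OF order_refl F] by (auto simp: Z_def)
  qed
  then have "Q * d * homog (degree d) d = 0" by (rule fibre_infinite_zeros)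
  then have "Q = 0" using hd d0 by simp
  then have eq1: "poly b1 (fibre_double y) * (16 * (poly fibre_cubic y)\<^sup>2 * poly a1 y)
      = poly b1 y * (poly a1 (fibre_double y) * poly fibre_ram y + c * poly b1 (fibre_double y) * poly fibre_cubic y * poly (pderiv fibre_cubic) y)"
    if "poly fibre_cubic y \<noteq> 0" for y using pQ[OF that] that by simp
  have "degree b1 = 0" using fibre_coprime_eq_denominator[OF ab(3) d0(2) eq1] by blast
  then obtain \<beta> where \<beta>: "b1 = [:\<beta>:]" using degree_eq_zeroE by blast
  then have \<beta>0: "\<beta> \<noteq> 0" using d0 by auto
  define e where "e = degree a1"
  define W where "W = (4 * fibre_cubic) ^ e"
  have "16 * fibre_cubic\<^sup>2 * a1 * W - (fibre_ram * homog e a1 + smult (c * \<beta>) (fibre_cubic * pderiv fibre_cubic * W)) = 0"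
  proof (rule fibre_infinite_zeros)
    fix y assume F: "poly fibre_cubic y \<noteq> 0"
    have "\<beta> * (16 * (poly fibre_cubic y)\<^sup>2 * poly a1 y) = \<beta> * (poly a1 (fibre_double y) * poly fibre_ram y + c * \<beta> * poly fibre_cubic y * poly (pderiv fibre_cubic) y)"
      using eq1[OF F] by (simp add: \<beta>)
    then have *: "16 * (poly fibre_cubic y)\<^sup>2 * poly a1 y = poly a1 (fibre_double y) * poly fibre_ram y + c * \<beta> * poly fibre_cubic y * poly (pderiv fibre_cubic) y"
      using \<beta>0 by simp
    then show "poly (16 * fibre_cubic\<^sup>2 * a1 * W - (fibre_ram * homog e a1 + smult (c * \<beta>) (fibre_cubic * pderiv fibre_cubic * W))) y = 0"
    proof -
      have "poly (16 * fibre_cubic\<^sup>2 * a1 * W - (fibre_ram * homog e a1 + smult (c * \<beta>) (fibre_cubic * pderiv fibre_cubic * W))) y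
        = poly W y * (16 * (poly fibre_cubic y)\<^sup>2 * poly a1 y
           - (poly a1 (fibre_double y) * poly fibre_ram y + c * \<beta> * poly fibre_cubic y * poly (pderiv fibre_cubic) y))"
        using F by (simp add: W_def poly_homog e_def algebra_simps)
      then show ?thesis using * by simp
    qed
  qed
  then have E: "16 * fibre_cubic\<^sup>2 * a1 * W = fibre_ram * homog e a1 + smult (c * \<beta>) (fibre_cubic * pderiv fibre_cubic * W)" by simp
  have F0: "fibre_cubic \<noteq> 0" by (simp add: fibre_cubic_def)
  have W0: "W \<noteq> 0" using F0 by (simp add: W_def)
  have dW: "degree W = 3 * e" using F0 by (simp add: W_def degree_power_eq degree_fibre numeral_poly mult.commute)
  show False
  proof (cases "a1 = 0")
    case True
    then have "homog e a1 = 0" by (simp add: homog_def homogenize_def)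
    then have "fibre_cubic * pderiv fibre_cubic * W = 0" using E True \<beta>0 c0 by simp
    then show False using F0 W0 degree_fibre(4) by auto
  next
    case False
    have "lead_coeff W = 4 ^ e" unfolding W_def lead_coeff_power lead_coeff_mult degree_fibre(5)
      by (simp add: numeral_poly)
    \<comment> \<open>The two main terms meet in degree \<open>6 + 4 * e\<close>: on the left
      \<open>6 + e + 3 * e\<close>, on the right \<open>6\<close> from \<open>fibre_ram\<close> and
      \<open>4 * e\<close> from \<open>homog e a1\<close>. The inhomogeneous term stops at
      \<open>5 + 3 * e\<close>.\<close>
    then have "coeff (16 * fibre_cubic\<^sup>2 * a1 * W) (6 + 4 * e) = 16 * lead_coeff a1 * 4 ^ e"
    proof -
      have "degree (16 * fibre_cubic\<^sup>2 * a1 * W) = 6 + 4 * e"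
        using F0 False W0 by (simp add: degree_mult_eq degree_power_eq degree_fibre numeral_poly dW e_def)
      moreover have "lead_coeff (16 * fibre_cubic\<^sup>2 * a1 * W) = 16 * lead_coeff a1 * 4 ^ e"
        using \<open>lead_coeff W = 4 ^ e\<close>
        unfolding lead_coeff_mult lead_coeff_power degree_fibre(5) by (simp add: numeral_poly)
      ultimately show ?thesis by simp
    qed
    moreover have "coeff (fibre_ram * homog e a1) (6 + 4 * e) = lead_coeff a1"
    proof (cases "degree (homog e a1) = 4 * e")
      case True
      then show ?thesis using coeff_mult_degree_sum[of fibre_ram "homog e a1"] coeff_homog(1)[of e a1] degree_fibre
        by (simp add: e_def)
    next
      case c: False
      then have "coeff (homog e a1) (4 * e) = 0" using coeff_homog(2)[of e a1] by (simp add: coeff_eq_0)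
      then show ?thesis using False by (simp add: coeff_homog(1) e_def)
    qed
    moreover have "coeff (smult (c * \<beta>) (fibre_cubic * pderiv fibre_cubic * W)) (6 + 4 * e) = 0"
    proof -
      have "degree (smult (c * \<beta>) (fibre_cubic * pderiv fibre_cubic * W)) \<le> 5 + 3 * e"
        using degree_mult_le[of "fibre_cubic * pderiv fibre_cubic" W] degree_mult_le[of fibre_cubic "pderiv fibre_cubic"] dW
          degree_smult_le[of "c * \<beta>" "fibre_cubic * pderiv fibre_cubic * W"] degree_fibre by linarith
      then show ?thesis by (intro coeff_eq_0) linarith
    qed
    ultimately have "16 * lead_coeff a1 * 4 ^ e = lead_coeff a1"
      using E by (metis add.right_neutral coeff_add)
    then have "(16 * 4 ^ e :: complex) = 1" using False by (simp add: mult.assoc mult.left_commute[of _ "lead_coeff a1"])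
    then have "norm (16 * 4 ^ e :: complex) = 1" by simp
    then have "16 * 4 ^ e = (1 :: real)" by (simp add: norm_mult norm_power)
    moreover have "(1 :: real) \<le> 4 ^ e" by simp
    ultimately show False by linarith
  qed
qed


section \<open>Linear substitutions in the outer variable\<close>

lemma coeff_linear_power:
  fixes q r :: "'a::comm_ring_1"
  shows "coeff ([:q, r:] ^ i) i = r ^ i" "coeff ([:q, r:] ^ Suc i) i = of_nat (Suc i) * q * r ^ i"
    "degree ([:q, r:] ^ i) \<le> i"
proof -
  show deg: "degree ([:q, r:] ^ i) \<le> i" for i
    by (rule order.trans[OF degree_power_le]) (simp add: degree_pCons_le)
  show top: "coeff ([:q, r:] ^ i) i = r ^ i" for i
  proof (induction i)
    case (Suc i)
    have "coeff ([:q, r:] ^ i) (Suc i) = 0" using deg[of i] by (simp add: coeff_eq_0)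
    then show ?case using Suc by simp
  qed simp
  show "coeff ([:q, r:] ^ Suc i) i = of_nat (Suc i) * q * r ^ i"
  proof (induction i)
    case (Suc i)
    have "coeff ([:q, r:] ^ Suc (Suc i)) (Suc i) = q * coeff ([:q, r:] ^ Suc i) (Suc i) + r * coeff ([:q, r:] ^ Suc i) i"
      unfolding power_Suc[of _ "Suc i"] by (simp del: power_Suc)
    then show ?case using Suc top[of "Suc i"] by (simp add: algebra_simps del: power_Suc) (simp add: algebra_simps)
  qed simp
qed

lemma poly2_linear_power:
  "poly (poly ([:c:] * [:q, r:] ^ i) [:u:]) z = poly c z * (poly q z + u * poly r z) ^ i"
  for u :: "'a::comm_ring_1"
  by simp

text \<open>For a vanishing polynomial of least degree in \<open>v\<close>, pulling back under doubling gives a multiple of it;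
  the two top coefficients yield the functional equation above.\<close>

lemma torsion_points_dense:
  fixes ys vs :: "nat \<Rightarrow> complex" and f :: "complex poly poly"
  assumes y0: "(ys 0)\<^sup>2 = -1" and F: "\<And>k. poly fibre_cubic (ys k) \<noteq> 0"
    and y: "\<And>k. fibre_double (ys (Suc k)) = ys k"
    and v: "\<And>k. vs k * poly fibre_ram (ys (Suc k)) = 4 * poly fibre_cubic (ys (Suc k)) *
         (4 * poly fibre_cubic (ys (Suc k)) * vs (Suc k) + poly (pderiv fibre_cubic) (ys (Suc k)))"
    and f: "\<And>k. poly (poly f [:vs k:]) (ys k) = 0"
  shows "f = 0"
proof (rule ccontr)
  assume "f \<noteq> 0"
  \<comment> \<open>Doubling lowers the index, so a coincidence descends to \<open>ys 0\<close>. The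
    double of \<open>ys 0\<close> is the branch point 0, which is not in the sequence.\<close>
  have "ys j \<noteq> ys (Suc k + j)" for j k
  proof (induction j)
    case 0
    show ?case
    proof
      assume "ys 0 = ys (Suc k + 0)"
      then have "fibre_double (ys 0) = ys k" using y by simp
      moreover have "fibre_double (ys 0) = 0" using y0 by (simp add: fibre_double_def poly_fibre)
      ultimately show False using F[of k] by (simp add: poly_fibre)
    qed
  next
    case (Suc j)
    then show ?case using y by (metis add_Suc_right)
  qed
  then have "ys j \<noteq> ys k" if "j < k" for j k
    using less_imp_Suc_add[OF that] by (metis add.commute add_Suc_right)
  then have inj: "inj ys" by (intro linorder_injI) auto
  define vanish where "vanish g \<longleftrightarrow> (\<forall>k. poly (poly g [:vs k:]) (ys k) = 0)" for g :: "complex poly poly"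
  obtain g where g: "g \<noteq> 0" "vanish g" and min: "\<And>h. h \<noteq> 0 \<Longrightarrow> vanish h \<Longrightarrow> degree g \<le> degree h"
    using ex_has_least_nat[of "\<lambda>g. g \<noteq> 0 \<and> vanish g" f degree] \<open>f \<noteq> 0\<close> f by (auto simp: vanish_def)
  have "degree g \<noteq> 0"
  proof
    assume "degree g = 0"
    then obtain q where q: "g = [:q:]" using degree_eq_zeroE by blast
    then have "range ys \<subseteq> {x. poly q x = 0}" using g by (auto simp: vanish_def)
    moreover have "finite {x. poly q x = 0}" using g q by (intro poly_roots_finite) auto
    ultimately show False using inj finite_subset range_inj_infinite by blast
  qed
  then obtain m where m: "degree g = Suc m" using not0_implies_Suc by blast
  define D where "D = (\<Sum>i\<le>Suc m. degree (coeff g i))"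
  have D: "degree (coeff g i) \<le> D" if "i \<le> Suc m" for i
    unfolding D_def using that by (intro member_le_sum) auto
  \<comment> \<open>This is \<open>g\<close> at the doubled point, times
    \<open>(4 * F) ^ D * fibre_ram ^ Suc m\<close>: the doubled abscissa is a quotient by
    \<open>4 * F\<close>, and the doubled \<open>v\<close> is
    \<open>4 * F * (F' + 4 * F * v) / fibre_ram\<close>.\<close>
  define h where "h = (\<Sum>i\<le>Suc m. [:homog D (coeff g i) * fibre_ram ^ (Suc m - i) * (4 * fibre_cubic) ^ i:] * [:pderiv fibre_cubic, 4 * fibre_cubic:] ^ i)"
  have h0: "poly (poly h [:vs (Suc k):]) (ys (Suc k)) = 0" for k
  proof -
    define z u where "z = ys (Suc k)" and "u = vs (Suc k)"
    have Fz: "poly fibre_cubic z \<noteq> 0" using F z_def by blast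
    have "4 * poly fibre_cubic z * (4 * poly fibre_cubic z * u + poly (pderiv fibre_cubic) z) = vs k * poly fibre_ram z"
      using v[of k] by (simp add: z_def u_def)
    then have e: "4 * poly fibre_cubic z * (poly (pderiv fibre_cubic) z + u * (4 * poly fibre_cubic z)) = vs k * poly fibre_ram z"
      by (simp add: algebra_simps)
    have "poly (poly h [:u:]) z = (\<Sum>i\<le>Suc m. poly (homog D (coeff g i)) z * poly fibre_ram z ^ (Suc m - i)
        * (4 * poly fibre_cubic z * (poly (pderiv fibre_cubic) z + u * (4 * poly fibre_cubic z))) ^ i)"
      unfolding h_def poly_sum poly2_linear_power
      by (intro sum.cong refl) (simp only: poly_mult poly_power poly_numeral power_mult_distrib mult.assoc)
    also have "\<dots> = (\<Sum>i\<le>Suc m. (4 * poly fibre_cubic z) ^ D * poly fibre_ram z ^ Suc m * (poly (coeff g i) (ys k) * vs k ^ i))"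
    proof (rule sum.cong)
      fix i assume "i \<in> {..Suc m}"
      then have i: "i \<le> Suc m" by simp
      then have "poly fibre_ram z ^ (Suc m - i) * poly fibre_ram z ^ i = poly fibre_ram z ^ Suc m"
        by (simp flip: power_add)
      moreover have SS_swap: "w * P * S1 * (x * Si) = w * (S1 * Si) * (P * x)" for w P S1 x Si :: complex
        by simp
      moreover have "poly (homog D (coeff g i)) z = (4 * poly fibre_cubic z) ^ D * poly (coeff g i) (ys k)"
        using poly_homog[OF D[OF i] Fz] y by (simp add: z_def)
      ultimately show "poly (homog D (coeff g i)) z * poly fibre_ram z ^ (Suc m - i)
        * (4 * poly fibre_cubic z * (poly (pderiv fibre_cubic) z + u * (4 * poly fibre_cubic z))) ^ i
        = (4 * poly fibre_cubic z) ^ D * poly fibre_ram z ^ Suc m * (poly (coeff g i) (ys k) * vs k ^ i)"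
        unfolding e power_mult_distrib[of "vs k"] by (metis (no_types, opaque_lifting) SS_swap)
    qed simp
    also have "\<dots> = (4 * poly fibre_cubic z) ^ D * poly fibre_ram z ^ Suc m * poly (poly g [:vs k:]) (ys k)"
      unfolding poly_altdef[of g] m by (simp add: poly_sum sum_distrib_left poly_power del: sum.atMost_Suc power_Suc)
    also have "\<dots> = 0" using g by (simp add: vanish_def)
    finally show ?thesis by (simp add: z_def u_def)
  qed
  have deg_term: "degree ([:homog D (coeff g i) * fibre_ram ^ (Suc m - i) * (4 * fibre_cubic) ^ i:] * [:pderiv fibre_cubic, 4 * fibre_cubic:] ^ i) \<le> i" for i
    by (rule order.trans[OF degree_mult_le]) (use coeff_linear_power(3)[of "pderiv fibre_cubic" "4 * fibre_cubic" i] in simp)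
  have degh: "degree h \<le> Suc m" unfolding h_def
    by (intro degree_sum_le finite_atMost, rule order.trans[OF deg_term]) simp
  define a b where "a = coeff g m" and "b = coeff g (Suc m)"
  have b0: "b \<noteq> 0" using g m by (metis b_def leading_coeff_0_iff)
  have lower: "(\<Sum>i<m. coeff ([:homog D (coeff g i) * fibre_ram ^ (Suc m - i) * (4 * fibre_cubic) ^ i:] * [:pderiv fibre_cubic, 4 * fibre_cubic:] ^ i) j) = 0"
    if "m \<le> j" for j
    by (intro sum.neutral ballI coeff_eq_0, rule le_less_trans[OF deg_term]) (use that in auto)
  have hsplit: "h = (\<Sum>i<m. [:homog D (coeff g i) * fibre_ram ^ (Suc m - i) * (4 * fibre_cubic) ^ i:] * [:pderiv fibre_cubic, 4 * fibre_cubic:] ^ i)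
     + [:homog D a * fibre_ram * (4 * fibre_cubic) ^ m:] * [:pderiv fibre_cubic, 4 * fibre_cubic:] ^ m
     + [:homog D b * (4 * fibre_cubic) ^ Suc m:] * [:pderiv fibre_cubic, 4 * fibre_cubic:] ^ Suc m"
  proof -
    have "{..Suc m} = insert (Suc m) (insert m {..<m})" by auto
    then show ?thesis unfolding h_def a_def b_def by (simp add: Suc_diff_le add_ac del: power_Suc)
  qed
  have hm: "coeff h (Suc m) = homog D b * (4 * fibre_cubic) ^ Suc m * (4 * fibre_cubic) ^ Suc m"
    unfolding hsplit coeff_add coeff_sum lower[of "Suc m", OF le_SucI[OF order_refl]]
  proof -
    have "coeff ([:pderiv fibre_cubic, 4 * fibre_cubic:] ^ m) (Suc m) = 0"
      by (intro coeff_eq_0 le_imp_less_Suc coeff_linear_power(3))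
    then show "0 + coeff ([:homog D a * fibre_ram * (4 * fibre_cubic) ^ m:] * [:pderiv fibre_cubic, 4 * fibre_cubic:] ^ m) (Suc m)
      + coeff ([:homog D b * (4 * fibre_cubic) ^ Suc m:] * [:pderiv fibre_cubic, 4 * fibre_cubic:] ^ Suc m) (Suc m)
      = homog D b * (4 * fibre_cubic) ^ Suc m * (4 * fibre_cubic) ^ Suc m"
      using coeff_linear_power(1)[of "pderiv fibre_cubic" "4 * fibre_cubic" "Suc m"] by (simp del: power_Suc)
  qed
  have hm': "coeff h m = homog D a * fibre_ram * (4 * fibre_cubic) ^ m * (4 * fibre_cubic) ^ m
     + homog D b * (4 * fibre_cubic) ^ Suc m * (of_nat (Suc m) * pderiv fibre_cubic * (4 * fibre_cubic) ^ m)"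
    unfolding hsplit coeff_add coeff_sum lower[of m, OF order_refl]
    using coeff_linear_power(1,2)[of "pderiv fibre_cubic" "4 * fibre_cubic" m]
    by (simp del: power_Suc of_nat_Suc)
  \<comment> \<open>Eliminating the top power of \<open>v\<close> between \<open>g\<close> and
    \<open>h\<close> leaves a polynomial of smaller degree than the minimal one.\<close>
  define E where "E = [:coeff h (Suc m):] * g - [:b:] * h"
  have "degree E \<le> Suc m" unfolding E_def
    using degh m by (intro degree_diff_le) (simp_all add: order.trans[OF degree_smult_le])
  moreover have "coeff E (Suc m) = 0" by (simp add: E_def b_def)
  ultimately have degE: "E = 0 \<or> degree E < Suc m"
    by (metis leading_coeff_0_iff order_le_imp_less_or_eq)
  \<comment> \<open>\<open>h\<close> is known to vanish only from index 1 on. The factor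
    \<open>1 + y ^ 2\<close> covers index 0, where \<open>(ys 0) ^ 2 = -1\<close>, without changing
    the degree in \<open>v\<close>.\<close>
  have "vanish ([:[:1, 0, 1:]:] * E)"
    unfolding vanish_def
  proof
    fix k show "poly (poly ([:[:1, 0, 1:]:] * E) [:vs k:]) (ys k) = 0"
    proof (cases k)
      case 0
      have "poly (poly ([:[:1, 0, 1:]:] * E) [:vs 0:]) (ys 0) = (1 + (ys 0)\<^sup>2) * poly (poly E [:vs 0:]) (ys 0)"
        by (simp add: algebra_simps power2_eq_square)
      then show ?thesis using y0 0 by simp
    next
      case (Suc j)
      then show ?thesis using g h0[of j] by (simp add: E_def vanish_def)
    qed
  qed
  moreover have "degree ([:[:1, 0, 1:]:] * E) = degree E" by simp
  ultimately have "[:[:1, 0, 1:]:] * E = 0" using min degE m by (metis linorder_not_less mult_zero_right)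
  then have "E = 0" by (metis mult_eq_0_iff one_neq_zero pCons_eq_0_iff)
  then have "smult (coeff h (Suc m)) g = smult b h" by (simp add: E_def)
  then have "coeff h (Suc m) * a = b * coeff h m"
    unfolding a_def by (metis coeff_smult)
  then have rel: "homog D b * (4 * fibre_cubic) ^ Suc m * (4 * fibre_cubic) ^ Suc m * a
     = b * (homog D a * fibre_ram * (4 * fibre_cubic) ^ m * (4 * fibre_cubic) ^ m
     + homog D b * (4 * fibre_cubic) ^ Suc m * (of_nat (Suc m) * pderiv fibre_cubic * (4 * fibre_cubic) ^ m))"
    unfolding hm hm' .
  show False
  \<comment> \<open>\<open>- a / b\<close> is the sum of the \<open>Suc m\<close> roots of
    \<open>g\<close> in \<open>v\<close>. Under doubling each root contributes one term
    \<open>4 * F * F'\<close>, hence the constant.\<close>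
  proof (rule fibre_functional_equation_unsolvable[of b "4 * of_nat (Suc m)" a])
    show "b \<noteq> 0" by fact
    show "(4 * of_nat (Suc m) :: complex) \<noteq> 0" by (simp del: of_nat_Suc)
    fix y assume F: "poly fibre_cubic y \<noteq> 0"
    define p where "p = poly fibre_cubic y"
    have ha: "poly (homog D a) y = (4 * p) ^ D * poly a (fibre_double y)"
      "poly (homog D b) y = (4 * p) ^ D * poly b (fibre_double y)"
      using poly_homog[OF D F] by (simp_all add: a_def b_def p_def)
    have "((4 * p) ^ D * (4 * p) ^ m * (4 * p) ^ m) * (poly b (fibre_double y) * (16 * p\<^sup>2 * poly a y))
      = ((4 * p) ^ D * (4 * p) ^ m * (4 * p) ^ m) *
        (poly b y * (poly a (fibre_double y) * poly fibre_ram y + 4 * of_nat (Suc m) * poly b (fibre_double y) * p * poly (pderiv fibre_cubic) y))"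
      using arg_cong[OF rel, of "\<lambda>q. poly q y"] unfolding poly_mult poly_add poly_power poly_numeral poly_of_nat ha p_def[symmetric]
      by (simp add: algebra_simps power2_eq_square del: of_nat_Suc)
    then show "poly b (fibre_double y) * (16 * (poly fibre_cubic y)\<^sup>2 * poly a y) = poly b y *
           (poly a (fibre_double y) * poly fibre_ram y + 4 * of_nat (Suc m) * poly b (fibre_double y) * poly fibre_cubic y * poly (pderiv fibre_cubic) y)"
      using F by (simp add: p_def[symmetric])
  qed
qed

section \<open>Torsion points as power series solutions\<close>

text \<open>The base is pulled back along \<open>t = \<tau>\<^sup>2\<close> and expanded at \<open>\<tau> = \<i>\<close>, i.e. \<open>t = -1\<close>; then the point of order 4
  with abscissa \<open>y = \<tau>\<close> starts the sequence of solutions.\<close>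

definition fps_tau :: "complex fps" where "fps_tau = fps_const \<i> + fps_X"
definition fps_T :: "complex fps" where "fps_T = fps_tau\<^sup>2"
text \<open>This is \<open>2 * t * (t - 1) * d/dt\<close> lifted along \<open>t = tau ^ 2\<close>,
  since \<open>d/dt = 1 / (2 * tau) * d/dtau\<close>.\<close>

definition fps_D :: "complex fps \<Rightarrow> complex fps" where
  "fps_D f = fps_tau * (fps_tau\<^sup>2 - 1) * fps_deriv f"

lemma fps_D_add: "fps_D (f + g) = fps_D f + fps_D g"
  and fps_D_diff: "fps_D (f - g) = fps_D f - fps_D g"
  and fps_D_mult: "fps_D (f * g) = fps_D f * g + f * fps_D g"
  and fps_D_const: "fps_D (fps_const c) = 0"
  and fps_D_numeral: "fps_D (numeral n) = 0" and fps_D_one: "fps_D 1 = 0"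
  and fps_D_tau: "fps_D fps_tau = fps_tau * (fps_tau\<^sup>2 - 1)"
  by (simp_all add: fps_D_def algebra_simps fps_tau_def)

lemma fps_D_square: "fps_D (f\<^sup>2) = 2 * f * fps_D f"
  by (simp add: power2_eq_square fps_D_mult algebra_simps)

lemma fps_D_T: "fps_D fps_T = 2 * fps_T * (fps_T - 1)"
  unfolding fps_T_def fps_D_square fps_D_tau by (simp add: power2_eq_square algebra_simps)

lemma fps_T_nth_0: "fps_T $ 0 = -1"
  by (simp add: fps_T_def fps_tau_def power2_eq_square fps_mult_nth_0)

lemma fps_sqrt_ex:
  fixes a :: "complex fps"
  assumes "a $ 0 \<noteq> 0"
  obtains r where "r\<^sup>2 = a" "r $ 0 \<noteq> 0"
proof -
  define r where "r = fps_radical (\<lambda>_. csqrt) (Suc 1) a"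
  have "r ^ Suc 1 = a"
    unfolding r_def using assms by (subst power_radical[symmetric]) (auto simp flip: power2_eq_square)
  then have "r\<^sup>2 = a" by (simp add: power2_eq_square)
  moreover have "r $ 0 \<noteq> 0" using assms by (simp add: r_def)
  ultimately show thesis using that by blast
qed

text \<open>\<open>A\<close>, \<open>B\<close>, \<open>C\<close> are square roots of \<open>y\<close>, \<open>y - 1\<close>, \<open>y - T\<close>, so that \<open>A * B * C\<close> is
  the ordinate of the point with abscissa \<open>y\<close>, and \<open>V\<close> is the coordinate on the vector extension.
  In these coordinates halving a point is almost linear.\<close>

definition torsion_quad :: "complex fps \<Rightarrow> complex fps \<Rightarrow> complex fps \<Rightarrow> complex fps \<Rightarrow> bool" where
  "torsion_quad A B C V \<longleftrightarrow> A\<^sup>2 - B\<^sup>2 = 1 \<and> A\<^sup>2 - C\<^sup>2 = fps_T \<and> A $ 0 \<noteq> 0 \<and> B $ 0 \<noteq> 0 \<and> C $ 0 \<noteq> 0 \<and>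
     fps_D A = A * B\<^sup>2 + B * C * V \<and> fps_D B = A\<^sup>2 * B + A * C * V \<and>
     fps_D C = C * (A\<^sup>2 + B\<^sup>2 - C\<^sup>2) + A * B * V \<and> fps_D V = - (C\<^sup>2 * V) - A * B * C"

text \<open>The double of a point with abscissa \<open>y\<close> has abscissa
  \<open>(y ^ 2 - t) ^ 2 / (4 * F)\<close>, so \<open>y = tau\<close> doubles to the 2-torsion point
  over 0 and has order 4.\<close>

lemma torsion_quad_start: "\<exists>A B C V. torsion_quad A B C V \<and> A\<^sup>2 = fps_tau"
proof -
  obtain A where A: "A\<^sup>2 = fps_tau" "A $ 0 \<noteq> 0"
    using fps_sqrt_ex[of fps_tau] by (auto simp: fps_tau_def)
  obtain B where B: "B\<^sup>2 = fps_tau - 1" "B $ 0 \<noteq> 0"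
    using fps_sqrt_ex[of "fps_tau - 1"] by (auto simp: fps_tau_def complex_eq_iff)
  define j where "j = fps_const \<i>"
  have j2: "j * j = -1" by (simp add: j_def fps_const_neg[symmetric] del: fps_const_neg)
  have jj: "j * (j * x) = - x" for x by (metis j2 mult.assoc mult_minus1)
  have h: "2 * (fps_const (1/2) * x) = x" for x :: "complex fps"
  proof -
    have "2 = fps_const (2::complex)" by (simp add: numeral_fps_const)
    then have "2 * fps_const (1/2::complex) = 1" by (simp del: fps_const_mult add: fps_const_mult[symmetric]) 
    then show ?thesis by (metis mult.assoc mult_1)
  qed
  have Dj: "fps_D j = 0" by (simp add: j_def fps_D_const)
  \<comment> \<open>\<open>C\<close> is a root of \<open>y - t = tau - tau ^ 2\<close>, and
    \<open>V\<close> is then forced by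
    \<open>y' = 2 * y * (y - 1) + 2 * A * B * C * V\<close>.\<close>
  define C where "C = j * A * B"
  define V where "V = - (fps_const (1/2) * j * B\<^sup>2)"
  have B2: "B\<^sup>2 = A\<^sup>2 - 1" using A B by simp
  have b3: "B\<^sup>2 + 2 = A\<^sup>2 + 1" using B2 by simp
  have dA: "2 * A * fps_D A = A\<^sup>2 * B\<^sup>2 * (A\<^sup>2 + 1)"
    using arg_cong[OF A(1), of fps_D] unfolding fps_D_square fps_D_tau unfolding B2 A(1)[symmetric]
    by (simp add: algebra_simps power2_eq_square)
  have dB: "2 * B * fps_D B = A\<^sup>2 * B\<^sup>2 * (A\<^sup>2 + 1)"
    using arg_cong[OF B(1), of fps_D] unfolding fps_D_square fps_D_tau fps_D_diff fps_D_one unfolding B2 A(1)[symmetric]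
    by (simp add: algebra_simps power2_eq_square)
  have V2: "2 * V = - (j * B\<^sup>2)" unfolding V_def using h[of "j * B\<^sup>2"] by (simp add: mult.assoc)
  have A0: "A \<noteq> 0" "B \<noteq> 0" using A B by auto
  \<comment> \<open>Only the derivatives of the squares are known, so the identity is shown after
    multiplication by \<open>2 * A\<close>, which is cancelled afterwards.\<close>
  have "2 * A * fps_D A = 2 * A * (A * B\<^sup>2 + B * C * V)"
  proof -
    have "2 * A * (A * B\<^sup>2 + B * C * V) = 2 * A\<^sup>2 * B\<^sup>2 + A * B * C * (2 * V)"
      by (simp add: algebra_simps power2_eq_square)
    also have "\<dots> = A\<^sup>2 * B\<^sup>2 * (B\<^sup>2 + 2)"
      unfolding V2 C_def by (simp add: algebra_simps power2_eq_square j2 jj)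
    finally show ?thesis unfolding b3 dA by (rule sym)
  qed
  then have 1: "fps_D A = A * B\<^sup>2 + B * C * V" using A0 by simp
  have "2 * B * fps_D B = 2 * B * (A\<^sup>2 * B + A * C * V)"
  proof -
    have "2 * B * (A\<^sup>2 * B + A * C * V) = 2 * A\<^sup>2 * B\<^sup>2 + A * B * C * (2 * V)"
      by (simp add: algebra_simps power2_eq_square)
    also have "\<dots> = A\<^sup>2 * B\<^sup>2 * (B\<^sup>2 + 2)"
      unfolding V2 C_def by (simp add: algebra_simps power2_eq_square j2 jj)
    finally show ?thesis unfolding b3 dB by (rule sym)
  qed
  then have 2: "fps_D B = A\<^sup>2 * B + A * C * V" using A0 by simp
  have C2: "C\<^sup>2 = - (A\<^sup>2 * B\<^sup>2)" unfolding C_def by (simp add: power2_eq_square algebra_simps j2 jj)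
  have "fps_D C = j * (fps_D A * B + A * fps_D B)"
    unfolding C_def by (simp add: fps_D_mult Dj algebra_simps)
  also have "\<dots> = C * (B\<^sup>2 + A\<^sup>2) + j * C * V * (A\<^sup>2 + B\<^sup>2)"
    unfolding 1 2 C_def by (simp add: algebra_simps power2_eq_square)
  also have "j * C * V * (A\<^sup>2 + B\<^sup>2) = A * B * V - C * C\<^sup>2"
  proof -
    have "2 * (j * C * V * (A\<^sup>2 + B\<^sup>2)) = j * C * (2 * V) * (A\<^sup>2 + B\<^sup>2)" by simp
    also have "\<dots> = C * B\<^sup>2 * (A\<^sup>2 + B\<^sup>2)" unfolding V2 by (simp add: algebra_simps j2 jj)
    also have "\<dots> = A * B * (2 * V) - 2 * C * C\<^sup>2"
    proof -
      have "A * B * (2 * V) = - C * B\<^sup>2" unfolding V2 C_def by (simp add: algebra_simps)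
      then show ?thesis unfolding C2 B2 by (simp add: algebra_simps power2_eq_square)
    qed
    finally have "2 * (j * C * V * (A\<^sup>2 + B\<^sup>2)) = 2 * (A * B * V - C * C\<^sup>2)" by (simp add: algebra_simps)
    then show ?thesis by (metis mult_left_cancel zero_neq_numeral)
  qed
  finally have 3: "fps_D C = C * (A\<^sup>2 + B\<^sup>2 - C\<^sup>2) + A * B * V" by (simp add: algebra_simps)
  have "2 * fps_D V = fps_D (2 * V)" by (simp add: fps_D_mult fps_D_numeral)
  also have "\<dots> = - (j * (2 * B * fps_D B))"
  proof -
    have "fps_D (- (j * B\<^sup>2)) = fps_D (0 - j * B\<^sup>2)" by simp
    also have "\<dots> = - (j * (2 * B * fps_D B))"
      unfolding fps_D_diff fps_D_mult Dj fps_D_square using fps_D_const[of 0] by simp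
    finally show ?thesis unfolding V2 .
  qed
  also have "\<dots> = - (j * (A\<^sup>2 * B\<^sup>2 * (B\<^sup>2 + 2)))" unfolding dB b3 ..
  also have "\<dots> = - (C\<^sup>2 * (2 * V)) - 2 * A * B * C"
    unfolding V2 C2 unfolding C_def by (simp add: algebra_simps power2_eq_square)
  also have "\<dots> = 2 * (- (C\<^sup>2 * V) - A * B * C)" by (simp add: algebra_simps)
  finally have 4: "fps_D V = - (C\<^sup>2 * V) - A * B * C" by (metis mult_left_cancel zero_neq_numeral)
  have "C $ 0 \<noteq> 0" using A B by (simp add: C_def j_def fps_mult_nth_0)
  moreover have "A\<^sup>2 - C\<^sup>2 = fps_T"
    unfolding C2 B2 fps_T_def A(1)[symmetric] by (simp add: power2_eq_square algebra_simps)
  ultimately show ?thesis using A B B2 1 2 3 4 unfolding torsion_quad_def by (metis add_diff_cancel_left' diff_add_cancel)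
qed

text \<open>Halving on a cubic with full 2-torsion: \<open>(A + B) * (A + C)\<close> is the abscissa
  of a half, and subtracting \<open>1 = (A + B) * (A - B)\<close> or
  \<open>t = (A + C) * (A - C)\<close> yields the other two products of pairs among
  \<open>A + B\<close>, \<open>A + C\<close>, \<open>B + C\<close>. Roots of these three sums
  therefore give the new triple, and the differential equations persist when
  \<open>A + B + C\<close> is subtracted from \<open>V\<close> and the result halved.\<close>

lemma torsion_quad_halve:
  assumes "torsion_quad A B C V"
  shows "\<exists>A' B' C' V'. torsion_quad A' B' C' V' \<and> A'\<^sup>2 = (A + B) * (A + C) \<and>
     A' * B' * C' = (A + B) * (A + C) * (B + C) \<and> V = 2 * V' + A + B + C"
proof -
  have AB: "A\<^sup>2 - B\<^sup>2 = 1" and AC: "A\<^sup>2 - C\<^sup>2 = fps_T"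
    and dA: "fps_D A = A * B\<^sup>2 + B * C * V" and dB: "fps_D B = A\<^sup>2 * B + A * C * V"
    and dC: "fps_D C = C * (A\<^sup>2 + B\<^sup>2 - C\<^sup>2) + A * B * V" and dV: "fps_D V = - (C\<^sup>2 * V) - A * B * C"
    using assms by (auto simp: torsion_quad_def)
  have BC: "B\<^sup>2 - C\<^sup>2 = fps_T - 1" using AB AC by (simp add: algebra_simps)
  \<comment> \<open>The three sums divide 1, \<open>t\<close> and \<open>t - 1\<close>, which are
    units at \<open>t = -1\<close>, so they have power series square roots.\<close>
  have "(A + B) * (A - B) = 1" using AB by (simp add: algebra_simps power2_eq_square)
  then have "((A + B) * (A - B)) $ 0 \<noteq> 0" by simp
  then have ab: "(A + B) $ 0 \<noteq> 0" by (simp add: fps_mult_nth_0)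
  have "(A + C) * (A - C) = fps_T" using AC by (simp add: algebra_simps power2_eq_square)
  then have "((A + C) * (A - C)) $ 0 \<noteq> 0" by (simp add: fps_T_nth_0)
  then have ac: "(A + C) $ 0 \<noteq> 0" by (simp add: fps_mult_nth_0)
  have "(B + C) * (B - C) = fps_T - 1" using BC by (simp add: algebra_simps power2_eq_square)
  then have "((B + C) * (B - C)) $ 0 \<noteq> 0" by (simp add: fps_T_nth_0)
  then have bc: "(B + C) $ 0 \<noteq> 0" by (simp add: fps_mult_nth_0)
  obtain P where P: "P\<^sup>2 = A + B" "P $ 0 \<noteq> 0" using fps_sqrt_ex[OF ab] .
  obtain Q where Q: "Q\<^sup>2 = A + C" "Q $ 0 \<noteq> 0" using fps_sqrt_ex[OF ac] .
  obtain R where R: "R\<^sup>2 = B + C" "R $ 0 \<noteq> 0" using fps_sqrt_ex[OF bc] .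
  define A' B' C' where "A' = P * Q" and "B' = P * R" and "C' = Q * R"
  define V' where "V' = fps_const (1/2) * (V - A - B - C)"
  have "2 = fps_const (2::complex)" by (simp add: numeral_fps_const)
  then have "2 * fps_const (1/2::complex) = 1" by (simp del: fps_const_mult add: fps_const_mult[symmetric])
  then have V'2: "2 * V' = V - A - B - C" unfolding V'_def by (metis mult.assoc mult_1)
  have sq: "A'\<^sup>2 = (A + B) * (A + C)" "B'\<^sup>2 = (A + B) * (B + C)" "C'\<^sup>2 = (A + C) * (B + C)"
    unfolding A'_def B'_def C'_def power_mult_distrib P Q R by simp_all
  have s: "A' * B' * C' = (A + B) * (A + C) * (B + C)"
    unfolding P(1)[symmetric] Q(1)[symmetric] R(1)[symmetric] A'_def B'_def C'_def
    by (simp add: power2_eq_square algebra_simps)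
  have nz: "A' \<noteq> 0" "B' \<noteq> 0" "C' \<noteq> 0" using P Q R by (auto simp: A'_def B'_def C'_def)
  have 1: "2 * A' * fps_D A' = 2 * A' * (A' * B'\<^sup>2 + B' * C' * V')"
  proof -
    have "2 * A' * (A' * B'\<^sup>2 + B' * C' * V') = 2 * A'\<^sup>2 * B'\<^sup>2 + A' * B' * C' * (2 * V')"
      by (simp add: algebra_simps power2_eq_square)
    also have "\<dots> = fps_D (A'\<^sup>2)" unfolding sq s V'2 fps_D_mult fps_D_add dA dB dC
      by (simp add: algebra_simps power2_eq_square)
    finally show ?thesis unfolding fps_D_square by (rule sym)
  qed
  have 2: "2 * B' * fps_D B' = 2 * B' * (A'\<^sup>2 * B' + A' * C' * V')"
  proof -
    have "2 * B' * (A'\<^sup>2 * B' + A' * C' * V') = 2 * A'\<^sup>2 * B'\<^sup>2 + A' * B' * C' * (2 * V')"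
      by (simp add: algebra_simps power2_eq_square)
    also have "\<dots> = fps_D (B'\<^sup>2)" unfolding sq s V'2 fps_D_mult fps_D_add dA dB dC
      by (simp add: algebra_simps power2_eq_square)
    finally show ?thesis unfolding fps_D_square by (rule sym)
  qed
  have 3: "2 * C' * fps_D C' = 2 * C' * (C' * (A'\<^sup>2 + B'\<^sup>2 - C'\<^sup>2) + A' * B' * V')"
  proof -
    have "2 * C' * (C' * (A'\<^sup>2 + B'\<^sup>2 - C'\<^sup>2) + A' * B' * V') = 2 * C'\<^sup>2 * (A'\<^sup>2 + B'\<^sup>2 - C'\<^sup>2) + A' * B' * C' * (2 * V')"
      by (simp add: algebra_simps power2_eq_square)
    also have "\<dots> = fps_D (C'\<^sup>2)" unfolding sq s V'2 fps_D_mult fps_D_add dA dB dC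
      by (simp add: algebra_simps power2_eq_square)
    finally show ?thesis unfolding fps_D_square by (rule sym)
  qed
  have d4: "fps_D A' = A' * B'\<^sup>2 + B' * C' * V'" "fps_D B' = A'\<^sup>2 * B' + A' * C' * V'"
    "fps_D C' = C' * (A'\<^sup>2 + B'\<^sup>2 - C'\<^sup>2) + A' * B' * V'"
    using 1 2 3 nz by simp_all
  have "2 * fps_D V' = fps_D (2 * V')" by (simp add: fps_D_mult fps_D_numeral)
  also have "\<dots> = - (C'\<^sup>2 * (2 * V')) - 2 * (A' * B' * C')"
    unfolding sq s V'2 fps_D_diff dA dB dC dV by (simp add: algebra_simps power2_eq_square)
  also have "\<dots> = 2 * (- (C'\<^sup>2 * V') - A' * B' * C')" by (simp add: algebra_simps)
  finally have 4: "fps_D V' = - (C'\<^sup>2 * V') - A' * B' * C'" by (metis mult_left_cancel zero_neq_numeral)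
  have "A'\<^sup>2 - B'\<^sup>2 = 1" "A'\<^sup>2 - C'\<^sup>2 = fps_T"
    unfolding sq AB[symmetric] AC[symmetric] by (simp_all add: algebra_simps power2_eq_square)
  then have "torsion_quad A' B' C' V'"
    unfolding torsion_quad_def using d4 4 P Q R
    by (simp add: A'_def B'_def C'_def fps_mult_nth_0)
  moreover have "V = 2 * V' + A + B + C" using V'2 by simp
  ultimately show ?thesis using sq s by blast
qed

text \<open>The equation for \<open>v\<close> comes from differentiating \<open>v * s = V\<close>
  with \<open>s = A * B * C\<close>. The roots enter only through their squares and one overall
  factor \<open>s\<close>, so after cancelling \<open>s\<close> a polynomial in \<open>y\<close>,
  \<open>v\<close> and \<open>t\<close> remains.\<close>

lemma torsion_quad_solution:
  assumes q: "torsion_quad A B C V" and v: "v = V * inverse (A * B * C)" and y: "y = A\<^sup>2"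
  shows "fps_D y = 2 * y * (y - 1) * (1 + (y - fps_T) * v)"
    "fps_D v = - 1 - (4 * y - 2) * v - (3 * y\<^sup>2 - 2 * (1 + fps_T) * y + fps_T) * v\<^sup>2"
    "v * (A * B * C) = V"
proof -
  have AB: "A\<^sup>2 - B\<^sup>2 = 1" and AC: "A\<^sup>2 - C\<^sup>2 = fps_T"
    and dA: "fps_D A = A * B\<^sup>2 + B * C * V" and dB: "fps_D B = A\<^sup>2 * B + A * C * V"
    and dC: "fps_D C = C * (A\<^sup>2 + B\<^sup>2 - C\<^sup>2) + A * B * V" and dV: "fps_D V = - (C\<^sup>2 * V) - A * B * C"
    and nz: "A $ 0 \<noteq> 0" "B $ 0 \<noteq> 0" "C $ 0 \<noteq> 0"
    using q by (auto simp: torsion_quad_def)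
  define s where "s = A * B * C"
  have s0: "s $ 0 \<noteq> 0" using nz by (simp add: s_def fps_mult_nth_0)
  have "v * s = V * (inverse s * s)" by (simp add: v s_def mult.assoc)
  then have vs: "v * s = V" using inverse_mult_eq_1[OF s0] by simp
  then show "v * (A * B * C) = V" by (simp add: s_def)
  have ys: "y - 1 = B\<^sup>2" "y - fps_T = C\<^sup>2" using AB AC y by (simp_all add: algebra_simps)
  have "fps_D y = 2 * A\<^sup>2 * B\<^sup>2 + 2 * s * V" unfolding y fps_D_square dA s_def by (simp add: algebra_simps power2_eq_square)
  also have "\<dots> = 2 * y * (y - 1) * (1 + (y - fps_T) * v)"
    unfolding ys unfolding y vs[symmetric] s_def by (simp add: algebra_simps power2_eq_square)
  finally show "fps_D y = 2 * y * (y - 1) * (1 + (y - fps_T) * v)" .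
  define F' where "F' = A\<^sup>2 * B\<^sup>2 + A\<^sup>2 * C\<^sup>2 + B\<^sup>2 * C\<^sup>2"
  have F': "3 * y\<^sup>2 - 2 * (1 + fps_T) * y + fps_T = F'"
    unfolding F'_def ys[symmetric] y[symmetric] by (simp add: algebra_simps power2_eq_square)
  have y42: "4 * y - 2 = 2 * A\<^sup>2 + 2 * B\<^sup>2" unfolding ys(1)[symmetric] y[symmetric] by (simp add: algebra_simps)
  have ds: "fps_D s = s * (2 * A\<^sup>2 + 2 * B\<^sup>2 - C\<^sup>2) + V * F'"
    unfolding s_def F'_def fps_D_mult dA dB dC by (simp add: algebra_simps power2_eq_square)
  have "fps_D v * s = fps_D V - v * fps_D s" using fps_D_mult[of v s] vs by (simp add: algebra_simps)
  also have "\<dots> = s * (- 1 - (4 * y - 2) * v - F' * v\<^sup>2)"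
    unfolding dV ds y42 s_def[symmetric] unfolding vs[symmetric] by (simp add: algebra_simps power2_eq_square)
  finally show "fps_D v = - 1 - (4 * y - 2) * v - (3 * y\<^sup>2 - 2 * (1 + fps_T) * y + fps_T) * v\<^sup>2"
    using s0 unfolding F' by (metis fps_nonzero_nth mult.commute mult_left_cancel)
qed

text \<open>The last two properties are the doubling formulas for the abscissa and for
  \<open>v\<close>, written without denominators so that they can be reduced to
  \<open>t = -1\<close>. They follow from \<open>z ^ 2 - t = 2 * a * s\<close> and its two
  analogues, where \<open>a\<close>, \<open>b\<close>, \<open>c\<close> are the roots at the doubled
  point and \<open>s\<close> is the ordinate of the half.\<close>

lemma algebraic_solutions:
  obtains ys us :: "nat \<Rightarrow> complex fps" where "ys 0 = fps_tau"
    "\<And>k. fps_D (ys k) = 2 * ys k * (ys k - 1) * (1 + (ys k - fps_T) * us k)"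
    "\<And>k. fps_D (us k) = - 1 - (4 * ys k - 2) * us k - (3 * (ys k)\<^sup>2 - 2 * (1 + fps_T) * ys k + fps_T) * (us k)\<^sup>2"
    "\<And>k. (ys k * (ys k - 1) * (ys k - fps_T)) $ 0 \<noteq> 0"
    "\<And>k z. z = ys (Suc k) \<Longrightarrow> 4 * (z * (z - 1) * (z - fps_T)) * ys k = (z\<^sup>2 - fps_T)\<^sup>2"
    "\<And>k z. z = ys (Suc k) \<Longrightarrow> us k * ((z\<^sup>2 - fps_T) * (z\<^sup>2 - 2 * z + fps_T) * (z\<^sup>2 - 2 * fps_T * z + fps_T))
        = 4 * (z * (z - 1) * (z - fps_T)) * (4 * (z * (z - 1) * (z - fps_T)) * us (Suc k)
          + (3 * z\<^sup>2 - 2 * (1 + fps_T) * z + fps_T))"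
proof -
  define tq where "tq x = (case x of (A, B, C, V) \<Rightarrow> torsion_quad A B C V)" for x
  define step where "step x x' = (case x of (A, B, C, V) \<Rightarrow> case x' of (A', B', C', V') \<Rightarrow>
     A'\<^sup>2 = (A + B) * (A + C) \<and> A' * B' * C' = (A + B) * (A + C) * (B + C) \<and> V = 2 * V' + A + B + C)"
    for x x' :: "complex fps \<times> complex fps \<times> complex fps \<times> complex fps"
  obtain x0 where x0: "tq x0" "(fst x0)\<^sup>2 = fps_tau"
    using torsion_quad_start by (auto simp: tq_def)
  have "\<exists>x'. tq x' \<and> step x x'" if "tq x" for x
    using torsion_quad_halve that unfolding tq_def step_def by (auto split: prod.splits)
  then obtain nxt where nxt: "\<And>x. tq x \<Longrightarrow> tq (nxt x) \<and> step x (nxt x)" by metis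
  define q where "q k = (nxt ^^ k) x0" for k
  have q: "tq (q k)" for k by (induction k) (auto simp: q_def x0 nxt)
  have qs: "step (q k) (q (Suc k))" for k using nxt[OF q[of k]] by (simp add: q_def)
  define A B C V where "A k = fst (q k)" and "B k = fst (snd (q k))" and "C k = fst (snd (snd (q k)))"
    and "V k = snd (snd (snd (q k)))" for k
  have tq: "torsion_quad (A k) (B k) (C k) (V k)" for k
    using q[of k] by (simp add: tq_def A_def B_def C_def V_def split: prod.splits)
  have st: "(A (Suc k))\<^sup>2 = (A k + B k) * (A k + C k)"
    "A (Suc k) * B (Suc k) * C (Suc k) = (A k + B k) * (A k + C k) * (B k + C k)"
    "V k = 2 * V (Suc k) + A k + B k + C k" for k
    using qs[of k] by (simp_all add: step_def A_def B_def C_def V_def split: prod.splits)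
  define ys where "ys k = (A k)\<^sup>2" for k
  define us where "us k = V k * inverse (A k * B k * C k)" for k
  have AB: "(A k)\<^sup>2 - (B k)\<^sup>2 = 1" "(A k)\<^sup>2 - (C k)\<^sup>2 = fps_T" "A k $ 0 \<noteq> 0" "B k $ 0 \<noteq> 0" "C k $ 0 \<noteq> 0" for k
    using tq[of k] by (auto simp: torsion_quad_def)
  have F: "ys k * (ys k - 1) * (ys k - fps_T) = (A k * B k * C k)\<^sup>2" for k
  proof -
    have "ys k - 1 = (B k)\<^sup>2" "ys k - fps_T = (C k)\<^sup>2" using AB[of k] by (simp_all add: ys_def algebra_simps)
    then show ?thesis by (simp add: ys_def power_mult_distrib)
  qed
  show thesis
  proof
    show "ys 0 = fps_tau" using x0 by (simp add: ys_def A_def q_def)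
    show "fps_D (ys k) = 2 * ys k * (ys k - 1) * (1 + (ys k - fps_T) * us k)"
      "fps_D (us k) = - 1 - (4 * ys k - 2) * us k - (3 * (ys k)\<^sup>2 - 2 * (1 + fps_T) * ys k + fps_T) * (us k)\<^sup>2" for k
      using torsion_quad_solution[OF tq[of k] us_def ys_def] by simp_all
    show "(ys k * (ys k - 1) * (ys k - fps_T)) $ 0 \<noteq> 0" for k
      unfolding F using AB[of k] by (simp add: power2_eq_square fps_mult_nth_0)
    fix k z assume z: "z = ys (Suc k)"
    define a b c s where "a = A k" and "b = B k" and "c = C k" and "s = (a + b) * (a + c) * (b + c)"
    \<comment> \<open>Writing 1 and \<open>t\<close> as differences of squares, and inserting the
      factor \<open>a ^ 2 - b ^ 2 = 1\<close> where degrees differ, makes all formulas homogeneous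
      identities in \<open>a\<close>, \<open>b\<close>, \<open>c\<close>.\<close>
    have T: "fps_T = a\<^sup>2 - c\<^sup>2" and one: "1 = a\<^sup>2 - b\<^sup>2" using AB[of k] by (simp_all add: a_def b_def c_def)
    have z1: "z = (a + b) * (a + c)" using st(1)[of k] by (simp add: z ys_def a_def b_def c_def)
    have z2: "z - 1 = (a + b) * (b + c)" unfolding z1 one by (simp add: algebra_simps power2_eq_square)
    have z3: "z - fps_T = (a + c) * (b + c)" unfolding z1 T by (simp add: algebra_simps power2_eq_square)
    have Fs: "z * (z - 1) * (z - fps_T) = s\<^sup>2" unfolding F[of "Suc k"] z st(2) s_def a_def b_def c_def ..
    have Ta: "fps_T = (a\<^sup>2 - c\<^sup>2) * (a\<^sup>2 - b\<^sup>2)" unfolding one[symmetric] T by simp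
    have p1: "z\<^sup>2 - fps_T = 2 * a * s" unfolding z1 Ta s_def by (simp add: algebra_simps power2_eq_square)
    have p2: "z\<^sup>2 - 2 * z + fps_T = 2 * b * s"
    proof -
      have "z\<^sup>2 - 2 * z + fps_T = (z - 1)\<^sup>2 - 1 + fps_T" by (simp add: algebra_simps power2_eq_square)
      also have "\<dots> = (z - 1)\<^sup>2 - (a\<^sup>2 - b\<^sup>2) * (a\<^sup>2 - b\<^sup>2) + (a\<^sup>2 - c\<^sup>2) * (a\<^sup>2 - b\<^sup>2)"
        using one Ta by simp
      also have "\<dots> = 2 * b * s" unfolding z2 s_def by (simp add: algebra_simps power2_eq_square)
      finally show ?thesis .
    qed
    have p3: "z\<^sup>2 - 2 * fps_T * z + fps_T = 2 * c * s"
    proof -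
      have "z\<^sup>2 - 2 * fps_T * z + fps_T = (z - fps_T)\<^sup>2 - fps_T * fps_T + fps_T" by (simp add: algebra_simps power2_eq_square)
      also have "\<dots> = (z - fps_T)\<^sup>2 - (a\<^sup>2 - c\<^sup>2) * (a\<^sup>2 - c\<^sup>2) + (a\<^sup>2 - c\<^sup>2) * (a\<^sup>2 - b\<^sup>2)"
        using Ta T by simp
      also have "\<dots> = 2 * c * s" unfolding z3 s_def by (simp add: algebra_simps power2_eq_square)
      finally show ?thesis .
    qed
    show "4 * (z * (z - 1) * (z - fps_T)) * ys k = (z\<^sup>2 - fps_T)\<^sup>2"
      unfolding Fs p1 ys_def a_def by (simp add: power_mult_distrib)
    have F': "3 * z\<^sup>2 - 2 * (1 + fps_T) * z + fps_T = 2 * s * (a + b + c)"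
    proof -
      have "3 * z\<^sup>2 - 2 * (1 + fps_T) * z + fps_T = z * (z - 1) + z * (z - fps_T) + (z - 1) * (z - fps_T)"
        by (simp add: algebra_simps power2_eq_square)
      also have "\<dots> = 2 * s * (a + b + c)" unfolding z3 z2 unfolding z1 s_def by (simp add: algebra_simps power2_eq_square)
      finally show ?thesis .
    qed
    have u1: "us k * (a * b * c) = V k"
      using torsion_quad_solution(3)[OF tq[of k] us_def ys_def] by (simp add: a_def b_def c_def)
    have u2: "us (Suc k) * s = V (Suc k)"
      using torsion_quad_solution(3)[OF tq[of "Suc k"] us_def ys_def] by (simp add: st(2) s_def a_def b_def c_def)
    have "us k * ((2 * a * s) * (2 * b * s) * (2 * c * s)) = 8 * s ^ 3 * (us k * (a * b * c))"
      by (simp add: algebra_simps power3_eq_cube)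
    also have "\<dots> = 8 * s ^ 3 * (2 * (us (Suc k) * s) + a + b + c)" unfolding u1 u2 unfolding st(3)[of k] a_def b_def c_def by simp
    also have "\<dots> = 4 * s\<^sup>2 * (4 * s\<^sup>2 * us (Suc k) + 2 * s * (a + b + c))"
      by (simp add: algebra_simps power3_eq_cube power2_eq_square)
    finally show "us k * ((z\<^sup>2 - fps_T) * (z\<^sup>2 - 2 * z + fps_T) * (z\<^sup>2 - 2 * fps_T * z + fps_T))
        = 4 * (z * (z - 1) * (z - fps_T)) * (4 * (z * (z - 1) * (z - fps_T)) * us (Suc k)
          + (3 * z\<^sup>2 - 2 * (1 + fps_T) * z + fps_T))"
      unfolding Fs p1 p2 p3 F' .
  qed
qed

section \<open>The vector field and its invariant curves\<close>

definition t_deriv :: "complex poly \<Rightarrow> complex poly" where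
  "t_deriv r = [:0, -2, 2:] * pderiv r"
definition yy :: "complex poly poly" where "yy = [:0, 1:]"
definition yt :: "complex poly poly" where "yt = [:[:0, 1:]:]"
definition cubic :: "complex poly poly" where "cubic = yy * (yy - 1) * (yy - yt)"
definition D0 :: "complex poly poly \<Rightarrow> complex poly poly" where
  "D0 q = map_poly t_deriv q + 2 * yy * (yy - 1) * pderiv q"
definition D1 :: "complex poly poly \<Rightarrow> complex poly poly" where
  "D1 q = 2 * cubic * pderiv q"

text \<open>\<open>vfield\<close> is the derivation with \<open>t' = 2 t (t - 1)\<close>, \<open>y' = 2 y (y - 1) + 2 F v\<close> and
  \<open>v' = - 1 - (4 y - 2) v - F' v\<^sup>2\<close>; on \<open>\<complex>[t, y]\<close> it is \<open>D0 + v D1\<close>.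
  The innermost variable is \<open>t\<close>, the outermost one \<open>v\<close>.\<close>

definition vfield :: "complex poly poly poly \<Rightarrow> complex poly poly poly" where
  "vfield p = map_poly D0 p + [:0, 1:] * map_poly D1 p + [:-1, 2 - 4 * yy, - pderiv cubic:] * pderiv p"

lemma derivation_t_deriv: "derivation t_deriv"
  unfolding t_deriv_def[abs_def] by (intro derivation_scale derivation_pderiv)

lemma derivation_D0: "derivation D0"
  unfolding D0_def[abs_def]
  by (intro derivation_add derivation_map_poly derivation_t_deriv derivation_scale derivation_pderiv)

lemma derivation_D1: "derivation D1"
  unfolding D1_def[abs_def] by (intro derivation_scale derivation_pderiv)

lemma derivation_vfield: "derivation vfield"
  unfolding vfield_def[abs_def]
  by (intro derivation_add derivation_map_poly derivation_D0 derivation_D1 derivation_scale derivation_pderiv)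

lemma pderiv_cubic: "pderiv cubic = 3 * yy\<^sup>2 - 2 * (1 + yt) * yy + yt"
proof -
  have d: "pderiv yy = 1" "pderiv yt = 0" by (simp_all add: yy_def yt_def pderiv_pCons)
  show ?thesis unfolding cubic_def pderiv_mult pderiv_diff pderiv_1 d
    by (simp add: algebra_simps power2_eq_square)
qed

section \<open>Evaluation along a power series solution\<close>

definition ev_t :: "complex poly \<Rightarrow> complex fps" where "ev_t = poly_ev fps_const fps_T"
definition ev_y :: "complex fps \<Rightarrow> complex poly poly \<Rightarrow> complex fps" where "ev_y y = poly_ev ev_t y"
definition ev_v :: "complex fps \<Rightarrow> complex fps \<Rightarrow> complex poly poly poly \<Rightarrow> complex fps" where
  "ev_v y v = poly_ev (ev_y y) v"

lemma unital_hom_ev: "unital_hom ev_t" "unital_hom (ev_y y)" "unital_hom (ev_v y v)"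
proof -
  have "unital_hom (fps_const :: complex \<Rightarrow> complex fps)" by (simp add: unital_hom_def)
  then show 1: "unital_hom ev_t" unfolding ev_t_def by (rule unital_hom_poly_ev)
  then show 2: "unital_hom (ev_y y)" unfolding ev_y_def by (rule unital_hom_poly_ev)
  then show "unital_hom (ev_v y v)" unfolding ev_v_def by (rule unital_hom_poly_ev)
qed

lemmas ev_t_hom = unital_hom_rules[OF unital_hom_ev(1)]
lemmas ev_y_hom = unital_hom_rules[OF unital_hom_ev(2)]
lemmas ev_v_hom = unital_hom_rules[OF unital_hom_ev(3)]

lemma ev_pCons:
  "ev_t (pCons c r) = fps_const c + fps_T * ev_t r"
  "ev_y y (pCons r q) = ev_t r + y * ev_y y q"
  "ev_v y v (pCons q p) = ev_y y q + v * ev_v y v p"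
  by (simp_all add: ev_t_def ev_y_def ev_v_def)

lemma ev_var: "ev_y y yy = y" "ev_y y yt = fps_T"
  by (simp_all add: yy_def yt_def ev_pCons ev_t_hom ev_y_hom)

lemma ev_y_cubic: "ev_y y cubic = y * (y - 1) * (y - fps_T)"
  by (simp add: cubic_def ev_y_hom ev_var)

lemma fps_D_ev_t: "fps_D (ev_t r) = ev_t (t_deriv r)"
proof (rule derivations_along_hom_eqI[where h = ev_t and ?E1.0 = "\<lambda>r. fps_D (ev_t r)" and ?E2.0 = "\<lambda>r. ev_t (t_deriv r)"])
  note d = derivation_rules[OF derivation_t_deriv]
  show "fps_D (ev_t [:c:]) = ev_t (t_deriv [:c:])" for c
    by (simp add: ev_pCons ev_t_hom t_deriv_def pderiv_pCons fps_D_const)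
  show "fps_D (ev_t [:0, 1:]) = ev_t (t_deriv [:0, 1:])"
    by (simp add: ev_pCons ev_t_hom t_deriv_def pderiv_pCons fps_D_T fps_const_neg[symmetric] numeral_fps_const
      del: fps_const_neg) (simp add: algebra_simps)
qed (simp_all add: ev_t_hom fps_D_add fps_D_mult derivation_rules[OF derivation_t_deriv] algebra_simps)

lemma fps_D_ev_y:
  assumes "fps_D y = 2 * y * (y - 1) * (1 + (y - fps_T) * v)"
  shows "fps_D (ev_y y q) = ev_y y (D0 q) + v * ev_y y (D1 q)"
proof (rule derivations_along_hom_eqI[where h = "ev_y y" and ?E1.0 = "\<lambda>q. fps_D (ev_y y q)"
      and ?E2.0 = "\<lambda>q. ev_y y (D0 q) + v * ev_y y (D1 q)"])
  show "fps_D (ev_y y [:r:]) = ev_y y (D0 [:r:]) + v * ev_y y (D1 [:r:])" for r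
    by (simp add: ev_pCons ev_y_hom D0_def D1_def pderiv_pCons fps_D_ev_t map_poly_pCons
      derivation_rules[OF derivation_t_deriv])
  have a: "D0 [:0, 1:] = 2 * yy * (yy - 1)" "D1 [:0, 1:] = 2 * cubic"
    by (simp_all add: D0_def D1_def pderiv_pCons map_poly_pCons derivation_rules[OF derivation_t_deriv])
  show "fps_D (ev_y y [:0, 1:]) = ev_y y (D0 [:0, 1:]) + v * ev_y y (D1 [:0, 1:])"
    unfolding a unfolding yy_def[symmetric] using assms
    by (simp add: ev_y_hom ev_y_cubic ev_var algebra_simps)
qed (simp_all add: ev_y_hom fps_D_add fps_D_mult derivation_rules[OF derivation_D0] derivation_rules[OF derivation_D1]
    algebra_simps)

text \<open>Along a solution, evaluation turns \<open>vfield\<close> into \<open>fps_D\<close>; its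
  kernel is therefore a differential prime.\<close>

lemma fps_D_ev_v:
  assumes "fps_D y = 2 * y * (y - 1) * (1 + (y - fps_T) * v)"
    "fps_D v = - 1 - (4 * y - 2) * v - (3 * y\<^sup>2 - 2 * (1 + fps_T) * y + fps_T) * v\<^sup>2"
  shows "fps_D (ev_v y v p) = ev_v y v (vfield p)"
proof (rule derivations_along_hom_eqI[where h = "ev_v y v" and ?E1.0 = "\<lambda>p. fps_D (ev_v y v p)"
      and ?E2.0 = "\<lambda>p. ev_v y v (vfield p)"])
  show "fps_D (ev_v y v [:q:]) = ev_v y v (vfield [:q:])" for q
    by (simp add: ev_pCons ev_v_hom ev_y_hom vfield_def pderiv_pCons fps_D_ev_y[OF assms(1)] map_poly_pCons
      derivation_rules[OF derivation_D0] derivation_rules[OF derivation_D1])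
  have "vfield [:0, 1:] = [:-1, 2 - 4 * yy, - pderiv cubic:]"
    by (simp add: vfield_def pderiv_pCons map_poly_pCons
      derivation_rules[OF derivation_D0] derivation_rules[OF derivation_D1])
  then show "fps_D (ev_v y v [:0, 1:]) = ev_v y v (vfield [:0, 1:])"
    using assms(2) by (simp add: ev_pCons ev_v_hom ev_y_hom ev_var pderiv_cubic algebra_simps power2_eq_square)
qed (simp_all add: ev_v_hom fps_D_add fps_D_mult derivation_rules[OF derivation_vfield] algebra_simps)

text \<open>Substitute \<open>y = (z ^ 2 - t) ^ 2 / (4 * F)\<close> into the equation of
  \<open>y\<close> and clear denominators. The numerator is monic of degree 4 in \<open>z\<close>,
  the denominator of degree 3, so the leading coefficient of \<open>q\<close> survives.\<close>

lemma algebraic_over_base_step: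
  assumes q: "q \<noteq> 0" "ev_y y q = 0"
    and yz: "4 * (z * (z - 1) * (z - fps_T)) * y = (z\<^sup>2 - fps_T)\<^sup>2"
  shows "\<exists>q'. q' \<noteq> 0 \<and> ev_y z q' = 0"
proof -
  define n where "n = (yy\<^sup>2 - yt)\<^sup>2"
  define q' where "q' = homogenize n (4 * cubic) (degree q) q"
  have n: "n = [:[:0, 0, 1:], 0, [:0, -2:], 0, 1:]"
    by (simp add: n_def yy_def yt_def power2_eq_square algebra_simps)
  have c: "cubic = [:0, [:0, 1:], [:-1, -1:], 1:]"
    by (simp add: cubic_def yy_def yt_def algebra_simps one_pCons)
  have deg: "degree (4 * cubic) < degree n" "lead_coeff n = 1"
    unfolding n c by (simp_all add: numeral_poly)
  have "q' \<noteq> 0" using homogenize_degree(1)[OF deg, of "degree q" q] q(1) unfolding q'_def by auto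
  define f where "f = 4 * (z * (z - 1) * (z - fps_T))"
  have "ev_y z n = f * y" using yz by (simp add: n_def ev_y_hom ev_var f_def)
  moreover have "ev_y z (4 * cubic) = f" by (simp add: ev_y_hom ev_y_cubic f_def)
  moreover have "ev_y z (smult r a) = ev_t r * ev_y z a" for r a
  proof -
    have "ev_y z ([:r:] * a) = ev_t r * ev_y z a" unfolding ev_y_hom by (simp add: ev_pCons ev_y_hom)
    then show ?thesis by simp
  qed
  ultimately have "ev_y z q' = (\<Sum>i\<le>degree q. ev_t (coeff q i) * ((f * y) ^ i * f ^ (degree q - i)))"
    unfolding q'_def homogenize_def ev_y_hom(8) by (simp only: ev_y_hom(2,7))
  also have "\<dots> = (\<Sum>i\<le>degree q. f ^ degree q * (ev_t (coeff q i) * y ^ i))"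
  proof (intro sum.cong refl)
    fix i assume "i \<in> {..degree q}"
    then have "f ^ i * f ^ (degree q - i) = f ^ degree q" by (simp flip: power_add)
    then show "ev_t (coeff q i) * ((f * y) ^ i * f ^ (degree q - i)) = f ^ degree q * (ev_t (coeff q i) * y ^ i)"
      by (metis (no_types, opaque_lifting) mult.assoc mult.commute power_mult_distrib)
  qed
  also have "\<dots> = f ^ degree q * (\<Sum>i\<le>degree q. ev_t (coeff q i) * y ^ i)" by (simp add: sum_distrib_left)
  also have "(\<Sum>i\<le>degree q. ev_t (coeff q i) * y ^ i) = ev_y y q"
  proof -
    have "(\<Sum>i\<le>degree q. ev_t (coeff q i) * y ^ i) = (\<Sum>i\<le>degree (map_poly ev_t q). ev_t (coeff q i) * y ^ i)"
      using degree_le[of "degree q" "map_poly ev_t q"]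
      by (intro sum.mono_neutral_right) (auto simp: coeff_map_poly coeff_eq_0 ev_t_hom,
          metis coeff_map_poly coeff_eq_0 ev_t_hom(3) not_le)
    then show ?thesis by (simp add: ev_y_def poly_ev_def poly_altdef coeff_map_poly ev_t_hom)
  qed
  finally show ?thesis using q(2) \<open>q' \<noteq> 0\<close> by auto
qed

definition spec_t :: "complex poly poly poly \<Rightarrow> complex poly poly" where
  "spec_t = map_poly (map_poly (\<lambda>r. poly r (-1)))"

text \<open>\<open>fps_T\<close> has constant term -1, so taking constant terms of the series
  specializes \<open>t\<close> to -1.\<close>

lemma ev_v_nth_0: "ev_v y v p $ 0 = poly (poly (spec_t p) [:v $ 0:]) (y $ 0)"
proof -
  have h0: "unital_hom (\<lambda>f::complex fps. f $ 0)" by (simp add: unital_hom_def fps_mult_nth_0)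
  have 1: "ev_t r $ 0 = poly r (-1)" for r
    unfolding ev_t_def poly_ev_def unital_hom_poly[OF h0] by (simp add: map_poly_map_poly o_def fps_T_nth_0)
  have 2: "ev_y y q $ 0 = poly (map_poly (\<lambda>r. poly r (-1)) q) (y $ 0)" for q
    unfolding ev_y_def poly_ev_def unital_hom_poly[OF h0] by (simp add: map_poly_map_poly o_def 1 ev_t_hom)
  have hp: "unital_hom (\<lambda>q. poly q (y $ 0))" by (simp add: unital_hom_def)
  show ?thesis
    unfolding ev_v_def poly_ev_def unital_hom_poly[OF h0] unital_hom_poly[OF hp] spec_t_def
    by (simp add: map_poly_map_poly o_def 2 ev_y_hom)
qed

text \<open>Dividing by \<open>t + 1\<close> as long as possible reduces the claim to the fibre \<open>t = -1\<close>.\<close>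

lemma vanish_everywhere:
  assumes ys: "\<And>k. ev_v (ys k) (us k) p = 0"
    and dense: "\<And>f. (\<And>k. poly (poly f [:us k $ 0:]) (ys k $ 0) = 0) \<Longrightarrow> f = 0"
  shows "p = 0"
proof (rule ccontr)
  assume "p \<noteq> 0"
  define l where "l = [:1, 1 :: complex:]"
  have "\<exists>g. (\<forall>k. ev_v (ys k) (us k) g = 0) \<and> (\<forall>i j. coeff (coeff p i) j = l ^ n * coeff (coeff g i) j)" for n
  proof (induction n)
    case 0
    then show ?case using ys by auto
  next
    case (Suc n)
    then obtain g where g: "\<And>k. ev_v (ys k) (us k) g = 0" "\<And>i j. coeff (coeff p i) j = l ^ n * coeff (coeff g i) j"
      by blast
    have "spec_t g = 0" using dense[of "spec_t g"] g(1) by (metis ev_v_nth_0 fps_zero_nth)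
    then have "coeff (coeff (spec_t g) i) j = 0" for i j by simp
    then have "poly (coeff (coeff g i) j) (-1) = 0" for i j
      by (simp add: spec_t_def coeff_map_poly)
    then have "l dvd coeff (coeff g i) j" for i j 
      using poly_eq_0_iff_dvd[of "coeff (coeff g i) j" "-1"] by (simp add: l_def)
    then have ldiv: "coeff (coeff g i) j = l * (coeff (coeff g i) j div l)" for i j by simp
    define h where "h = map_poly (map_poly (\<lambda>r. r div l)) g"
    have h: "coeff (coeff g i) j = l * coeff (coeff h i) j" for i j
      using ldiv[of i j] by (simp add: h_def coeff_map_poly)
    have "g = [:[:l:]:] * h" by (intro poly_eqI) (simp add: h)
    then have "ev_v (ys k) (us k) [:[:l:]:] * ev_v (ys k) (us k) h = 0" for k
      using g(1) by (metis ev_v_hom(2))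
    moreover have "ev_v (ys k) (us k) [:[:l:]:] = 1 + fps_T" for k
      by (simp add: l_def ev_pCons ev_v_hom ev_y_hom ev_t_hom)
    \<comment> \<open>The value of \<open>t + 1\<close> can be cancelled in the domain of power
      series: it is not zero, as \<open>tau ^ 2\<close> has the linear coefficient
      \<open>2 * i\<close>.\<close>
    moreover have "1 + fps_T \<noteq> 0"
    proof
      assume "1 + fps_T = 0"
      then have "fps_tau * fps_tau = -1" by (simp add: fps_T_def power2_eq_square eq_neg_iff_add_eq_0 add.commute)
      then have "(fps_tau * fps_tau) $ 1 = (-1 :: complex fps) $ 1" by simp
      then show False by (simp add: fps_tau_def fps_mult_nth)
    qed
    ultimately have "ev_v (ys k) (us k) h = 0" for k by simp
    moreover have "coeff (coeff p i) j = l ^ Suc n * coeff (coeff h i) j" for i j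
      using g(2)[of i j] h[of i j] by simp
    ultimately show ?case by blast
  qed
  note * = this
  obtain i j where ij: "coeff (coeff p i) j \<noteq> 0"
    using \<open>p \<noteq> 0\<close> by (metis leading_coeff_0_iff)
  define r where "r = coeff (coeff p i) j"
  obtain s where "r = l ^ Suc (degree r) * s" using *[of "Suc (degree r)"] unfolding r_def by blast
  then have "l ^ Suc (degree r) dvd r" by (metis dvd_triv_left)
  then have "degree (l ^ Suc (degree r)) \<le> degree r" using ij by (intro dvd_imp_degree_le) (auto simp: r_def)
  moreover have "degree l = 1" "l \<noteq> 0" by (simp_all add: l_def)
  ultimately show False by (simp add: degree_power_eq del: power_Suc)
qed

text \<open>The kernels are nonzero because the abscissae are algebraic over \<open>C(t)\<close>:
  the first satisfies \<open>y ^ 2 = t\<close>, and halving preserves this. That only 0 lies in all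
  of them is decided on constant terms, that is, in the fibre over \<open>t = -1\<close>.\<close>

lemma invariant_curves:
  obtains e :: "nat \<Rightarrow> complex poly poly poly \<Rightarrow> complex fps"
  where "\<And>k. unital_hom (e k)" "\<And>k p. fps_D (e k p) = e k (vfield p)"
    "\<And>k. \<exists>p. p \<noteq> 0 \<and> e k p = 0" "\<And>p. (\<And>k. e k p = 0) \<Longrightarrow> p = 0"
proof -
  obtain ys us :: "nat \<Rightarrow> complex fps" where y0: "ys 0 = fps_tau"
    and dy: "\<And>k. fps_D (ys k) = 2 * ys k * (ys k - 1) * (1 + (ys k - fps_T) * us k)"
    and du: "\<And>k. fps_D (us k) = - 1 - (4 * ys k - 2) * us k - (3 * (ys k)\<^sup>2 - 2 * (1 + fps_T) * ys k + fps_T) * (us k)\<^sup>2"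
    and F: "\<And>k. (ys k * (ys k - 1) * (ys k - fps_T)) $ 0 \<noteq> 0"
    and yz: "\<And>k z. z = ys (Suc k) \<Longrightarrow> 4 * (z * (z - 1) * (z - fps_T)) * ys k = (z\<^sup>2 - fps_T)\<^sup>2"
    and vz: "\<And>k z. z = ys (Suc k) \<Longrightarrow> us k * ((z\<^sup>2 - fps_T) * (z\<^sup>2 - 2 * z + fps_T) * (z\<^sup>2 - 2 * fps_T * z + fps_T))
        = 4 * (z * (z - 1) * (z - fps_T)) * (4 * (z * (z - 1) * (z - fps_T)) * us (Suc k)
          + (3 * z\<^sup>2 - 2 * (1 + fps_T) * z + fps_T))"
    by (rule algebraic_solutions) blast
  have alg: "\<exists>q. q \<noteq> 0 \<and> ev_y (ys k) q = 0" for k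
  proof (induction k)
    case 0
    have "yy\<^sup>2 - yt \<noteq> 0" by (simp add: yy_def yt_def power2_eq_square)
    moreover have "ev_y (ys 0) (yy\<^sup>2 - yt) = 0" by (simp add: ev_y_hom ev_var y0 fps_T_def)
    ultimately show ?case by blast
  next
    case (Suc k)
    then show ?case using algebraic_over_base_step yz by blast
  qed
  show thesis
  proof (rule that[of "\<lambda>k. ev_v (ys k) (us k)"])
    show "unital_hom (ev_v (ys k) (us k))" for k by (rule unital_hom_ev)
    show "fps_D (ev_v (ys k) (us k) p) = ev_v (ys k) (us k) (vfield p)" for k p
      by (rule fps_D_ev_v[OF dy du])
    show "\<exists>p. p \<noteq> 0 \<and> ev_v (ys k) (us k) p = 0" for k
    proof -
      obtain q where "q \<noteq> 0" "ev_y (ys k) q = 0" using alg by blast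
      then have "[:q:] \<noteq> 0" "ev_v (ys k) (us k) [:q:] = 0" by (simp_all add: ev_pCons ev_v_hom)
      then show ?thesis by blast
    qed
    fix p assume p: "\<And>k. ev_v (ys k) (us k) p = 0"
    show "p = 0"
    proof (rule vanish_everywhere[OF p])
      fix f assume f: "\<And>k. poly (poly f [:us k $ 0:]) (ys k $ 0) = 0"
      define y v where "y k = ys k $ 0" and "v k = us k $ 0" for k
      have nth0: "(a * b) $ 0 = a $ 0 * b $ 0" "(a ^ n) $ 0 = (a $ 0) ^ n" "(numeral w :: complex fps) $ 0 = numeral w"
        for a b :: "complex fps" and n w
        by (simp_all add: fps_mult_nth_0 fps_power_zeroth numeral_fps_const)
      have F0: "poly fibre_cubic (y k) \<noteq> 0" for k
        using F[of k] by (simp add: nth0 fps_T_nth_0 y_def poly_fibre algebra_simps power3_eq_cube)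
      show "f = 0"
      proof (rule torsion_points_dense[of y v f])
        show "(y 0)\<^sup>2 = -1" by (simp add: y_def y0 fps_tau_def power2_eq_square)
        show "poly fibre_cubic (y k) \<noteq> 0" for k by (rule F0)
        show "fibre_double (y (Suc k)) = y k" for k
        proof -
          have "4 * poly fibre_cubic (y (Suc k)) * y k = poly fibre_num (y (Suc k))"
            using arg_cong[OF yz[OF refl, of k], of "\<lambda>f. f $ 0"]
            by (simp add: nth0 fps_T_nth_0 y_def poly_fibre algebra_simps power3_eq_cube power2_eq_square)
          then show ?thesis using F0 by (simp add: fibre_double_def divide_eq_eq mult.commute)
        qed
        show "v k * poly fibre_ram (y (Suc k)) = 4 * poly fibre_cubic (y (Suc k)) *
         (4 * poly fibre_cubic (y (Suc k)) * v (Suc k) + poly (pderiv fibre_cubic) (y (Suc k)))" for k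
          using arg_cong[OF vz[OF refl, of k], of "\<lambda>f. f $ 0"]
          unfolding poly_fibre
          by (simp add: nth0 fps_T_nth_0 y_def v_def algebra_simps eval_nat_numeral)
        show "poly (poly f [:v k:]) (y k) = 0" for k using f by (simp add: y_def v_def)
      qed
    qed
  qed
qed

section \<open>Absence of rational constants\<close>

lemma coeff_mult_bound:
  fixes p q :: "'a::comm_ring_1 poly"
  assumes "degree p \<le> a" "degree q \<le> b"
  shows "coeff (p * q) (a + b) = coeff p a * coeff q b"
proof -
  have "coeff (p * q) (a + b) = (\<Sum>i\<le>a + b. coeff p i * coeff q (a + b - i))" by (rule coeff_mult)
  also have "\<dots> = (\<Sum>i\<in>{a}. coeff p i * coeff q (a + b - i))"
  proof (rule sum.mono_neutral_right)
    show "\<forall>i\<in>{..a + b} - {a}. coeff p i * coeff q (a + b - i) = 0"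
    proof
      fix i assume "i \<in> {..a + b} - {a}"
      then have "i > a \<or> a + b - i > b" by auto
      then show "coeff p i * coeff q (a + b - i) = 0" using assms by (auto simp: coeff_eq_0)
    qed
  qed auto
  finally show ?thesis by simp
qed

lemma coeff_mult_second:
  fixes p q :: "'a::comm_ring_1 poly"
  assumes "degree p \<le> Suc a" "degree q \<le> b"
  shows "coeff (p * q) (a + b) = coeff p a * coeff q b + coeff p (Suc a) * (if b = 0 then 0 else coeff q (b - 1))"
proof (cases b)
  case 0
  then obtain c where "q = [:c:]" using assms(2) by (metis degree_eq_zeroE le_zero_eq)
  then show ?thesis using 0 by simp
next
  case (Suc b')
  have "coeff (p * q) (a + b) = (\<Sum>i\<le>a + b. coeff p i * coeff q (a + b - i))" by (rule coeff_mult)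
  also have "\<dots> = (\<Sum>i\<in>{a, Suc a}. coeff p i * coeff q (a + b - i))"
  proof (rule sum.mono_neutral_right)
    show "\<forall>i\<in>{..a + b} - {a, Suc a}. coeff p i * coeff q (a + b - i) = 0"
    proof
      fix i assume "i \<in> {..a + b} - {a, Suc a}"
      then have "i > Suc a \<or> a + b - i > b" by auto
      then show "coeff p i * coeff q (a + b - i) = 0" using assms by (auto simp: coeff_eq_0)
    qed
  qed (use Suc in auto)
  finally show ?thesis using Suc by simp
qed

text \<open>The Euler operator \<open>x * d/dx\<close> multiplies the coefficient of
  \<open>x ^ i\<close> by \<open>i\<close> and keeps degrees, so the top coefficient of the
  Wronskian is the difference of the degrees times both leading coefficients.\<close>

lemma degree_eq_if_wronskian_zero:
  fixes p q :: "'a::{idom, ring_char_0} poly"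
  assumes "p \<noteq> 0" "q \<noteq> 0" "pderiv p * q = p * pderiv q"
  shows "degree p = degree q"
proof -
  have c: "coeff ([:0, 1:] * pderiv r) i = of_nat i * coeff r i" for r :: "'a poly" and i
    by (cases i) (simp_all add: coeff_pderiv)
  have d: "degree ([:0, 1:] * pderiv r) \<le> degree r" for r :: "'a poly"
    by (rule degree_le) (simp only: c, simp add: coeff_eq_0)
  have "([:0, 1:] * pderiv p) * q = p * ([:0, 1:] * pderiv q)" using assms(3) by (simp add: mult_ac)
  then have "coeff (([:0, 1:] * pderiv p) * q) (degree p + degree q) = coeff (p * ([:0, 1:] * pderiv q)) (degree p + degree q)"
    by simp
  then have "of_nat (degree p) * lead_coeff p * lead_coeff q = lead_coeff p * (of_nat (degree q) * lead_coeff q)"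
    unfolding coeff_mult_bound[OF d order_refl] coeff_mult_bound[OF order_refl d] c .
  then have "(of_nat (degree p) - of_nat (degree q) :: 'a) * (lead_coeff p * lead_coeff q) = 0"
    by (simp add: algebra_simps)
  then have "(of_nat (degree p) :: 'a) = of_nat (degree q)" using assms(1,2) by simp
  then show ?thesis by simp
qed

text \<open>The combination \<open>r\<close> that cancels the leading terms again has zero Wronskian
  with \<open>q\<close>, so if nonzero it would have the degree of \<open>q\<close>.
  Cross-multiplying avoids division in the coefficient ring.\<close>

lemma proportional_if_wronskian_zero:
  fixes p q :: "'a::{idom, ring_char_0} poly"
  assumes "p \<noteq> 0" "q \<noteq> 0" and w: "pderiv p * q = p * pderiv q"
  shows "smult (lead_coeff q) p = smult (lead_coeff p) q"
proof (rule ccontr)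
  assume ne: "smult (lead_coeff q) p \<noteq> smult (lead_coeff p) q"
  define r where "r = smult (lead_coeff q) p - smult (lead_coeff p) q"
  have r0: "r \<noteq> 0" using ne by (simp add: r_def)
  have deg: "degree p = degree q" using degree_eq_if_wronskian_zero assms by blast
  have "pderiv r * q = r * pderiv q"
    unfolding r_def pderiv_diff pderiv_smult using w by (simp add: algebra_simps)
  then have "degree r = degree q" using degree_eq_if_wronskian_zero r0 assms(2) by blast
  moreover have "coeff r (degree q) = 0" using deg by (simp add: r_def mult.commute)
  ultimately show False using r0 by (metis leading_coeff_0_iff)
qed

text \<open>\<open>v'\<close> has degree 2 in \<open>v\<close> and \<open>D1\<close> comes with a
  factor \<open>v\<close>, so the degree rises by at most one. \<open>f1\<close> is 0 for
  \<open>m = 0\<close>, where the natural number \<open>m - 1\<close> would return the top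
  coefficient itself.\<close>

lemma vfield_leading:
  assumes m: "degree f \<le> m" and f1: "f1 = (if m = 0 then 0 else coeff f (m - 1))"
  shows "degree (vfield f) \<le> Suc m"
    and "coeff (vfield f) (Suc m) = D1 (coeff f m) - of_nat m * pderiv cubic * coeff f m"
    and "coeff (vfield f) m = D0 (coeff f m) + D1 f1 + of_nat m * (2 - 4 * yy) * coeff f m
      - (of_nat m - 1) * pderiv cubic * f1"
proof -
  define G where "G = [:-1, 2 - 4 * yy, - pderiv cubic:]"
  have z: "D0 0 = 0" "D1 0 = 0"
    using derivation_rules(3)[OF derivation_D0] derivation_rules(3)[OF derivation_D1] by auto
  have c: "coeff (vfield f) i = D0 (coeff f i) + (if i = 0 then 0 else D1 (coeff f (i - 1)))
      - of_nat (Suc i) * coeff f (Suc i) + (2 - 4 * yy) * (of_nat i * coeff f i)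
      - (if i = 0 then 0 else pderiv cubic * ((of_nat i - 1) * coeff f (i - 1)))" for i
  proof -
    have "coeff (G * pderiv f) i = - of_nat (Suc i) * coeff f (Suc i) + (2 - 4 * yy) * (of_nat i * coeff f i)
      - (if i = 0 then 0 else pderiv cubic * ((of_nat i - 1) * coeff f (i - 1)))"
      unfolding G_def
      by (auto simp: coeff_pCons coeff_pderiv algebra_simps split: nat.splits)
    moreover have "coeff ([:0, 1:] * map_poly D1 f) i = (if i = 0 then 0 else D1 (coeff f (i - 1)))"
      by (auto simp: coeff_pCons coeff_map_poly z split: nat.splits)
    ultimately show ?thesis unfolding vfield_def G_def[symmetric]
      by (simp add: coeff_map_poly z algebra_simps)
  qed
  have zero: "coeff f i = 0" if "i > m" for i using that m by (simp add: coeff_eq_0)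
  show "degree (vfield f) \<le> Suc m" by (rule degree_le) (simp add: c zero z)
  show "coeff (vfield f) (Suc m) = D1 (coeff f m) - of_nat m * pderiv cubic * coeff f m"
    by (simp add: c zero z)
  show "coeff (vfield f) m = D0 (coeff f m) + D1 f1 + of_nat m * (2 - 4 * yy) * coeff f m
      - (of_nat m - 1) * pderiv cubic * f1"
    by (simp add: c zero z f1 algebra_simps)
qed

lemma t_deriv_const: "D0 [:r:] = [:t_deriv r:]" "D1 [:r:] = 0"
  by (simp_all add: D0_def D1_def map_poly_pCons derivation_rules[OF derivation_t_deriv] pderiv_pCons)

lemma vfield_const: "vfield [:[:[:c:]:]:] = 0"
  by (simp add: vfield_def map_poly_pCons pderiv_pCons derivation_rules[OF derivation_D0]
      derivation_rules[OF derivation_D1] t_deriv_const t_deriv_def)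

text \<open>Each factor of \<open>cubic\<close> divides its own \<open>D0\<close>-derivative; the
  three cofactors \<open>2 * (y - 1)\<close>, \<open>2 * y\<close> and
  \<open>2 * (y + t - 1)\<close> add up.\<close>

lemma D0_cubic: "D0 cubic = 2 * (3 * yy + yt - 2) * cubic"
proof -
  have y: "D0 yy = 2 * yy * (yy - 1)"
    by (simp add: D0_def yy_def map_poly_pCons derivation_rules[OF derivation_t_deriv] pderiv_pCons)
  have t: "D0 yt = 2 * yt * (yt - 1)"
    unfolding yt_def t_deriv_const t_deriv_def by (simp add: pderiv_pCons numeral_poly one_pCons)
  show ?thesis unfolding cubic_def
    by (simp add: derivation_rules[OF derivation_D0] y t algebra_simps)
qed

lemma derivation_power: "derivation d \<Longrightarrow> d (f ^ Suc n) = of_nat (Suc n) * f ^ n * d f"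
  by (induction n) (simp_all add: derivation_rules algebra_simps)

text \<open>Specializing \<open>t\<close> to a complex number \<open>c\<close> reduces to the
  equation over the complex numbers, whose denominators split into linear factors.\<close>

lemma specialize_t_ode:
  fixes N B :: "complex poly poly" and E0 E1 :: "complex poly"
  assumes B0: "B \<noteq> 0"
    and eq: "2 * cubic * (pderiv N * B - N * pderiv B) + pderiv cubic * N * B = B\<^sup>2 * [:E0, E1:]"
  shows "E0 = 0" "E1 = 0"
proof -
  \<comment> \<open>\<open>L\<close> excludes the values 0 and 1, where the cubic has a double root,
    and those where the top coefficient of \<open>B\<close> vanishes.\<close>
  define L where "L = [:0, 1:] * [:-1, 1:] * lead_coeff B"
  have "[:0, 1:] \<noteq> (0 :: complex poly)" "[:-1, 1:] \<noteq> (0 :: complex poly)" "lead_coeff B \<noteq> 0"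
    using B0 by simp_all
  then have L0: "L \<noteq> 0" unfolding L_def by (metis mult_eq_0_iff)
  have key: "poly E0 c = 0 \<and> poly E1 c = 0" if c: "poly L c \<noteq> 0" for c
  proof -
    define h where "h = map_poly (\<lambda>r. poly r c)"
    have "unital_hom (\<lambda>r. poly r c)" by (simp add: unital_hom_def)
    then have "unital_hom h" unfolding h_def by (rule unital_hom_map_poly)
    note h = unital_hom_rules[OF this]
    have hd: "h (pderiv q) = pderiv (h q)" for q
      by (intro poly_eqI) (simp add: h_def coeff_map_poly coeff_pderiv)
    have hc: "h cubic = [:0, 1:] * [:-1, 1:] * [:-c, 1:]"
      unfolding cubic_def h yy_def yt_def by (simp add: h_def map_poly_pCons one_pCons)
    have c01: "c \<noteq> 0" "c \<noteq> 1" using c by (auto simp: L_def)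
    have "coeff (h B) (degree B) \<noteq> 0" using c by (simp add: L_def h_def coeff_map_poly)
    then have hB: "h B \<noteq> 0" by auto
    have "2 * h cubic * (pderiv (h N) * h B - h N * pderiv (h B)) + pderiv (h cubic) * h N * h B = (h B)\<^sup>2 * h [:E0, E1:]"
      using arg_cong[OF eq, of h] by (simp only: h hd)
    moreover have "degree (h cubic) = 3" unfolding hc by (simp add: degree_mult_eq)
    moreover have "degree (h [:E0, E1:]) \<le> 1" by (simp add: h_def map_poly_pCons)
    moreover have "poly (pderiv (h cubic)) r \<noteq> 0" if "poly (h cubic) r = 0" for r
    proof -
      have "poly (h cubic) r = r * (r - 1) * (r - c)" unfolding hc poly_mult by simp
      then have "r = 0 \<or> r = 1 \<or> r = c" using that by auto
      moreover have "poly (pderiv (h cubic)) r = (r - 1) * (r - c) + r * (r - c) + r * (r - 1)"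
        unfolding hc by (simp add: pderiv_mult pderiv_pCons algebra_simps)
      ultimately show ?thesis using c01 by auto
    qed
    ultimately have "h [:E0, E1:] = 0" using linear_ode_rational_solution[OF hB] by blast
    then show ?thesis by (simp add: h_def map_poly_pCons)
  qed
  have "poly (L * E) c = 0" if "E = E0 \<or> E = E1" for c E using key[of c] that by auto
  then have "L * E = 0" if "E = E0 \<or> E = E1" for E using that poly_all_0_iff_0 by blast
  then show "E0 = 0" "E1 = 0" using L0 by (metis mult_eq_0_iff)+
qed

text \<open>\<open>L1\<close> and \<open>L2\<close> compare the two top coefficients in \<open>v\<close> of \<open>f' g - f g' = 2 t (t - 1) \<omega> f g\<close>.
  Since \<open>a / b\<close> is \<open>F\<close> to the power \<open>(m - k) / 2\<close> up to a factor from \<open>\<complex>(t)\<close>, squares are used.\<close>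

lemma leading_system_wlog:
  fixes a b a1 b1 :: "complex poly poly" and \<omega> :: "complex poly"
  assumes a0: "a \<noteq> 0" and b0: "b \<noteq> 0" and mk: "k \<le> m"
    and L1: "(D1 a - of_nat m * pderiv cubic * a) * b = (D1 b - of_nat k * pderiv cubic * b) * a"
    and L2: "(D0 a + D1 a1 + of_nat m * (2 - 4 * yy) * a - (of_nat m - 1) * pderiv cubic * a1) * b
        + (D1 a - of_nat m * pderiv cubic * a) * b1
      - ((D0 b + D1 b1 + of_nat k * (2 - 4 * yy) * b - (of_nat k - 1) * pderiv cubic * b1) * a
        + (D1 b - of_nat k * pderiv cubic * b) * a1) = [:[:0, -2, 2:] * \<omega>:] * (a * b)"
  shows "m = k \<and> \<omega> = 0 \<and> (\<exists>c. c \<noteq> 0 \<and> a = [:[:c:]:] * b)"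
proof -
  define j where "j = m - k"
  define W where "W = [:[:0, -2, 2:] * \<omega>:]"
  define F' where "F' = pderiv cubic"
  \<comment> \<open>\<open>N / B = a1 / a - b1 / b\<close>. Divided by \<open>B ^ 2\<close>, the
    relation \<open>E\<close> below is a linear equation \<open>2 * F * z' + F' * z = ...\<close>
    for it, with the logarithmic \<open>D0\<close>-derivative of \<open>a / b\<close> on the
    right.\<close>
  define N B where "N = a1 * b - b1 * a" and "B = a * b"
  have m: "m = k + j" using mk by (simp add: j_def)
  have mj: "of_nat m = (of_nat k + of_nat j :: complex poly poly)" by (simp add: m)
  have B0: "B \<noteq> 0" using a0 b0 by (simp add: B_def)
  have cubic0: "cubic \<noteq> 0" by (auto simp: cubic_def yy_def yt_def one_pCons)
  note dD1 = derivation_rules[OF derivation_D1] and dD0 = derivation_rules[OF derivation_D0]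
  have L1': "D1 a * b = D1 b * a + of_nat j * F' * a * b"
    using L1 unfolding mj F'_def by (simp add: algebra_simps)
  have E: "D1 N * B - N * D1 B + F' * N * B + B * (D0 a * b - a * D0 b) + of_nat j * (2 - 4 * yy) * B\<^sup>2 = W * B\<^sup>2"
  proof -
    define P where "P = (D0 a + D1 a1 + of_nat m * (2 - 4 * yy) * a - (of_nat m - 1) * F' * a1) * b
        + (D1 a - of_nat m * F' * a) * b1
      - ((D0 b + D1 b1 + of_nat k * (2 - 4 * yy) * b - (of_nat k - 1) * F' * b1) * a
        + (D1 b - of_nat k * F' * b) * a1)"
    have "D1 N * B - N * D1 B + F' * N * B + B * (D0 a * b - a * D0 b) + of_nat j * (2 - 4 * yy) * B\<^sup>2
      = B * P - (a1 * b + b1 * a) * (D1 a * b - (D1 b * a + of_nat j * F' * a * b))"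
      unfolding P_def N_def B_def mj dD1 by (simp add: algebra_simps power2_eq_square)
    also have "\<dots> = B * P" unfolding L1' by simp
    also have "P = W * B" unfolding P_def F'_def W_def B_def by (rule L2)
    finally show ?thesis by (simp add: power2_eq_square)
  qed
  \<comment> \<open>\<open>L1\<close> says that \<open>a ^ 2\<close> and
    \<open>F ^ j * b ^ 2\<close> have the same logarithmic derivative in \<open>y\<close>, so their
    ratio \<open>\<beta> / \<alpha>\<close> depends on \<open>t\<close> only.\<close>
  define q G where "q = a\<^sup>2" and "G = cubic ^ j * b\<^sup>2"
  have q0: "q \<noteq> 0" "G \<noteq> 0" using a0 b0 cubic0 by (simp_all add: q_def G_def)
  have D0G: "D0 G = cubic ^ j * (2 * of_nat j * (3 * yy + yt - 2) * b\<^sup>2 + 2 * b * D0 b)"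
  proof (cases j)
    case 0
    then show ?thesis by (simp add: G_def power2_eq_square dD0 algebra_simps)
  next
    case (Suc i)
    have dc: "D0 (cubic ^ j) = 2 * of_nat j * (3 * yy + yt - 2) * cubic ^ j"
      unfolding Suc derivation_power[OF derivation_D0] D0_cubic by (simp add: algebra_simps del: of_nat_Suc)
    show ?thesis unfolding G_def dD0(2) dc by (simp add: power2_eq_square dD0 algebra_simps)
  qed
  have "pderiv q * G = q * pderiv G"
  proof -
    have dG: "cubic * pderiv G = cubic ^ j * (of_nat j * F' * b\<^sup>2 + cubic * (2 * b * pderiv b))"
    proof (cases j)
      case 0
      then show ?thesis by (simp add: G_def pderiv_mult power2_eq_square algebra_simps)
    next
      case (Suc i)
      show ?thesis unfolding G_def pderiv_mult Suc derivation_power[OF derivation_pderiv] F'_def power2_eq_square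
        by (simp add: algebra_simps del: of_nat_Suc)
    qed
    have "2 * cubic * pderiv a * b = 2 * cubic * pderiv b * a + of_nat j * F' * a * b"
      using L1' unfolding D1_def .
    then have x: "2 * cubic * pderiv a * b - (2 * cubic * pderiv b * a + of_nat j * F' * a * b) = 0" by simp
    have "cubic * (pderiv q * G - q * pderiv G) = cubic * pderiv q * G - q * (cubic * pderiv G)"
      by (simp add: algebra_simps)
    also have "\<dots> = cubic ^ j * a * b * (2 * cubic * pderiv a * b - (2 * cubic * pderiv b * a + of_nat j * F' * a * b))"
      unfolding dG unfolding q_def G_def by (simp add: power2_eq_square pderiv_mult algebra_simps)
    finally show ?thesis using x cubic0 by simp
  qed
  then have pq: "smult (lead_coeff G) q = smult (lead_coeff q) G"
    by (intro proportional_if_wronskian_zero q0)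
  define \<alpha> \<beta> where "\<alpha> = lead_coeff G" and "\<beta> = lead_coeff q"
  have ab0: "\<alpha> \<noteq> 0" "\<beta> \<noteq> 0" using q0 by (simp_all add: \<alpha>_def \<beta>_def)
  have pq': "[:\<alpha>:] * q = [:\<beta>:] * G" using pq by (simp add: \<alpha>_def \<beta>_def)
  \<comment> \<open>\<open>w / (\<alpha> * \<beta>)\<close> is the logarithmic derivative of
    \<open>\<beta> / \<alpha>\<close>. With \<open>D0_cubic\<close> it determines the one of
    \<open>a / b\<close>, as recorded in \<open>H\<close>.\<close>
  define w where "w = \<alpha> * t_deriv \<beta> - t_deriv \<alpha> * \<beta>"
  have w: "[:w:] = [:\<alpha>:] * [:t_deriv \<beta>:] - [:t_deriv \<alpha>:] * [:\<beta>:]" by (simp add: w_def)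
  have dpq: "[:t_deriv \<alpha>:] * q + [:\<alpha>:] * D0 q = [:t_deriv \<beta>:] * G + [:\<beta>:] * D0 G"
    using arg_cong[OF pq', of D0] unfolding dD0(2) t_deriv_const by simp
  have "[:\<alpha>:] * [:\<beta>:] * (D0 q * G - q * D0 G) = [:w:] * (q * G)"
  proof -
    have "[:\<alpha>:] * [:\<beta>:] * (D0 q * G - q * D0 G)
      = ([:\<alpha>:] * D0 q) * ([:\<beta>:] * G) - ([:\<alpha>:] * q) * ([:\<beta>:] * D0 G)" by (simp only: algebra_simps)
    also have "\<dots> = [:\<alpha>:] * q * ([:\<alpha>:] * D0 q - [:\<beta>:] * D0 G)"
      unfolding pq'[symmetric] by (simp only: algebra_simps)
    also have "[:\<alpha>:] * D0 q - [:\<beta>:] * D0 G = [:t_deriv \<beta>:] * G - [:t_deriv \<alpha>:] * q"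
    proof -
      have "x - y = u - v" if "v + x = u + y" for x y u v :: "complex poly poly"
        using that by (simp add: algebra_simps)
      from this[OF dpq] show ?thesis .
    qed
    also have "[:\<alpha>:] * q * ([:t_deriv \<beta>:] * G - [:t_deriv \<alpha>:] * q)
      = [:\<alpha>:] * [:t_deriv \<beta>:] * (q * G) - [:t_deriv \<alpha>:] * q * ([:\<alpha>:] * q)"
      by (simp only: algebra_simps)
    also have "\<dots> = [:w:] * (q * G)" unfolding pq' w by (simp only: algebra_simps)
    finally show ?thesis .
  qed
  moreover have "D0 q * G - q * D0 G = cubic ^ j * (2 * B * (D0 a * b - a * D0 b) - 2 * of_nat j * (3 * yy + yt - 2) * B\<^sup>2)"
    unfolding D0G unfolding q_def G_def B_def by (simp add: power2_eq_square dD0 algebra_simps)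
  moreover have "q * G = cubic ^ j * B\<^sup>2" unfolding q_def G_def B_def by (simp add: power2_eq_square algebra_simps)
  ultimately have "cubic ^ j * ([:\<alpha>:] * [:\<beta>:] * (2 * B * (D0 a * b - a * D0 b) - 2 * of_nat j * (3 * yy + yt - 2) * B\<^sup>2))
     = cubic ^ j * ([:w:] * B\<^sup>2)" by (simp only: mult.left_commute)
  then have H: "[:\<alpha>:] * [:\<beta>:] * (2 * B * (D0 a * b - a * D0 b) - 2 * of_nat j * (3 * yy + yt - 2) * B\<^sup>2) = [:w:] * B\<^sup>2"
    using cubic0 by (metis mult_left_cancel power_not_zero)
  \<comment> \<open>The contributions \<open>j * (2 - 4 * y)\<close> and
    \<open>j * (3 * y + t - 2)\<close> combine to \<open>j * (t - y)\<close>. After scaling by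
    \<open>2 * \<alpha> * \<beta>\<close> the right side is \<open>E0 + E1 * y\<close>, and its
    vanishing gives first \<open>j = 0\<close>, then a relation for \<open>\<omega>\<close>.\<close>
  define E0 E1 where "E0 = 2 * \<alpha> * \<beta> * ([:0, -2, 2:] * \<omega>) - w - 2 * of_nat j * \<alpha> * \<beta> * [:0, 1:]"
    and "E1 = 2 * of_nat j * \<alpha> * \<beta>"
  define N' where "N' = 2 * [:\<alpha>:] * [:\<beta>:] * N"
  have split: "[:E0, E1:] = [:E0:] + yy * [:E1:]" by (simp add: yy_def)
  have e0: "[:E0:] = 2 * [:\<alpha>:] * [:\<beta>:] * W - [:w:] - 2 * of_nat j * [:\<alpha>:] * [:\<beta>:] * yt"
    unfolding E0_def W_def yt_def by (simp add: numeral_poly of_nat_poly mult_ac)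
  have e1: "[:E1:] = 2 * of_nat j * [:\<alpha>:] * [:\<beta>:]"
    unfolding E1_def by (simp add: numeral_poly of_nat_poly mult_ac)
  have EE: "[:E0, E1:] = 2 * [:\<alpha>:] * [:\<beta>:] * W - [:w:] - 2 * of_nat j * [:\<alpha>:] * [:\<beta>:] * (yt - yy)"
    unfolding split unfolding e0 e1 by (simp only: algebra_simps)
  have dN': "pderiv N' = 2 * [:\<alpha>:] * [:\<beta>:] * pderiv N"
    unfolding N'_def by (simp add: numeral_poly pderiv_smult)
  have "2 * cubic * (pderiv N' * B - N' * pderiv B) + pderiv cubic * N' * B = B\<^sup>2 * [:E0, E1:]"
  proof -
    define Z Y where "Z = D0 a * b - a * D0 b" and "Y = D1 N * B - N * D1 B + F' * N * B"
    define A where "A = [:\<alpha>:] * [:\<beta>:]"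
    have "2 * cubic * (pderiv N' * B - N' * pderiv B) + pderiv cubic * N' * B = 2 * A * Y"
      unfolding dN' unfolding N'_def A_def Y_def D1_def F'_def by (simp only: algebra_simps)
    also have "\<dots> = 2 * A * (W * B\<^sup>2 - B * Z - of_nat j * (2 - 4 * yy) * B\<^sup>2)"
    proof -
      have "Y + B * Z + of_nat j * (2 - 4 * yy) * B\<^sup>2 = W * B\<^sup>2" using E unfolding Z_def Y_def .
      then have "Y = W * B\<^sup>2 - B * Z - of_nat j * (2 - 4 * yy) * B\<^sup>2" by (simp add: algebra_simps)
      then show ?thesis by (rule arg_cong)
    qed
    also have "\<dots> = 2 * A * W * B\<^sup>2 - A * (2 * B * Z - 2 * of_nat j * (3 * yy + yt - 2) * B\<^sup>2)
       - 2 * A * of_nat j * (yt - yy) * B\<^sup>2"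
      by (simp add: algebra_simps)
    also have "\<dots> = 2 * A * W * B\<^sup>2 - [:w:] * B\<^sup>2 - 2 * A * of_nat j * (yt - yy) * B\<^sup>2"
      using H unfolding Z_def A_def by simp
    also have "\<dots> = B\<^sup>2 * [:E0, E1:]" unfolding EE A_def by (simp only: algebra_simps)
    finally show ?thesis .
  qed
  from specialize_t_ode[OF B0 this] have E0: "E0 = 0" and E1: "E1 = 0" by simp_all
  have j0: "j = 0" using E1 ab0 by (simp add: E1_def of_nat_poly)
  have w2: "w = [:0, -2, 2:] * (\<alpha> * pderiv \<beta> - pderiv \<alpha> * \<beta>)"
    unfolding w_def t_deriv_def by (simp only: algebra_simps)
  have "[:0, -2, 2:] * (2 * \<alpha> * \<beta> * \<omega>) = [:0, -2, 2:] * (\<alpha> * pderiv \<beta> - pderiv \<alpha> * \<beta>)"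
    using E0 unfolding E0_def w2 j0 by (simp only: algebra_simps) simp
  then have wr: "2 * \<alpha> * \<beta> * \<omega> = \<alpha> * pderiv \<beta> - pderiv \<alpha> * \<beta>"
    by (metis mult_left_cancel pCons_eq_0_iff zero_neq_numeral)
  \<comment> \<open>\<open>2 * \<omega>\<close> is the logarithmic \<open>t\<close>-derivative of
    \<open>\<beta> / \<alpha>\<close>, which decays at infinity; a nonzero polynomial does
    not.\<close>
  have \<omega>0: "\<omega> = 0"
  proof (rule ccontr)
    assume o: "\<omega> \<noteq> 0"
    have dlt: "degree (p * pderiv r) < degree p + degree r \<or> p * pderiv r = 0" for p r :: "complex poly"
    proof (cases "degree r")
      case 0
      then show ?thesis by (simp add: pderiv_eq_0_iff)
    next
      case (Suc d)
      then show ?thesis using degree_mult_le[of p "pderiv r"] by (auto simp: degree_pderiv)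
    qed
    have "degree (2 * \<alpha> * \<beta> * \<omega>) = degree \<alpha> + degree \<beta> + degree \<omega>"
      using ab0 o by (simp add: degree_mult_eq numeral_poly)
    moreover have "2 * \<alpha> * \<beta> * \<omega> \<noteq> 0" using ab0 o by simp
    moreover have "degree (\<alpha> * pderiv \<beta> - pderiv \<alpha> * \<beta>) < degree \<alpha> + degree \<beta> \<or> \<alpha> * pderiv \<beta> - pderiv \<alpha> * \<beta> = 0"
      using dlt[of \<alpha> \<beta>] dlt[of \<beta> \<alpha>] by (auto simp: mult.commute add.commute intro: degree_diff_less)
    ultimately show False unfolding wr by linarith
  qed
  then have "pderiv \<beta> * \<alpha> = \<beta> * pderiv \<alpha>" using wr by (simp add: mult.commute)
  then have "smult (lead_coeff \<alpha>) \<beta> = smult (lead_coeff \<beta>) \<alpha>"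
    by (intro proportional_if_wronskian_zero ab0)
  then have sm: "[:lead_coeff \<alpha>:] * \<beta> = [:lead_coeff \<beta>:] * \<alpha>" by simp
  \<comment> \<open>\<open>\<beta> / \<alpha>\<close> is constant, so
    \<open>a ^ 2 = c ^ 2 * b ^ 2\<close>; the sign of the root is absorbed into the
    constant.\<close>
  define c where "c = csqrt (lead_coeff \<beta> / lead_coeff \<alpha>)"
  have c2: "c * c * lead_coeff \<alpha> = lead_coeff \<beta>"
    using ab0 by (simp add: c_def flip: power2_eq_square)
  have c0: "c \<noteq> 0" using ab0 c2 by (metis leading_coeff_0_iff mult_zero_left)
  have "[:\<alpha>:] * (a * a) = [:\<beta>:] * (b * b)"
    using pq' unfolding q_def G_def j0 power2_eq_square by simp
  then have "[:[:lead_coeff \<alpha>:]:] * [:\<alpha>:] * (a * a) = [:[:lead_coeff \<alpha>:]:] * ([:\<beta>:] * (b * b))"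
    by (simp only: mult.assoc)
  also have "\<dots> = [:[:lead_coeff \<alpha>:] * \<beta>:] * (b * b)" by simp
  also have "\<dots> = [:[:lead_coeff \<alpha>:]:] * [:\<alpha>:] * ([:[:c:]:] * [:[:c:]:] * (b * b))"
    unfolding sm c2[symmetric] by (simp add: mult_ac)
  finally have "a * a = [:[:c:]:] * [:[:c:]:] * (b * b)" using ab0
    by (metis mult_left_cancel mult_eq_0_iff pCons_eq_0_iff leading_coeff_0_iff)
  then have "(a - e * b) * (a + e * b) = 0" if "e = [:[:c:]:]" for e
    unfolding that[symmetric] by (simp add: algebra_simps)
  then have "(a - [:[:c:]:] * b) * (a + [:[:c:]:] * b) = 0" by blast
  then have "a = [:[:c:]:] * b \<or> a = - ([:[:c:]:] * b)"
    by (metis eq_iff_diff_eq_0 eq_neg_iff_add_eq_0 mult_eq_0_iff)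
  moreover have "- ([:[:c:]:] * b) = [:[:-c:]:] * b"
  proof -
    have "[:[:-c:]:] = - [:[:c:]:]" by simp
    then show ?thesis by (simp only: mult_minus_left)
  qed
  ultimately have "a = [:[:c:]:] * b \<or> a = [:[:-c:]:] * b" by metis
  then show ?thesis using j0 m \<omega>0 c0 by (metis add_0_right neg_equal_0_iff_equal)
qed

text \<open>With \<open>m\<close> and \<open>k\<close> the degrees in \<open>v\<close>, the
  coefficients of \<open>v ^ (m + k + 1)\<close> and \<open>v ^ (m + k)\<close> give the two
  equations of the preceding lemma; the right side reaches only the second. Exchanging
  \<open>f\<close> and \<open>g\<close> changes the sign of \<open>\<omega>\<close>, so
  \<open>k \<le> m\<close> may be assumed.\<close>

lemma vfield_wronskian_leading:
  assumes f0: "f \<noteq> 0" and g0: "g \<noteq> 0"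
    and eq: "vfield f * g - f * vfield g = [:[:[:0, -2, 2:] * \<omega>:]:] * (f * g)"
  shows "degree f = degree g \<and> \<omega> = 0 \<and> (\<exists>c. c \<noteq> 0 \<and> lead_coeff f = [:[:c:]:] * lead_coeff g)"
proof -
  have key: "degree f = degree g \<and> \<omega> = 0 \<and> (\<exists>c. c \<noteq> 0 \<and> lead_coeff f = [:[:c:]:] * lead_coeff g)"
    if f0: "f \<noteq> 0" and g0: "g \<noteq> 0" and le: "degree g \<le> degree f"
    and eq: "vfield f * g - f * vfield g = [:[:[:0, -2, 2:] * \<omega>:]:] * (f * g)" for f g \<omega>
  proof -
    define m k where "m = degree f" and "k = degree g"
    define f1 where "f1 = (if m = 0 then 0 else coeff f (m - 1))"
    define g1 where "g1 = (if k = 0 then 0 else coeff g (k - 1))"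
    note vf = vfield_leading[of f m, OF eq_refl[OF m_def[symmetric]] f1_def]
    note vg = vfield_leading[of g k, OF eq_refl[OF k_def[symmetric]] g1_def]
    have df: "degree f \<le> m" "degree g \<le> k" by (simp_all add: m_def k_def)
    have fg: "degree (f * g) \<le> m + k" using degree_mult_le[of f g] by (simp add: m_def k_def)
    have eq': "vfield f * g - vfield g * f = [:[:[:0, -2, 2:] * \<omega>:]:] * (f * g)"
      using eq by (simp add: mult.commute)
    have "coeff (vfield f * g) (Suc m + k) - coeff (vfield g * f) (Suc k + m) = coeff ([:[:[:0, -2, 2:] * \<omega>:]:] * (f * g)) (Suc m + k)"
      unfolding eq'[symmetric] coeff_diff by (simp add: add.commute)
    also have "\<dots> = 0" using fg by (simp add: coeff_eq_0)
    finally have 1: "coeff (vfield f) (Suc m) * coeff g k = coeff (vfield g) (Suc k) * coeff f m"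
      unfolding coeff_mult_bound[OF vf(1) df(2)] coeff_mult_bound[OF vg(1) df(1)] by simp
    have "coeff (vfield f * g) (m + k) - coeff (vfield g * f) (k + m) = coeff ([:[:[:0, -2, 2:] * \<omega>:]:] * (f * g)) (m + k)"
      unfolding eq'[symmetric] coeff_diff by (simp add: add.commute)
    also have "\<dots> = [:[:0, -2, 2:] * \<omega>:] * (coeff f m * coeff g k)"
      unfolding coeff_mult_bound[OF df, symmetric] by simp
    finally have 2: "coeff (vfield f) m * coeff g k + coeff (vfield f) (Suc m) * g1
       - (coeff (vfield g) k * coeff f m + coeff (vfield g) (Suc k) * f1) = [:[:0, -2, 2:] * \<omega>:] * (coeff f m * coeff g k)"
      unfolding coeff_mult_second[OF vf(1) df(2)] coeff_mult_second[OF vg(1) df(1)] f1_def[symmetric] g1_def[symmetric] .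
    have "coeff f m \<noteq> 0" "coeff g k \<noteq> 0" "k \<le> m" using f0 g0 le by (simp_all add: m_def k_def)
    from leading_system_wlog[OF this 1[unfolded vf(2) vg(2)] 2[unfolded vf(2,3) vg(2,3)]]
    show ?thesis unfolding m_def k_def .
  qed
  show ?thesis
  proof (cases "degree g \<le> degree f")
    case True
    then show ?thesis using key f0 g0 eq by blast
  next
    case False
    have neg: "[:[:[:0, -2, 2:] * (- \<omega>):]:] = - [:[:[:0, -2, 2:] * \<omega>:]:]" by simp
    have "vfield g * f - g * vfield f = - (vfield f * g - f * vfield g)"
      by (simp only: minus_diff_eq mult.commute)
    also have "\<dots> = [:[:[:0, -2, 2:] * (- \<omega>):]:] * (g * f)"
      unfolding eq neg by (simp only: mult_minus_left mult.commute[of g f])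
    finally have "vfield g * f - g * vfield f = [:[:[:0, -2, 2:] * (- \<omega>):]:] * (g * f)" .
    then have k: "degree g = degree f \<and> - \<omega> = 0 \<and> (\<exists>c. c \<noteq> 0 \<and> lead_coeff g = [:[:c:]:] * lead_coeff f)"
      using key[of g f "- \<omega>"] f0 g0 False by simp
    then show ?thesis using False by simp
  qed
qed

text \<open>Subtracting the multiple of \<open>g\<close> that cancels the leading coefficient keeps
  the equation, now with \<open>\<omega> = 0\<close>. The difference would have to have the degree
  of \<open>g\<close>, so it is 0.\<close>

lemma vfield_wronskian:
  assumes f0: "f \<noteq> 0" and g0: "g \<noteq> 0"
    and eq: "vfield f * g - f * vfield g = [:[:[:0, -2, 2:] * \<omega>:]:] * (f * g)"
  shows "\<omega> = 0 \<and> (\<exists>c. f = [:[:[:c:]:]:] * g)"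
proof -
  obtain c where deg: "degree f = degree g" and o: "\<omega> = 0" and c: "lead_coeff f = [:[:c:]:] * lead_coeff g"
    using vfield_wronskian_leading[OF assms] by blast
  define h where "h = f - [:[:[:c:]:]:] * g"
  note d = derivation_rules[OF derivation_vfield]
  have vh: "vfield h = vfield f - [:[:[:c:]:]:] * vfield g" unfolding h_def d vfield_const by simp
  have "vfield h * g - h * vfield g = vfield f * g - f * vfield g"
    unfolding vh unfolding h_def by (simp add: algebra_simps)
  also have "\<dots> = [:[:[:0, -2, 2:] * 0:]:] * (h * g)" using eq o by simp
  finally have w: "vfield h * g - h * vfield g = [:[:[:0, -2, 2:] * 0:]:] * (h * g)" .
  have "h = 0"
  proof (rule ccontr)
    assume "h \<noteq> 0"
    then have "degree h = degree g" using vfield_wronskian_leading w g0 by blast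
    moreover have "coeff h (degree g) = 0" using c deg by (simp add: h_def)
    ultimately show False using \<open>h \<noteq> 0\<close> by (metis leading_coeff_0_iff)
  qed
  then show ?thesis using o by (auto simp: h_def)
qed

section \<open>An upper bound for the lengths of prime chains\<close>

definition subring_of :: "'a::comm_ring_1 set \<Rightarrow> bool" where
  "subring_of S \<longleftrightarrow> 1 \<in> S \<and> (\<forall>a\<in>S. - a \<in> S) \<and> (\<forall>a\<in>S. \<forall>b\<in>S. a + b \<in> S \<and> a * b \<in> S)"

definition prime_in :: "'a::comm_ring_1 set \<Rightarrow> 'a set \<Rightarrow> bool" where
  "prime_in S P \<longleftrightarrow> P \<subseteq> S \<and> 0 \<in> P \<and> 1 \<notin> P \<and> (\<forall>a\<in>P. \<forall>b\<in>P. a + b \<in> P) \<and>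
     (\<forall>a\<in>S. \<forall>b\<in>P. a * b \<in> P) \<and> (\<forall>a\<in>S. \<forall>b\<in>S. a * b \<in> P \<longrightarrow> a \<in> P \<or> b \<in> P)"

lemma subring_of_closed:
  assumes "subring_of S"
  shows "1 \<in> S" "0 \<in> S" "a \<in> S \<Longrightarrow> - a \<in> S" "a \<in> S \<Longrightarrow> b \<in> S \<Longrightarrow> a + b \<in> S"
    "a \<in> S \<Longrightarrow> b \<in> S \<Longrightarrow> a - b \<in> S"
    "a \<in> S \<Longrightarrow> b \<in> S \<Longrightarrow> a * b \<in> S" "a \<in> S \<Longrightarrow> a ^ n \<in> S"
    "(\<And>i. i \<in> I \<Longrightarrow> f i \<in> S) \<Longrightarrow> sum f I \<in> S" "(\<And>i. i \<in> I \<Longrightarrow> f i \<in> S) \<Longrightarrow> prod f I \<in> S"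
proof -
  show m: "- a \<in> S" if "a \<in> S" for a using assms that by (auto simp: subring_of_def)
  show a: "a + b \<in> S" if "a \<in> S" "b \<in> S" for a b using assms that by (auto simp: subring_of_def)
  show "a - b \<in> S" if "a \<in> S" "b \<in> S" using a[OF that(1) m[OF that(2)]] by simp
  show t: "a * b \<in> S" if "a \<in> S" "b \<in> S" for a b using assms that by (auto simp: subring_of_def)
  show one: "1 \<in> S" using assms by (simp add: subring_of_def)
  show z: "0 \<in> S" using a[OF one m[OF one]] by simp
  show "a ^ n \<in> S" if "a \<in> S" by (induction n) (use that one t in auto)
  show "(\<And>i. i \<in> I \<Longrightarrow> f i \<in> S) \<Longrightarrow> sum f I \<in> S"
    by (induction I rule: infinite_finite_induct) (use z a in auto)
  show "(\<And>i. i \<in> I \<Longrightarrow> f i \<in> S) \<Longrightarrow> prod f I \<in> S"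
    by (induction I rule: infinite_finite_induct) (use one t in auto)
qed

lemma prime_in_rules:
  assumes "prime_in S P"
  shows "P \<subseteq> S" "0 \<in> P" "1 \<notin> P" "a \<in> P \<Longrightarrow> b \<in> P \<Longrightarrow> a + b \<in> P"
    "a \<in> S \<Longrightarrow> b \<in> P \<Longrightarrow> a * b \<in> P" "a \<in> S \<Longrightarrow> b \<in> S \<Longrightarrow> a * b \<in> P \<Longrightarrow> a \<in> P \<or> b \<in> P"
  using assms unfolding prime_in_def by blast+

lemma prime_in_power:
  assumes "prime_in S P" "subring_of S" "x \<in> S" "x \<notin> P"
  shows "x ^ m \<notin> P"
proof (induction m)
  case 0
  then show ?case using assms by (simp add: prime_in_def)
next
  case (Suc m)
  have "x ^ m \<in> S" using subring_of_closed(7)[OF assms(2,3)] .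
  then show ?case using Suc assms prime_in_rules(6)[OF assms(1), of x "x ^ m"] by auto
qed

text \<open>Split off the lowest power of \<open>x j\<close>: modulo the next prime only the terms of that power survive.\<close>

lemma monomial_sum_notin_prime_chain:
  fixes \<iota> :: "complex \<Rightarrow> 'a::comm_ring_1"
  assumes S: "subring_of S" and h: "unital_hom \<iota>" and \<iota>S: "\<And>c. \<iota> c \<in> S"
    and P: "\<And>i. i \<le> Suc n \<Longrightarrow> prime_in S (P i)" and inc: "\<And>i. i \<le> n \<Longrightarrow> P i \<subseteq> P (Suc i)"
    and x: "\<And>i. i \<le> n \<Longrightarrow> x i \<in> P (Suc i)" "\<And>i. i \<le> n \<Longrightarrow> x i \<notin> P i"
    and "j \<le> Suc n" "finite I" "I \<noteq> {}" "\<And>\<alpha>. \<alpha> \<in> I \<Longrightarrow> c \<alpha> \<noteq> 0" "inj_on (\<lambda>\<alpha>::nat \<Rightarrow> nat. restrict \<alpha> {j..n}) I"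
  shows "(\<Sum>\<alpha>\<in>I. \<iota> (c \<alpha>) * (\<Prod>i=j..n. x i ^ \<alpha> i)) \<notin> P j"
  using assms(8-)
proof (induction j arbitrary: I rule: inc_induct)
  case base
  \<comment> \<open>No variables are left: all exponents agree on the empty range, so injectivity
    leaves one term, a nonzero constant and hence a unit.\<close>
  have "I = {\<alpha>}" if "\<alpha> \<in> I" for \<alpha>
    using base(4) that by (auto simp: inj_on_def)
  then obtain \<alpha> where \<alpha>: "I = {\<alpha>}" using base(2) by blast
  have "\<iota> (1 / c \<alpha>) * \<iota> (c \<alpha>) = 1"
    using base(3)[of \<alpha>] \<alpha> unital_hom_rules(2,4)[OF h] by (metis insertI1 nonzero_eq_divide_eq)
  moreover have "prime_in S (P (Suc n))" using P by simp
  ultimately have "\<iota> (c \<alpha>) \<notin> P (Suc n)" using prime_in_rules(3,5)[of S "P (Suc n)"] \<iota>S by metis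
  then show ?case using \<alpha> by simp
next
  case (step j)
  have j: "j \<le> n" using step.hyps by simp
  have pj: "prime_in S (P j)" and pSj: "prime_in S (P (Suc j))" using P j by simp_all
  have xS: "x i \<in> S" if "i \<le> n" for i using x(1)[OF that] P[of "Suc i"] that prime_in_rules(1) by blast
  define m where "m = Min ((\<lambda>\<alpha>. \<alpha> j) ` I)"
  have mI: "m \<in> (\<lambda>\<alpha>. \<alpha> j) ` I" unfolding m_def using step.prems by (intro Min_in) auto
  have mle: "m \<le> \<alpha> j" if "\<alpha> \<in> I" for \<alpha> unfolding m_def using step.prems that by (intro Min_le) auto
  define J where "J = {\<alpha> \<in> I. \<alpha> j = m}"
  have J: "finite J" "J \<noteq> {}" "J \<subseteq> I" using mI step.prems by (auto simp: J_def)
  define M where "M \<alpha> = \<iota> (c \<alpha>) * (\<Prod>i=Suc j..n. x i ^ \<alpha> i)" for \<alpha>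
  define A where "A = (\<Sum>\<alpha>\<in>J. M \<alpha>)"
  define B where "B = (\<Sum>\<alpha>\<in>I - J. x j ^ (\<alpha> j - Suc m) * M \<alpha>)"
  have MS: "M \<alpha> \<in> S" for \<alpha>
    unfolding M_def
    by (intro subring_of_closed(6)[OF S] subring_of_closed(9)[OF S] subring_of_closed(7)[OF S] \<iota>S xS) auto
  have AS: "A \<in> S" "B \<in> S"
    unfolding A_def B_def
    by (intro subring_of_closed(8)[OF S] subring_of_closed(6)[OF S] subring_of_closed(7)[OF S] MS xS j)+
  have AnP: "A \<notin> P (Suc j)"
    unfolding A_def M_def
  proof (rule step.IH)
    show "inj_on (\<lambda>\<alpha>. restrict \<alpha> {Suc j..n}) J"
    proof (rule inj_onI)
      fix \<alpha> \<beta> assume ab: "\<alpha> \<in> J" "\<beta> \<in> J" "restrict \<alpha> {Suc j..n} = restrict \<beta> {Suc j..n}"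
      have "restrict \<alpha> {j..n} i = restrict \<beta> {j..n} i" for i
      proof (cases "i = j")
        case True
        then show ?thesis using ab by (simp add: J_def)
      next
        case False
        then show ?thesis using fun_cong[OF ab(3), of i] by (auto simp: restrict_def split: if_splits)
      qed
      then have "restrict \<alpha> {j..n} = restrict \<beta> {j..n}" by blast
      then show "\<alpha> = \<beta>" using inj_onD[OF step.prems(4)] ab J by blast
    qed
  qed (use J step.prems in auto)
  have split: "{j..n} = insert j {Suc j..n}" using j by auto
  have "(\<Sum>\<alpha>\<in>I. \<iota> (c \<alpha>) * (\<Prod>i=j..n. x i ^ \<alpha> i)) = (\<Sum>\<alpha>\<in>I. x j ^ \<alpha> j * M \<alpha>)"
    unfolding M_def split by (simp add: mult.left_commute)
  also have "\<dots> = (\<Sum>\<alpha>\<in>J. x j ^ \<alpha> j * M \<alpha>) + (\<Sum>\<alpha>\<in>I - J. x j ^ \<alpha> j * M \<alpha>)"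
    using sum.subset_diff[OF J(3) step.prems(1), of "\<lambda>\<alpha>. x j ^ \<alpha> j * M \<alpha>"] by simp
  also have "(\<Sum>\<alpha>\<in>J. x j ^ \<alpha> j * M \<alpha>) = x j ^ m * A"
    unfolding A_def sum_distrib_left by (intro sum.cong) (auto simp: J_def)
  also have "(\<Sum>\<alpha>\<in>I - J. x j ^ \<alpha> j * M \<alpha>) = x j ^ m * (x j * B)"
    unfolding B_def sum_distrib_left
  proof (intro sum.cong refl)
    fix \<alpha> assume "\<alpha> \<in> I - J"
    then have "m < \<alpha> j" using mle[of \<alpha>] by (auto simp: J_def)
    then have "\<alpha> j = m + Suc (\<alpha> j - Suc m)" by simp
    then have "x j ^ \<alpha> j = x j ^ m * (x j * x j ^ (\<alpha> j - Suc m))" by (metis power_Suc power_add)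
    then show "x j ^ \<alpha> j * M \<alpha> = x j ^ m * (x j * (x j ^ (\<alpha> j - Suc m) * M \<alpha>))" by (simp add: mult.assoc)
  qed
  finally have sum_eq: "(\<Sum>\<alpha>\<in>I. \<iota> (c \<alpha>) * (\<Prod>i=j..n. x i ^ \<alpha> i)) = x j ^ m * (A + x j * B)"
    by (simp add: distrib_left)
  show ?case
  proof
    assume "(\<Sum>\<alpha>\<in>I. \<iota> (c \<alpha>) * (\<Prod>i=j..n. x i ^ \<alpha> i)) \<in> P j"
    then have in_P: "x j ^ m * (A + x j * B) \<in> P j" by (simp add: sum_eq)
    have "x j ^ m \<in> S" "A + x j * B \<in> S" 
      using subring_of_closed(4,6,7)[OF S] xS[OF j] AS by simp_all
    moreover have "x j ^ m \<notin> P j" using prime_in_power[OF pj S xS[OF j] x(2)[OF j]] .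
    \<comment> \<open>Primality of \<open>P j\<close> removes the power of \<open>x j\<close>; in
      \<open>P (Suc j)\<close>, which contains \<open>x j\<close>, the term with \<open>B\<close>
      can then be discarded.\<close>
    ultimately have "A + x j * B \<in> P j" using prime_in_rules(6)[OF pj] in_P by blast
    then have 1: "A + x j * B \<in> P (Suc j)" using inc j by auto
    have "- B \<in> S" using subring_of_closed(3)[OF S] AS by simp
    then have "- B * x j \<in> P (Suc j)" using prime_in_rules(5)[OF pSj] x(1)[OF j] by blast
    then have "A + x j * B + - B * x j \<in> P (Suc j)" using prime_in_rules(4)[OF pSj] 1 by blast
    then show False using AnP by (simp add: algebra_simps)
  qed
qed

text \<open>A dimension count. Elements \<open>x i\<close> of \<open>P (Suc i) - P i\<close> for
  \<open>i \<le> n\<close> satisfy no polynomial relation by the preceding lemma. But the monomials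
  in these \<open>n + 1\<close> elements outnumber the monomials in \<open>n\<close> generators that
  span them, so a relation exists.\<close>

lemma no_long_prime_chain:
  fixes \<iota> :: "complex \<Rightarrow> 'a::comm_ring_1" and g :: "nat \<Rightarrow> 'a"
  assumes S: "subring_of S" and h: "unital_hom \<iota>" and \<iota>S: "\<And>c. \<iota> c \<in> S"
    and gen: "\<And>U. (\<And>c. \<iota> c \<in> U) \<Longrightarrow> (\<And>i. i < n \<Longrightarrow> g i \<in> U) \<Longrightarrow>
        (\<And>a b. a \<in> U \<Longrightarrow> b \<in> U \<Longrightarrow> a + b \<in> U \<and> a * b \<in> U) \<Longrightarrow> S \<subseteq> U"
    and P: "\<And>i. i \<le> Suc n \<Longrightarrow> prime_in S (P i)" and inc: "\<And>i. i \<le> n \<Longrightarrow> P i \<subset> P (Suc i)"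
  shows False
proof -
  note hr = unital_hom_rules[OF h]
  interpret vector_space "\<lambda>c x. \<iota> c * x"
    by unfold_locales (simp_all add: algebra_simps hr)
  define T where "T D = (\<lambda>a. \<Prod>i<n. g i ^ a i) ` ({..<n} \<rightarrow>\<^sub>E {..D})" for D :: nat
  have finT: "finite (T D)" and cardT: "card (T D) \<le> (D + 1) ^ n" for D
  proof -
    have fin: "finite ({..<n} \<rightarrow>\<^sub>E {..D})" by (intro finite_PiE) auto
    then show "finite (T D)" by (simp add: T_def)
    have "card ({..<n} \<rightarrow>\<^sub>E {..D}) = (D + 1) ^ n" by (simp add: card_PiE)
    then show "card (T D) \<le> (D + 1) ^ n" unfolding T_def using card_image_le[OF fin] by metis
  qed
  have TI: "(\<Prod>i<n. g i ^ a i) \<in> T D" if "\<And>i. i < n \<Longrightarrow> a i \<le> D" for a D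
  proof -
    have "(\<Prod>i<n. g i ^ a i) = (\<Prod>i<n. g i ^ restrict a {..<n} i)" by (intro prod.cong) auto
    moreover have "restrict a {..<n} \<in> {..<n} \<rightarrow>\<^sub>E {..D}" using that by auto
    ultimately show ?thesis unfolding T_def by (intro image_eqI)
  qed
  have mono: "span (T D) \<subseteq> span (T D')" if "D \<le> D'" for D D'
  proof (intro span_mono subsetI)
    fix y assume "y \<in> T D"
    then obtain a where "a \<in> {..<n} \<rightarrow>\<^sub>E {..D}" "y = (\<Prod>i<n. g i ^ a i)" by (auto simp: T_def)
    then show "y \<in> T D'" using TI[of a D'] that by (metis PiE_mem atMost_iff lessThan_iff order.trans)
  qed
  have mult: "y * z \<in> span (T (D + D'))" if y: "y \<in> span (T D)" and z: "z \<in> span (T D')" for y z D D'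
  proof -
    have 1: "u * v \<in> T (D + D')" if "u \<in> T D" "v \<in> T D'" for u v
    proof -
      obtain a where a: "a \<in> {..<n} \<rightarrow>\<^sub>E {..D}" "u = (\<Prod>i<n. g i ^ a i)"
        using \<open>u \<in> T D\<close> unfolding T_def by blast
      obtain b where b: "b \<in> {..<n} \<rightarrow>\<^sub>E {..D'}" "v = (\<Prod>i<n. g i ^ b i)"
        using \<open>v \<in> T D'\<close> unfolding T_def by blast
      note ab = a b
      have "u * v = (\<Prod>i<n. g i ^ (a i + b i))" unfolding ab by (simp add: prod.distrib power_add)
      moreover have "a i + b i \<le> D + D'" if "i < n" for i using ab that by (intro add_mono) auto
      ultimately show ?thesis using TI[of "\<lambda>i. a i + b i"] by simp
    qed
    have 2: "u * z \<in> span (T (D + D'))" if "u \<in> T D" for u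
      using z
    proof (induction rule: span_induct_alt)
      case base
      then show ?case by (simp add: span_zero)
    next
      case (step c v w)
      have "\<iota> c * (u * v) \<in> span (T (D + D'))" using 1[OF that step(1)] span_base span_scale by blast
      then have "\<iota> c * (u * v) + u * w \<in> span (T (D + D'))" using step.IH span_add by blast
      then show ?case by (simp add: algebra_simps)
    qed
    show ?thesis using y
    proof (induction rule: span_induct_alt)
      case base
      then show ?case by (simp add: span_zero)
    next
      case (step c v w)
      have "\<iota> c * (v * z) \<in> span (T (D + D'))" using 2[OF step(1)] span_scale by blast
      then have "\<iota> c * (v * z) + w * z \<in> span (T (D + D'))" using step.IH span_add by blast
      then show ?case by (simp add: algebra_simps)
    qed
  qed
  have one: "1 \<in> span (T 0)" using TI[of "\<lambda>_. 0" 0] by (intro span_base) simp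
  define U where "U = (\<Union>D. span (T D))"
  have "S \<subseteq> U"
  proof (rule gen)
    show "\<iota> c \<in> U" for c unfolding U_def using span_scale[OF one, of c] by auto
    show "g i \<in> U" if "i < n" for i
    proof -
      have "(\<Prod>k<n. g k ^ (if k = i then 1 else 0)) = (\<Prod>k<n. if k = i then g k else 1)"
        by (intro prod.cong) auto
      also have "\<dots> = g i" using that by simp
      finally have "g i \<in> T 1" using TI[of "\<lambda>k. if k = i then 1 else 0" 1] by simp
      then show ?thesis unfolding U_def using span_base by blast
    qed
    show "a + b \<in> U \<and> a * b \<in> U" if ab: "a \<in> U" "b \<in> U" for a b
    proof -
      obtain D D' where D: "a \<in> span (T D)" "b \<in> span (T D')" using ab by (auto simp: U_def)
      then have "a \<in> span (T (D + D'))" "b \<in> span (T (D + D'))" using mono by (meson le_add1 le_add2 subsetD)+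
      then have "a + b \<in> span (T (D + D'))" by (rule span_add)
      then show ?thesis using mult[OF D] by (auto simp: U_def)
    qed
  qed
  have "\<exists>x. x \<in> P (Suc i) \<and> x \<notin> P i" if "i \<le> n" for i using inc[OF that] by blast
  then obtain x where x: "\<And>i. i \<le> n \<Longrightarrow> x i \<in> P (Suc i)" "\<And>i. i \<le> n \<Longrightarrow> x i \<notin> P i" by metis
  have "x i \<in> U" if "i \<le> n" for i using x(1)[OF that] P[of "Suc i"] that \<open>S \<subseteq> U\<close> prime_in_rules(1) by (metis Suc_le_mono subsetD)
  then have "\<exists>D. x i \<in> span (T D)" if "i \<le> n" for i using that by (auto simp: U_def)
  then obtain d where d: "\<And>i. i \<le> n \<Longrightarrow> x i \<in> span (T (d i))" by metis
  define K where "K = Suc (\<Sum>i\<le>n. d i)"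
  have xK: "x i \<in> span (T K)" if "i \<le> n" for i
  proof -
    have "d i \<le> (\<Sum>i\<le>n. d i)" using that by (intro member_le_sum) auto
    then show ?thesis using d[OF that] mono[of "d i" K] by (auto simp: K_def)
  qed
  have pow: "x i ^ a \<in> span (T (K * a))" if "i \<le> n" for i a
  proof (induction a)
    case 0
    then show ?case using one by simp
  next
    case (Suc a)
    then show ?case using mult[OF xK[OF that] Suc] by (simp add: add.commute)
  qed
  have mon: "(\<Prod>i\<in>J. x i ^ \<alpha> i) \<in> span (T (K * (\<Sum>i\<in>J. \<alpha> i)))" if "finite J" "J \<subseteq> {..n}" for J \<alpha>
    using that
  proof (induction J rule: finite_induct)
    case empty
    then show ?case using one by simp
  next
    case (insert i J)
    have "x i ^ \<alpha> i * (\<Prod>i\<in>J. x i ^ \<alpha> i) \<in> span (T (K * \<alpha> i + K * (\<Sum>i\<in>J. \<alpha> i)))"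
      using insert by (intro mult pow) auto
    then show ?case using insert by (simp add: algebra_simps)
  qed
  \<comment> \<open>Monomials with exponents up to \<open>e\<close> in the \<open>x i\<close> lie in
    the span of \<open>T (L * e)\<close>. The choice of \<open>e\<close> gives \<open>(L * e + 1) ^
    n \<le> (L + 1) ^ n * (e + 1) ^ n = e * (e + 1) ^ n < (e + 1) ^ Suc n\<close>.\<close>
  define L where "L = Suc n * K"
  define e where "e = (L + 1) ^ n"
  define F where "F \<alpha> = (\<Prod>i=0..n. x i ^ \<alpha> i)" for \<alpha> :: "nat \<Rightarrow> nat"
  define E where "E = ({0..n} \<rightarrow>\<^sub>E {..e})"
  have finE: "finite E" by (simp add: E_def finite_PiE)
  have cardE: "card E = (e + 1) ^ Suc n" by (simp add: E_def card_PiE)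
  have FE: "F \<alpha> \<in> span (T (L * e))" if "\<alpha> \<in> E" for \<alpha>
  proof -
    have "(\<Sum>i=0..n. \<alpha> i) \<le> (\<Sum>i=0..n. e)" using that by (intro sum_mono) (auto simp: E_def PiE_def)
    then have "K * (\<Sum>i=0..n. \<alpha> i) \<le> K * (Suc n * e)" by (intro mult_left_mono) simp_all
    then have "K * (\<Sum>i=0..n. \<alpha> i) \<le> L * e" by (simp add: L_def algebra_simps)
    moreover have "F \<alpha> \<in> span (T (K * (\<Sum>i=0..n. \<alpha> i)))" unfolding F_def by (intro mon) auto
    ultimately show ?thesis using mono by blast
  qed
  have "(L * e + 1) ^ n \<le> ((L + 1) * (e + 1)) ^ n" by (intro power_mono) auto
  also have "\<dots> = e * (e + 1) ^ n" unfolding power_mult_distrib e_def[symmetric] ..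
  also have "\<dots> < (e + 1) ^ Suc n" by simp
  finally have lt: "card (T (L * e)) < card E" using cardT[of "L * e"] cardE by linarith
  have "\<exists>I c. I \<subseteq> E \<and> I \<noteq> {} \<and> (\<forall>\<alpha>\<in>I. c \<alpha> \<noteq> 0) \<and> (\<Sum>\<alpha>\<in>I. \<iota> (c \<alpha>) * F \<alpha>) = 0"
  \<comment> \<open>Linear dependence speaks of the set of values; if two exponents have the same
    monomial value, their difference is already a relation.\<close>
  proof (cases "inj_on F E")
    case True
    then have "card (F ` E) = card E" by (rule card_image)
    then have "dependent (F ` E)"
      using independent_span_bound[OF finT[of "L * e"], of "F ` E"] FE lt by (metis image_subsetI not_less)
    then obtain t u where tu: "finite t" "t \<subseteq> F ` E" "(\<Sum>v\<in>t. \<iota> (u v) * v) = 0" "\<exists>v\<in>t. u v \<noteq> 0"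
      unfolding dependent_explicit by blast
    define I where "I = {\<alpha> \<in> E. F \<alpha> \<in> t \<and> u (F \<alpha>) \<noteq> 0}"
    have img: "F ` I = {v \<in> t. u v \<noteq> 0}" using tu(2) by (auto simp: I_def)
    have "(\<Sum>\<alpha>\<in>I. \<iota> (u (F \<alpha>)) * F \<alpha>) = (\<Sum>v\<in>F ` I. \<iota> (u v) * v)"
      using inj_on_subset[OF True, of I] by (subst sum.reindex) (auto simp: I_def)
    also have "\<dots> = (\<Sum>v\<in>t. \<iota> (u v) * v)"
      unfolding img using tu(1) by (intro sum.mono_neutral_left) (auto simp: hr)
    finally have "(\<Sum>\<alpha>\<in>I. \<iota> (u (F \<alpha>)) * F \<alpha>) = 0" using tu(3) by simp
    moreover have "I \<noteq> {}" using tu(2,4) by (auto simp: I_def)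
    ultimately show ?thesis by (intro exI[of _ I] exI[of _ "\<lambda>\<alpha>. u (F \<alpha>)"]) (auto simp: I_def)
  next
    case False
    then obtain \<alpha> \<beta> where ab: "\<alpha> \<in> E" "\<beta> \<in> E" "F \<alpha> = F \<beta>" "\<alpha> \<noteq> \<beta>" by (auto simp: inj_on_def)
    have "(\<Sum>\<gamma>\<in>{\<alpha>, \<beta>}. \<iota> (if \<gamma> = \<alpha> then 1 else -1) * F \<gamma>) = 0" using ab by (simp add: hr)
    then show ?thesis using ab by (intro exI[of _ "{\<alpha>, \<beta>}"] exI[of _ "\<lambda>\<gamma>. if \<gamma> = \<alpha> then 1 else -1"]) auto
  qed
  then obtain I c where I: "I \<subseteq> E" "I \<noteq> {}" "\<And>\<alpha>. \<alpha> \<in> I \<Longrightarrow> c \<alpha> \<noteq> 0" "(\<Sum>\<alpha>\<in>I. \<iota> (c \<alpha>) * F \<alpha>) = 0"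
    by blast
  have "(\<Sum>\<alpha>\<in>I. \<iota> (c \<alpha>) * (\<Prod>i=0..n. x i ^ \<alpha> i)) \<notin> P 0"
  proof (rule monomial_sum_notin_prime_chain[OF S h \<iota>S P])
    show "P i \<subseteq> P (Suc i)" if "i \<le> n" for i using inc[OF that] by blast
    show "finite I" using I finE finite_subset by blast
    show "inj_on (\<lambda>\<alpha>. restrict \<alpha> {0..n}) I"
      using I(1) by (intro inj_onI) (metis E_def PiE_restrict subsetD)
  qed (use x I in auto)
  moreover have "0 \<in> P 0" using P[of 0] by (simp add: prime_in_def)
  ultimately show False using I(4) by (simp add: F_def)
qed

section \<open>Adjoining exponentials\<close>

lemma poly_mapping_sum_single:
  "p = (\<Sum>k\<in>Poly_Mapping.keys p. Poly_Mapping.single k (Poly_Mapping.lookup p k))"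
proof (rule poly_mapping_eqI)
  fix k
  show "Poly_Mapping.lookup p k = Poly_Mapping.lookup (\<Sum>k\<in>Poly_Mapping.keys p. Poly_Mapping.single k (Poly_Mapping.lookup p k)) k"
    by (cases "k \<in> Poly_Mapping.keys p")
      (auto simp: lookup_sum lookup_single when_def in_keys_iff sum.delta' cong: if_cong)
qed

lemma poly_mapping_single_add_induct [case_names single add]:
  fixes p :: "'m \<Rightarrow>\<^sub>0 'a::comm_monoid_add"
  assumes "\<And>k a. P (Poly_Mapping.single k a)" "\<And>p q. P p \<Longrightarrow> P q \<Longrightarrow> P (p + q)"
  shows "P p"
proof -
  have "P (\<Sum>k\<in>K. Poly_Mapping.single k (Poly_Mapping.lookup p k))" if "finite K" for K
    using that
  proof (induction K)
    case empty
    show ?case using assms(1)[of undefined 0] by simp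
  next
    case (insert k K)
    then show ?case using assms by simp
  qed
  then show ?thesis using poly_mapping_sum_single[of p] by (metis finite_keys)
qed

lemma unital_hom_poly_mappingI:
  fixes E :: "('m::comm_monoid_add \<Rightarrow>\<^sub>0 'a::comm_ring_1) \<Rightarrow> 'b::comm_ring_1"
  assumes one: "E 1 = 1" and add: "\<And>p q. E (p + q) = E p + E q"
    and single: "\<And>k l a b. E (Poly_Mapping.single (k + l) (a * b)) = E (Poly_Mapping.single k a) * E (Poly_Mapping.single l b)"
  shows "unital_hom E"
proof -
  have "E (p * q) = E p * E q" for p q
  proof (induction p rule: poly_mapping_single_add_induct)
    case (single k a)
    show ?case
    proof (induction q rule: poly_mapping_single_add_induct)
      case (single l b)
      show ?case by (simp add: mult_single assms(3))
    next
      case (add p q)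
      then show ?case by (simp add: distrib_left assms(2))
    qed
  next
    case (add p q)
    then show ?case by (simp add: distrib_right assms(2))
  qed
  then show ?thesis using one assms(2) by (simp add: unital_hom_def)
qed

lemma lookup_mapp_zero:
  "(\<And>k. f k 0 = 0) \<Longrightarrow> Poly_Mapping.lookup (Poly_Mapping.mapp f p) k = f k (Poly_Mapping.lookup p k)"
  by (auto simp: lookup_mapp when_def in_keys_iff)

definition weighted_deriv :: "('a::comm_ring_1 \<Rightarrow> 'a) \<Rightarrow> ('m \<Rightarrow> 'a) \<Rightarrow> ('m::comm_monoid_add \<Rightarrow>\<^sub>0 'a) \<Rightarrow> 'm \<Rightarrow>\<^sub>0 'a" where
  "weighted_deriv d w p = Poly_Mapping.mapp (\<lambda>k a. d a + w k * a) p"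

lemma lookup_weighted_deriv:
  assumes "derivation d"
  shows "Poly_Mapping.lookup (weighted_deriv d w p) k = d (Poly_Mapping.lookup p k) + w k * Poly_Mapping.lookup p k"
  unfolding weighted_deriv_def by (rule lookup_mapp_zero) (simp add: derivation_rules[OF assms])

text \<open>\<open>w k\<close> is the logarithmic derivative of the monomial with exponent
  \<open>k\<close>; on monomials its additivity is the Leibniz rule.\<close>

lemma derivation_weighted_deriv:
  assumes d: "derivation d" and w: "\<And>k l. w (k + l) = w k + w l"
  shows "derivation (weighted_deriv d w)"
proof -
  note dr = derivation_rules[OF d]
  have add: "weighted_deriv d w (p + q) = weighted_deriv d w p + weighted_deriv d w q" for p q
    by (rule poly_mapping_eqI) (simp add: lookup_weighted_deriv[OF d] lookup_add dr algebra_simps)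
  have single: "weighted_deriv d w (Poly_Mapping.single k a) = Poly_Mapping.single k (d a + w k * a)" for k a
    by (rule poly_mapping_eqI) (auto simp: lookup_weighted_deriv[OF d] lookup_single when_def dr)
  have "weighted_deriv d w (p * q) = weighted_deriv d w p * q + p * weighted_deriv d w q" for p q
  proof (induction p rule: poly_mapping_single_add_induct)
    case (single k a)
    show ?case
    proof (induction q rule: poly_mapping_single_add_induct)
      case (single l b)
      have "d (a * b) + w (k + l) * (a * b) = (d a + w k * a) * b + a * (d b + w l * b)"
        by (simp add: dr w algebra_simps)
      then show ?case by (simp add: mult_single \<open>\<And>k a. weighted_deriv d w (Poly_Mapping.single k a) = _\<close> flip: single_add)
    next
      case (add p q)
      then show ?case by (simp add: distrib_left \<open>\<And>p q. weighted_deriv d w (p + q) = _\<close> add_ac)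
    qed
  next
    case (add p q)
    then show ?case by (simp add: distrib_right distrib_left \<open>\<And>p q. weighted_deriv d w (p + q) = _\<close> add_ac)
  qed
  then show ?thesis using add by (simp add: derivation_def)
qed

lemma unital_hom_coeff_map:
  assumes "unital_hom h"
  shows "unital_hom (Poly_Mapping.mapp (\<lambda>_. h) :: ('m::comm_monoid_add \<Rightarrow>\<^sub>0 _) \<Rightarrow> _)"
proof (rule unital_hom_poly_mappingI)
  note h = unital_hom_rules[OF assms]
  have l: "Poly_Mapping.lookup (Poly_Mapping.mapp (\<lambda>_. h) p) k = h (Poly_Mapping.lookup p k)" for p :: "'m \<Rightarrow>\<^sub>0 _" and k
    by (rule lookup_mapp_zero) (rule h)
  have s: "Poly_Mapping.mapp (\<lambda>_. h) (Poly_Mapping.single k a) = Poly_Mapping.single k (h a)" for k :: 'm and a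
    by (rule poly_mapping_eqI) (auto simp: l lookup_single when_def h)
  show "Poly_Mapping.mapp (\<lambda>_. h) (1 :: 'm \<Rightarrow>\<^sub>0 _) = 1"
    unfolding single_one[symmetric] s h ..
  show "Poly_Mapping.mapp (\<lambda>_. h) (p + q) = Poly_Mapping.mapp (\<lambda>_. h) p + Poly_Mapping.mapp (\<lambda>_. h) q" for p q :: "'m \<Rightarrow>\<^sub>0 _"
    by (rule poly_mapping_eqI) (simp add: l lookup_add h)
  show "Poly_Mapping.mapp (\<lambda>_. h) (Poly_Mapping.single (k + l) (a * b))
     = Poly_Mapping.mapp (\<lambda>_. h) (Poly_Mapping.single k a) * Poly_Mapping.mapp (\<lambda>_. h) (Poly_Mapping.single l b)"
    for k l :: 'm and a b
    by (simp add: s mult_single h)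
qed

definition kill_vars :: "nat set \<Rightarrow> ((nat \<Rightarrow>\<^sub>0 nat) \<Rightarrow>\<^sub>0 'a) \<Rightarrow> (nat \<Rightarrow>\<^sub>0 nat) \<Rightarrow>\<^sub>0 'a::comm_ring_1" where
  "kill_vars Z = Poly_Mapping.mapp (\<lambda>k a. if Poly_Mapping.keys k \<inter> Z = {} then a else 0)"

lemma lookup_kill_vars:
  "Poly_Mapping.lookup (kill_vars Z p) k = (if Poly_Mapping.keys k \<inter> Z = {} then Poly_Mapping.lookup p k else 0)"
  unfolding kill_vars_def by (rule lookup_mapp_zero) simp

lemma keys_add_nat: "Poly_Mapping.keys (k + l) = Poly_Mapping.keys k \<union> Poly_Mapping.keys (l :: nat \<Rightarrow>\<^sub>0 nat)"
  by (auto simp: in_keys_iff lookup_add)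

text \<open>\<open>kill_vars Z\<close> sets the variables in \<open>Z\<close> to 0. Natural
  exponents cannot cancel, so a product of monomials avoids \<open>Z\<close> exactly when both
  factors do.\<close>

lemma unital_hom_kill_vars: "unital_hom (kill_vars Z)"
proof (rule unital_hom_poly_mappingI)
  have s: "kill_vars Z (Poly_Mapping.single k a) = (if Poly_Mapping.keys k \<inter> Z = {} then Poly_Mapping.single k a else 0)" for k and a :: 'a
    by (rule poly_mapping_eqI) (auto simp: lookup_kill_vars lookup_single when_def)
  show "kill_vars Z 1 = (1 :: _ \<Rightarrow>\<^sub>0 'a)"
    unfolding single_one[symmetric] s by simp
  show "kill_vars Z (p + q) = kill_vars Z p + kill_vars Z q" for p q :: "_ \<Rightarrow>\<^sub>0 'a"
    by (rule poly_mapping_eqI) (simp add: lookup_kill_vars lookup_add)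
  show "kill_vars Z (Poly_Mapping.single (k + l) (a * b))
     = kill_vars Z (Poly_Mapping.single k a) * kill_vars Z (Poly_Mapping.single l b)" for k l and a b :: 'a
    by (auto simp: s mult_single keys_add_nat)
qed

lemma unital_hom_lookup_0: "unital_hom (\<lambda>p :: (nat \<Rightarrow>\<^sub>0 nat) \<Rightarrow>\<^sub>0 'a::comm_ring_1. Poly_Mapping.lookup p 0)"
proof (rule unital_hom_poly_mappingI)
  have "k + l = 0 \<longleftrightarrow> k = 0 \<and> l = 0" for k l :: "nat \<Rightarrow>\<^sub>0 nat"
  proof
    assume "k + l = 0"
    then have "Poly_Mapping.keys k \<union> Poly_Mapping.keys l = {}" by (metis keys_add_nat keys_zero)
    then show "k = 0 \<and> l = 0" by (auto simp: poly_mapping_eq_iff in_keys_iff fun_eq_iff)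
  qed simp
  then show "Poly_Mapping.lookup (Poly_Mapping.single (k + l) (a * b)) 0
     = Poly_Mapping.lookup (Poly_Mapping.single k a) 0 * Poly_Mapping.lookup (Poly_Mapping.single l b) 0" for k l :: "nat \<Rightarrow>\<^sub>0 nat" and a b :: 'a
    by (auto simp: lookup_single when_def)
qed (simp_all add: lookup_add)

text \<open>In an order compatible with addition, \<open>\<alpha> + \<beta>\<close> is reached from
  exponents bounded by \<open>\<alpha>\<close> and \<open>\<beta>\<close> in one way only.\<close>

lemma lookup_mult_top:
  fixes p q :: "'m::{linordered_cancel_ab_semigroup_add, comm_monoid_add} \<Rightarrow>\<^sub>0 'a::comm_ring_1"
  assumes "\<And>k. k > \<alpha> \<Longrightarrow> Poly_Mapping.lookup p k = 0" "\<And>k. k > \<beta> \<Longrightarrow> Poly_Mapping.lookup q k = 0"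
  shows "Poly_Mapping.lookup (p * q) (\<alpha> + \<beta>) = Poly_Mapping.lookup p \<alpha> * Poly_Mapping.lookup q \<beta>"
proof -
  let ?s = "\<lambda>p k. Poly_Mapping.single k (Poly_Mapping.lookup p k)"
  have "p * q = (\<Sum>k\<in>Poly_Mapping.keys p. ?s p k) * (\<Sum>l\<in>Poly_Mapping.keys q. ?s q l)"
    using poly_mapping_sum_single[of p] poly_mapping_sum_single[of q] by simp
  also have "\<dots> = (\<Sum>k\<in>Poly_Mapping.keys p. \<Sum>l\<in>Poly_Mapping.keys q.
      Poly_Mapping.single (k + l) (Poly_Mapping.lookup p k * Poly_Mapping.lookup q l))"
    by (simp add: sum_product mult_single)
  finally have "Poly_Mapping.lookup (p * q) (\<alpha> + \<beta>) = (\<Sum>k\<in>Poly_Mapping.keys p. \<Sum>l\<in>Poly_Mapping.keys q.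
      if k + l = \<alpha> + \<beta> then Poly_Mapping.lookup p k * Poly_Mapping.lookup q l else 0)"
    by (simp add: lookup_sum lookup_single when_def)
  also have "\<dots> = (\<Sum>k\<in>Poly_Mapping.keys p. \<Sum>l\<in>Poly_Mapping.keys q.
      if l = \<beta> then (if k = \<alpha> then Poly_Mapping.lookup p k * Poly_Mapping.lookup q l else 0) else 0)"
  proof (intro sum.cong refl)
    fix k l assume kl: "k \<in> Poly_Mapping.keys p" "l \<in> Poly_Mapping.keys q"
    then have "k \<le> \<alpha>" "l \<le> \<beta>" using assms by (meson in_keys_iff not_le)+
    then have "k + l = \<alpha> + \<beta> \<longleftrightarrow> k = \<alpha> \<and> l = \<beta>"
      by (metis add_le_less_mono add_less_le_mono order_le_less order_less_irrefl)
    then show "(if k + l = \<alpha> + \<beta> then Poly_Mapping.lookup p k * Poly_Mapping.lookup q l else 0)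
       = (if l = \<beta> then (if k = \<alpha> then Poly_Mapping.lookup p k * Poly_Mapping.lookup q l else 0) else 0)" by simp
  qed
  also have "\<dots> = Poly_Mapping.lookup p \<alpha> * Poly_Mapping.lookup q \<beta>"
    by (cases "Poly_Mapping.lookup q \<beta> = 0") (auto simp: in_keys_iff)
  finally show ?thesis .
qed

section \<open>The derivation with exponentials and its constants\<close>

type_synonym base_ring = "complex poly poly poly"
type_synonym big_ring = "(nat \<Rightarrow>\<^sub>0 nat) \<Rightarrow>\<^sub>0 base_ring"

definition weight :: "(nat \<Rightarrow>\<^sub>0 nat) \<Rightarrow> complex poly" where
  "weight \<alpha> = (\<Sum>i\<in>Poly_Mapping.keys \<alpha>. monom (of_nat (Poly_Mapping.lookup \<alpha> i)) i)"

lemma coeff_weight: "coeff (weight \<alpha>) i = of_nat (Poly_Mapping.lookup \<alpha> i)"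
  by (auto simp: weight_def coeff_sum in_keys_iff)

lemma weight_add: "weight (\<alpha> + \<beta>) = weight \<alpha> + weight \<beta>"
  by (rule poly_eqI) (simp add: coeff_weight lookup_add)

text \<open>The reason for the factors \<open>t ^ i\<close>: distinct monomials in the exponentials
  have distinct logarithmic derivatives.\<close>

lemma weight_inj: "weight \<alpha> = weight \<beta> \<longleftrightarrow> \<alpha> = \<beta>"
proof
  assume "weight \<alpha> = weight \<beta>"
  then have "(of_nat (Poly_Mapping.lookup \<alpha> i) :: complex) = of_nat (Poly_Mapping.lookup \<beta> i)" for i
    by (metis coeff_weight)
  then show "\<alpha> = \<beta>" by (intro poly_mapping_eqI) simp
qed simp

text \<open>The extra variables are exponentials: the derivation multiplies \<open>x\<^sub>i\<close> by \<open>2 t (t - 1) t\<^sup>i\<close>.\<close>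

definition big_deriv :: "big_ring \<Rightarrow> big_ring" where
  "big_deriv = weighted_deriv vfield (\<lambda>\<alpha>. [:[:[:0, -2, 2:] * weight \<alpha>:]:])"

definition big_const :: "complex \<Rightarrow> big_ring" where
  "big_const c = Poly_Mapping.single 0 [:[:[:c:]:]:]"

lemma derivation_big_deriv: "derivation big_deriv"
  unfolding big_deriv_def
  by (intro derivation_weighted_deriv derivation_vfield) (simp only: weight_add distrib_left add_pCons add_0)

lemmas lookup_big_deriv = lookup_weighted_deriv[OF derivation_vfield, where w = "\<lambda>\<alpha>. [:[:[:0, -2, 2:] * weight \<alpha>:]:]", folded big_deriv_def]

lemma unital_hom_big_const: "unital_hom big_const"
  by (simp add: unital_hom_def big_const_def single_add[symmetric] mult_single single_one[symmetric] one_pCons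
    mult.commute del: single_one)

lemma big_deriv_const: "big_deriv (big_const c) = 0"
  by (rule poly_mapping_eqI)
    (auto simp: lookup_big_deriv big_const_def lookup_single when_def vfield_const derivation_rules[OF derivation_vfield] weight_def)

lemma big_deriv_scale: "big_deriv (big_const c * p) = big_const c * big_deriv p"
  by (simp add: derivation_rules[OF derivation_big_deriv] big_deriv_const)

lemma lookup_const_mult: "Poly_Mapping.lookup (big_const c * p) \<alpha> = [:[:[:c:]:]:] * Poly_Mapping.lookup p \<alpha>"
proof (induction p rule: poly_mapping_single_add_induct)
  case (single k a)
  then show ?case by (auto simp: big_const_def mult_single lookup_single when_def)
next
  case (add p q)
  then show ?case by (simp add: distrib_left lookup_add)
qed

text \<open>The top monomials reduce the equation to the base ring, where \<open>\<omega>\<close> in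
  \<open>vfield_wronskian\<close> is the difference of the weights of the two leading
  exponents.\<close>

lemma big_wronskian_top:
  assumes a0: "a \<noteq> 0" and b0: "b \<noteq> 0" and eq: "big_deriv a * b = a * big_deriv b"
  shows "Max (Poly_Mapping.keys a) = Max (Poly_Mapping.keys b) \<and>
    (\<exists>c. Poly_Mapping.lookup a (Max (Poly_Mapping.keys a)) = [:[:[:c:]:]:] * Poly_Mapping.lookup b (Max (Poly_Mapping.keys a)))"
proof -
  define \<alpha> \<beta> where "\<alpha> = Max (Poly_Mapping.keys a)" and "\<beta> = Max (Poly_Mapping.keys b)"
  have top: "Poly_Mapping.lookup p k = 0" if "k > Max (Poly_Mapping.keys p)" for p :: big_ring and k
    using that by (metis Max_ge finite_keys in_keys_iff not_le)
  have topd: "Poly_Mapping.lookup (big_deriv p) k = 0" if "k > Max (Poly_Mapping.keys p)" for p k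
    using top[OF that] by (simp add: lookup_big_deriv derivation_rules[OF derivation_vfield])
  have nz: "Poly_Mapping.lookup p (Max (Poly_Mapping.keys p)) \<noteq> 0" if "p \<noteq> 0" for p :: big_ring
  proof -
    have "Poly_Mapping.keys p \<noteq> {}" using that by (metis poly_mapping_sum_single sum.empty)
    then show ?thesis using Max_in[of "Poly_Mapping.keys p"] by (simp add: in_keys_iff)
  qed
  define f g where "f = Poly_Mapping.lookup a \<alpha>" and "g = Poly_Mapping.lookup b \<beta>"
  define Wa Wb where "Wa = [:[:[:0, -2, 2:] * weight \<alpha>:]:]" and "Wb = [:[:[:0, -2, 2:] * weight \<beta>:]:]"
  have fg: "f \<noteq> 0" "g \<noteq> 0" using nz a0 b0 by (simp_all add: f_def g_def \<alpha>_def \<beta>_def)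
  have "Poly_Mapping.lookup (big_deriv a * b) (\<alpha> + \<beta>) = (vfield f + Wa * f) * g"
    using lookup_mult_top[of \<alpha> "big_deriv a" \<beta> b] top topd
    by (simp add: lookup_big_deriv f_def g_def Wa_def \<alpha>_def \<beta>_def)
  moreover have "Poly_Mapping.lookup (a * big_deriv b) (\<alpha> + \<beta>) = f * (vfield g + Wb * g)"
    using lookup_mult_top[of \<alpha> a \<beta> "big_deriv b"] top topd
    by (simp add: lookup_big_deriv f_def g_def Wb_def \<alpha>_def \<beta>_def)
  ultimately have e: "(vfield f + Wa * f) * g = f * (vfield g + Wb * g)" using eq by simp
  have "vfield f * g - f * vfield g = (vfield f + Wa * f) * g - f * (vfield g + Wb * g) + (Wb - Wa) * (f * g)"
    by (simp only: algebra_simps)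
  also have "\<dots> = (Wb - Wa) * (f * g)" using e by simp
  also have "Wb - Wa = [:[:[:0, -2, 2:] * (weight \<beta> - weight \<alpha>):]:]"
    unfolding Wa_def Wb_def by (simp only: diff_pCons right_diff_distrib diff_self)
  finally have "weight \<beta> - weight \<alpha> = 0 \<and> (\<exists>c. f = [:[:[:c:]:]:] * g)"
    by (intro vfield_wronskian fg)
  then show ?thesis unfolding f_def g_def using weight_inj[of \<beta> \<alpha>] by (auto simp flip: \<alpha>_def \<beta>_def)
qed

text \<open>As in the base ring: the difference \<open>h\<close> cancels the leading coefficient,
  yet if nonzero it would have the same leading exponent as \<open>b\<close>.\<close>

lemma big_constants:
  assumes b0: "b \<noteq> 0" and eq: "big_deriv a * b = a * big_deriv b"
  shows "\<exists>c. a = big_const c * b"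
proof (cases "a = 0")
  case True
  then show ?thesis using unital_hom_rules(3)[OF unital_hom_big_const] by (intro exI[of _ 0]) simp
next
  case False
  define \<alpha> where "\<alpha> = Max (Poly_Mapping.keys a)"
  obtain c where c: "Max (Poly_Mapping.keys b) = \<alpha>" "Poly_Mapping.lookup a \<alpha> = [:[:[:c:]:]:] * Poly_Mapping.lookup b \<alpha>"
    using big_wronskian_top[OF False b0 eq] by (auto simp: \<alpha>_def)
  define h where "h = a - big_const c * b"
  have dh: "big_deriv h = big_deriv a - big_const c * big_deriv b"
    unfolding h_def derivation_rules(6)[OF derivation_big_deriv] big_deriv_scale ..
  have "big_deriv h * b = h * big_deriv b"
    unfolding dh unfolding h_def using eq by (simp add: algebra_simps)
  have "h = 0"
  proof (rule ccontr)
    assume h0: "h \<noteq> 0"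
    then have "Max (Poly_Mapping.keys h) = \<alpha>"
      using big_wronskian_top[OF h0 b0 \<open>big_deriv h * b = h * big_deriv b\<close>] c by simp
    moreover have "Poly_Mapping.lookup h \<alpha> = 0" by (simp add: h_def lookup_minus lookup_const_mult c)
    moreover have "Poly_Mapping.keys h \<noteq> {}" using h0 by (metis poly_mapping_sum_single sum.empty)
    ultimately show False using Max_in[of "Poly_Mapping.keys h"] by (simp add: in_keys_iff)
  qed
  then show ?thesis by (auto simp: h_def)
qed

text \<open>Keeping all examples inside one ring, as the polynomials in the first \<open>N\<close>
  exponentials, lets a single type serve every dimension.\<close>

definition big_sub :: "nat \<Rightarrow> big_ring set" where
  "big_sub N = {p. \<forall>\<alpha>\<in>Poly_Mapping.keys p. Poly_Mapping.keys \<alpha> \<subseteq> {..<N}}"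

lemma subring_big_sub: "subring_of (big_sub N)"
proof -
  have "p + q \<in> big_sub N" if "p \<in> big_sub N" "q \<in> big_sub N" for p q
    using that Poly_Mapping.keys_add[of p q] by (auto simp: big_sub_def)
  moreover have "p * q \<in> big_sub N" if pq: "p \<in> big_sub N" "q \<in> big_sub N" for p q
  proof -
    have "Poly_Mapping.keys \<gamma> \<subseteq> {..<N}" if "\<gamma> \<in> Poly_Mapping.keys (p * q)" for \<gamma>
    proof -
      obtain \<alpha> \<beta> where "\<gamma> = \<alpha> + \<beta>" "\<alpha> \<in> Poly_Mapping.keys p" "\<beta> \<in> Poly_Mapping.keys q"
        using keys_mult[of p q] \<open>\<gamma> \<in> Poly_Mapping.keys (p * q)\<close> by blast
      then show ?thesis using pq by (simp add: keys_add_nat big_sub_def)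
    qed
    then show ?thesis by (simp add: big_sub_def)
  qed
  moreover have "- p \<in> big_sub N" if "p \<in> big_sub N" for p using that by (simp add: big_sub_def)
  moreover have "1 \<in> big_sub N" by (simp add: big_sub_def)
  ultimately show ?thesis by (simp add: subring_of_def)
qed

lemma big_deriv_sub:
  assumes "p \<in> big_sub N"
  shows "big_deriv p \<in> big_sub N"
proof -
  have "Poly_Mapping.keys (big_deriv p) \<subseteq> Poly_Mapping.keys p"
    unfolding big_deriv_def weighted_deriv_def by (rule keys_mapp_subset)
  then show ?thesis using assms by (auto simp: big_sub_def)
qed

definition big_gen :: "nat \<Rightarrow> big_ring" where
  "big_gen i = (if i = 0 then Poly_Mapping.single 0 [:[:[:0, 1:]:]:] else if i = 1 then Poly_Mapping.single 0 [:[:0, 1:]:]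
     else if i = 2 then Poly_Mapping.single 0 [:0, 1:] else Poly_Mapping.single (Poly_Mapping.single (i - 3) 1) 1)"

lemma big_sub_const: "big_const c \<in> big_sub N" "Poly_Mapping.single 0 a \<in> big_sub N"
  by (simp_all add: big_sub_def big_const_def)

lemma big_gen_sub: "i < N + 3 \<Longrightarrow> big_gen i \<in> big_sub N"
  by (auto simp: big_gen_def big_sub_def)

lemma big_sub_generated:
  assumes const: "\<And>c. big_const c \<in> V" and gen: "\<And>i. i < N + 3 \<Longrightarrow> big_gen i \<in> V"
    and cl: "\<And>a b. a \<in> V \<Longrightarrow> b \<in> V \<Longrightarrow> a + b \<in> V \<and> a * b \<in> V"
  shows "big_sub N \<subseteq> V"
proof
  fix p assume p: "p \<in> big_sub N"
  have g: "Poly_Mapping.single 0 [:[:[:0, 1:]:]:] \<in> V" "Poly_Mapping.single 0 [:[:0, 1:]:] \<in> V" "Poly_Mapping.single 0 [:0, 1:] \<in> V"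
    using gen[of 0] gen[of 1] gen[of 2] by (simp_all add: big_gen_def)
  have z: "0 \<in> V" using const[of 0] by (simp add: big_const_def)
  have one: "1 \<in> V" using const[of 1] unital_hom_rules(4)[OF unital_hom_big_const] by simp
  have V1: "Poly_Mapping.single 0 [:[:r:]:] \<in> V" for r
  proof (induction r)
    case 0
    then show ?case using z by simp
  next
    case (pCons c r)
    have "Poly_Mapping.single 0 [:[:pCons c r:]:] = big_const c + Poly_Mapping.single 0 [:[:[:0, 1:]:]:] * (Poly_Mapping.single 0 [:[:r:]:] :: big_ring)"
      by (simp add: big_const_def mult_single single_add[symmetric])
    then show ?case using const g pCons cl by metis
  qed
  have V2: "Poly_Mapping.single 0 [:q:] \<in> V" for q
  proof (induction q)
    case 0
    then show ?case using z by simp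
  next
    case (pCons r q)
    have "Poly_Mapping.single 0 [:pCons r q:] = Poly_Mapping.single 0 [:[:r:]:] + Poly_Mapping.single 0 [:[:0, 1:]:] * (Poly_Mapping.single 0 [:q:] :: big_ring)"
      by (simp add: mult_single single_add[symmetric])
    then show ?case using V1 g pCons cl by metis
  qed
  have V3: "Poly_Mapping.single 0 a \<in> V" for a
  proof (induction a)
    case 0
    then show ?case using z by simp
  next
    case (pCons q a)
    have "Poly_Mapping.single 0 (pCons q a) = Poly_Mapping.single 0 [:q:] + Poly_Mapping.single 0 [:0, 1:] * (Poly_Mapping.single 0 a :: big_ring)"
      by (simp add: mult_single single_add[symmetric])
    then show ?case using V2 g pCons cl by metis
  qed
  have pw: "Poly_Mapping.single (Poly_Mapping.single i m) 1 \<in> V" if "i < N" for i m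
  proof (induction m)
    case 0
    then show ?case using one by simp
  next
    case (Suc m)
    have "Poly_Mapping.single (Poly_Mapping.single i (Suc m)) 1 = big_gen (i + 3) * Poly_Mapping.single (Poly_Mapping.single i m) 1"
      by (simp add: big_gen_def mult_single flip: single_add)
    then show ?case using gen[of "i + 3"] that Suc cl by simp
  qed
  have mon: "Poly_Mapping.single (\<Sum>i\<in>K. Poly_Mapping.single i (Poly_Mapping.lookup \<alpha> i)) 1 \<in> V"
    if "finite K" "K \<subseteq> {..<N}" for K \<alpha>
    using that
  proof (induction K rule: finite_induct)
    case empty
    then show ?case using one by simp
  next
    case (insert i K)
    have "Poly_Mapping.single (Poly_Mapping.single i (Poly_Mapping.lookup \<alpha> i)) 1 * Poly_Mapping.single (\<Sum>i\<in>K. Poly_Mapping.single i (Poly_Mapping.lookup \<alpha> i)) (1 :: base_ring) \<in> V"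
      using insert pw cl by simp
    then show ?case using insert by (simp add: mult_single)
  qed
  have "Poly_Mapping.single \<alpha> a \<in> V" if "Poly_Mapping.keys \<alpha> \<subseteq> {..<N}" for \<alpha> a
  proof -
    have "Poly_Mapping.single \<alpha> 1 \<in> V" using mon[OF finite_keys that, of \<alpha>] poly_mapping_sum_single[of \<alpha>] by simp
    then have "Poly_Mapping.single \<alpha> 1 * Poly_Mapping.single 0 a \<in> V" using V3 cl by blast
    then show ?thesis by (simp add: mult_single)
  qed
  then have terms: "Poly_Mapping.single \<alpha> (Poly_Mapping.lookup p \<alpha>) \<in> V" if "\<alpha> \<in> Poly_Mapping.keys p" for \<alpha>
    using p that by (simp add: big_sub_def)
  have "(\<Sum>\<alpha>\<in>K. Poly_Mapping.single \<alpha> (Poly_Mapping.lookup p \<alpha>)) \<in> V" if "K \<subseteq> Poly_Mapping.keys p" "finite K" for K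
    using that(2,1) by (induction K rule: finite_induct) (use z cl terms in auto)
  then show "p \<in> V" using poly_mapping_sum_single[of p] by (metis finite_keys order_refl)
qed

lemma prime_in_kernel:
  fixes h :: "'a::comm_ring_1 \<Rightarrow> 'b::idom"
  assumes "unital_hom h" "subring_of S"
  shows "prime_in S {p \<in> S. h p = 0}"
  unfolding prime_in_def
  using unital_hom_rules[OF assms(1)] subring_of_closed(2,4,6)[OF assms(2)] by auto

text \<open>The variables are set to 0 one after the other: the exponentials, then \<open>v\<close>,
  \<open>y\<close> and \<open>t\<close>. Describing the primes as kernels of maps to domains makes
  primality immediate.\<close>

lemma big_sub_prime_chain:
  obtains P where "\<And>i. i \<le> N + 3 \<Longrightarrow> prime_in (big_sub N) (P i)" "\<And>i. i < N + 3 \<Longrightarrow> P i \<subset> P (Suc i)"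
proof -
  let ?S = "big_sub N"
  define h1 h2 h3 where "h1 p = coeff (Poly_Mapping.lookup p 0) 0" and "h2 p = coeff (coeff (Poly_Mapping.lookup p 0) 0) 0"
    and "h3 p = coeff (coeff (coeff (Poly_Mapping.lookup p 0) 0) 0) 0" for p :: big_ring
  note l0 = unital_hom_rules[OF unital_hom_lookup_0[where 'a = base_ring]]
  have hom: "unital_hom h1" "unital_hom h2" "unital_hom h3"
    unfolding unital_hom_def h1_def h2_def h3_def l0 by (simp_all add: coeff_mult)
  define P where "P i = (if i \<le> N then {p \<in> ?S. kill_vars {..<i} p = 0} else if i = N + 1 then {p \<in> ?S. h1 p = 0}
     else if i = N + 2 then {p \<in> ?S. h2 p = 0} else {p \<in> ?S. h3 p = 0})" for i
  have kv: "kill_vars Z p = 0 \<longleftrightarrow> (\<forall>\<alpha>. Poly_Mapping.keys \<alpha> \<inter> Z = {} \<longrightarrow> Poly_Mapping.lookup p \<alpha> = 0)" for Z and p :: big_ring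
    by (auto simp: poly_mapping_eq_iff fun_eq_iff lookup_kill_vars)
  show thesis
  proof
    show "prime_in ?S (P i)" if "i \<le> N + 3" for i
      unfolding P_def using prime_in_kernel[OF unital_hom_kill_vars subring_big_sub] 
        prime_in_kernel[OF hom(1) subring_big_sub] prime_in_kernel[OF hom(2) subring_big_sub]
        prime_in_kernel[OF hom(3) subring_big_sub] by auto
    fix i assume i: "i < N + 3"
    consider "i < N" | "i = N" | "i = N + 1" | "i = N + 2" using i by linarith
    then show "P i \<subset> P (Suc i)"
    proof cases
      case 1
      define x where "x = (Poly_Mapping.single (Poly_Mapping.single i 1) 1 :: big_ring)"
      have "x \<in> ?S" using 1 by (simp add: x_def big_sub_def)
      moreover have "kill_vars {..<Suc i} x = 0" unfolding kv by (auto simp: x_def lookup_single when_def)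
      moreover have "kill_vars {..<i} x \<noteq> 0" unfolding kv
        by (intro notI) (drule spec[of _ "Poly_Mapping.single i 1"], simp add: x_def)
      moreover have "P i \<subseteq> P (Suc i)"
      proof -
        have "K \<inter> {..<Suc i} = {} \<Longrightarrow> K \<inter> {..<i} = {}" for K by auto
        then show ?thesis using 1 unfolding P_def kv by auto
      qed
      ultimately show ?thesis using 1 by (auto simp: P_def)
    next
      case 2
      define x where "x = (Poly_Mapping.single 0 [:0, 1:] :: big_ring)"
      have "x \<in> ?S" "h1 x = 0" by (simp_all add: x_def big_sub_const h1_def)
      moreover have "kill_vars {..<N} x \<noteq> 0" unfolding kv
        by (intro notI) (drule spec[of _ 0], simp add: x_def)
      moreover have "h1 p = 0" if "kill_vars {..<N} p = 0" for p using that[unfolded kv, rule_format, of 0] by (simp add: h1_def)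
      ultimately show ?thesis using 2 by (auto simp: P_def)
    next
      case 3
      define x where "x = (Poly_Mapping.single 0 [:[:0, 1:]:] :: big_ring)"
      have "x \<in> ?S" "h2 x = 0" "h1 x \<noteq> 0" by (simp_all add: x_def big_sub_const h1_def h2_def)
      moreover have "h2 p = 0" if "h1 p = 0" for p using that by (simp add: h1_def h2_def)
      ultimately show ?thesis using 3 by (auto simp: P_def)
    next
      case 4
      define x where "x = (Poly_Mapping.single 0 [:[:[:0, 1:]:]:] :: big_ring)"
      have "x \<in> ?S" "h3 x = 0" "h2 x \<noteq> 0" by (simp_all add: x_def big_sub_const h3_def h2_def)
      moreover have "h3 p = 0" if "h2 p = 0" for p using that by (simp add: h3_def h2_def)
      ultimately show ?thesis using 4 by (auto simp: P_def)
    qed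
  qed
qed

text \<open>The primes of the base ring are extended coefficientwise. The weight only multiplies
  each coefficient, so stability and zero intersection pass to the extension.\<close>

lemma big_sub_invariant_primes:
  obtains P :: "nat \<Rightarrow> big_ring set" where "\<And>k. prime_in (big_sub N) (P k)" "\<And>k. P k \<noteq> {0}"
    "\<And>k p. p \<in> P k \<Longrightarrow> big_deriv p \<in> P k" "(\<Inter>k. P k) = {0}"
proof -
  obtain e :: "nat \<Rightarrow> base_ring \<Rightarrow> complex fps" where hom: "\<And>k. unital_hom (e k)"
    and der: "\<And>k p. fps_D (e k p) = e k (vfield p)" and nz: "\<And>k. \<exists>p. p \<noteq> 0 \<and> e k p = 0"
    and dense: "\<And>p. (\<And>k. e k p = 0) \<Longrightarrow> p = 0"
    using invariant_curves by metis
  define h where "h k = (Poly_Mapping.mapp (\<lambda>_. e k) :: big_ring \<Rightarrow> _)" for k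
  have lh: "Poly_Mapping.lookup (h k p) \<alpha> = e k (Poly_Mapping.lookup p \<alpha>)" for k p \<alpha>
    unfolding h_def by (rule lookup_mapp_zero) (rule unital_hom_rules(3)[OF hom])
  have h0: "h k p = 0 \<longleftrightarrow> (\<forall>\<alpha>. e k (Poly_Mapping.lookup p \<alpha>) = 0)" for k p
    by (auto simp: poly_mapping_eq_iff fun_eq_iff lh)
  define P where "P k = {p \<in> big_sub N. h k p = 0}" for k
  show thesis
  proof
    show "prime_in (big_sub N) (P k)" for k
      unfolding P_def h_def by (intro prime_in_kernel unital_hom_coeff_map hom subring_big_sub)
    show "P k \<noteq> {0}" for k
    proof -
      obtain p where p: "p \<noteq> 0" "e k p = 0" using nz by blast
      then have "Poly_Mapping.single 0 p \<in> P k" unfolding P_def h0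
        by (auto simp: big_sub_const lookup_single when_def unital_hom_rules(3)[OF hom])
      moreover have "Poly_Mapping.single 0 p \<noteq> (0 :: big_ring)" using p by (metis lookup_single_eq lookup_zero)
      ultimately show ?thesis by blast
    qed
    show "big_deriv p \<in> P k" if "p \<in> P k" for k p
    proof -
      have "e k (Poly_Mapping.lookup p \<alpha>) = 0" for \<alpha> using that by (simp add: P_def h0)
      then have "e k (Poly_Mapping.lookup (big_deriv p) \<alpha>) = 0" for \<alpha>
        unfolding lookup_big_deriv unital_hom_rules(1,2)[OF hom] der[symmetric] by (simp add: fps_D_def)
      then show ?thesis using that big_deriv_sub unfolding P_def h0 by blast
    qed
    show "(\<Inter>k. P k) = {0}"
    proof
      show "(\<Inter>k. P k) \<subseteq> {0}"
      proof
        fix p assume "p \<in> (\<Inter>k. P k)"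
        then have "e k (Poly_Mapping.lookup p \<alpha>) = 0" for k \<alpha> by (auto simp: P_def h0)
        then have "Poly_Mapping.lookup p \<alpha> = 0" for \<alpha> using dense by blast
        then show "p \<in> {0}" by (simp add: poly_mapping_eqI)
      qed
      show "{0} \<subseteq> (\<Inter>k. P k)"
        using subring_of_closed(2)[OF subring_big_sub] by (auto simp: P_def h0 unital_hom_rules(3)[OF hom])
    qed
  qed
qed

section \<open>Transport to a ring of sequences\<close>

text \<open>Moves a subring of a type class ring along an injection \<open>f\<close> with left
  inverse \<open>g\<close>, so that all examples are carried by
  \<open>nat => complex\<close>.\<close>

definition transport_ring :: "('a::comm_ring_1 \<Rightarrow> 'b) \<Rightarrow> ('b \<Rightarrow> 'a) \<Rightarrow> 'a set \<Rightarrow> 'b ring" where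
  "transport_ring f g S = \<lparr>carrier = f ` S, monoid.mult = (\<lambda>x y. f (g x * g y)), one = f 1,
     ring.zero = f 0, ring.add = (\<lambda>x y. f (g x + g y))\<rparr>"

lemma transport_ring_simps [simp]:
  "carrier (transport_ring f g S) = f ` S"
  "x \<otimes>\<^bsub>transport_ring f g S\<^esub> y = f (g x * g y)"
  "x \<oplus>\<^bsub>transport_ring f g S\<^esub> y = f (g x + g y)"
  "\<one>\<^bsub>transport_ring f g S\<^esub> = f 1"
  "\<zero>\<^bsub>transport_ring f g S\<^esub> = f 0"
  by (simp_all add: transport_ring_def)

context
  fixes f :: "'a::idom \<Rightarrow> 'b" and g :: "'b \<Rightarrow> 'a" and S :: "'a set"
  assumes gf [simp]: "\<And>a. g (f a) = a" and S: "subring_of S"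
begin

lemma transport_inject [simp]: "f a = f b \<longleftrightarrow> a = b"
  by (metis gf)

lemma transport_image_iff [simp]: "f a \<in> f ` T \<longleftrightarrow> a \<in> T"
  by (auto simp: image_iff)

lemma transport_ring_domain: "domain (transport_ring f g S)"
proof -
  note cl = subring_of_closed[OF S]
  have "cring (transport_ring f g S)"
  proof (rule cringI)
    show "abelian_group (transport_ring f g S)"
    proof (rule abelian_groupI)
      fix x assume "x \<in> carrier (transport_ring f g S)"
      then obtain a where "x = f a" "a \<in> S" by auto
      then show "\<exists>y\<in>carrier (transport_ring f g S). y \<oplus>\<^bsub>transport_ring f g S\<^esub> x = \<zero>\<^bsub>transport_ring f g S\<^esub>"
        by (intro bexI[of _ "f (- a)"]) (auto simp: cl)
    qed (auto simp: cl add_ac)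
    show "comm_monoid (transport_ring f g S)"
      by (rule comm_monoidI) (auto simp: cl mult_ac)
  qed (auto simp: distrib_right)
  then show ?thesis
    by (rule domain.intro) (unfold_locales, auto)
qed

lemma transport_ring_minus: "a \<in> S \<Longrightarrow> \<ominus>\<^bsub>transport_ring f g S\<^esub> f a = f (- a)"
proof -
  assume a: "a \<in> S"
  interpret domain "transport_ring f g S" by (rule transport_ring_domain)
  show ?thesis using a subring_of_closed(3)[OF S a] by (intro minus_equality) auto
qed

lemma transport_primeideal:
  assumes P: "prime_in S P"
  shows "primeideal (f ` P) (transport_ring f g S)"
proof (rule primeidealI2)
  interpret domain "transport_ring f g S" by (rule transport_ring_domain)
  note p = prime_in_rules[OF P]
  show "cring (transport_ring f g S)" by (rule is_cring)
  have neg: "- a \<in> P" if "a \<in> P" for a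
    using p(5)[of "- 1" a] that subring_of_closed(1,3)[OF S] by simp
  have absorb: "a * b \<in> P" if "a \<in> P" "b \<in> S" for a b
    using p(5)[OF that(2,1)] by (simp add: mult.commute)
  show "additive_subgroup (f ` P) (transport_ring f g S)"
  proof (intro additive_subgroup.intro add.subgroupI)
    show "f ` P \<subseteq> carrier (transport_ring f g S)" using p(1) by auto
    show "f ` P \<noteq> {}" using p(2) by auto
    show "\<ominus>\<^bsub>transport_ring f g S\<^esub> x \<in> f ` P" if "x \<in> f ` P" for x
      using that neg p(1) transport_ring_minus by auto
    show "x \<oplus>\<^bsub>transport_ring f g S\<^esub> y \<in> f ` P" if "x \<in> f ` P" "y \<in> f ` P" for x y
      using that p(4) by auto
  qed
  show "x \<otimes>\<^bsub>transport_ring f g S\<^esub> y \<in> f ` P" if "y \<in> f ` P" "x \<in> carrier (transport_ring f g S)" for x y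
    using that p(5) by auto
  show "x \<otimes>\<^bsub>transport_ring f g S\<^esub> y \<in> f ` P" if "x \<in> f ` P" "y \<in> carrier (transport_ring f g S)" for x y
    using that absorb by auto
  show "carrier (transport_ring f g S) \<noteq> f ` P"
  proof -
    have "f 1 \<in> carrier (transport_ring f g S)" "f 1 \<notin> f ` P" using subring_of_closed(1)[OF S] p(3) by auto
    then show ?thesis by metis
  qed
  show "x \<in> f ` P \<or> y \<in> f ` P"
    if xy: "x \<in> carrier (transport_ring f g S)" "y \<in> carrier (transport_ring f g S)" "x \<otimes>\<^bsub>transport_ring f g S\<^esub> y \<in> f ` P" for x y
  proof -
    obtain a b where "x = f a" "a \<in> S" "y = f b" "b \<in> S" using xy(1,2) by auto
    then show ?thesis using xy(3) p(6)[of a b] by auto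
  qed
qed

lemma prime_in_of_transport:
  assumes "primeideal Q (transport_ring f g S)"
  shows "prime_in S {a \<in> S. f a \<in> Q}" "Q \<subseteq> f ` S"
proof -
  interpret primeideal Q "transport_ring f g S" by fact
  note cl = subring_of_closed[OF S]
  have one: "f 1 \<notin> Q" using one_imp_carrier I_notcarr by auto
  have add: "f (a + b) \<in> Q" if "f a \<in> Q" "f b \<in> Q" for a b 
    using additive_subgroup.a_closed[OF additive_subgroup_axioms that] by simp
  have mult: "f (a * b) \<in> Q" if "a \<in> S" "f b \<in> Q" for a b using I_l_closed[OF that(2), of "f a"] that by simp
  have prime: "f a \<in> Q \<or> f b \<in> Q" if "a \<in> S" "b \<in> S" "f (a * b) \<in> Q" for a b
    using I_prime[of "f a" "f b"] that by simp
  have zero: "f 0 \<in> Q" using additive_subgroup.zero_closed[OF additive_subgroup_axioms] by simp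
  show "prime_in S {a \<in> S. f a \<in> Q}"
    unfolding prime_in_def using one add mult prime zero cl by auto
  show "Q \<subseteq> f ` S" using a_subset by simp
qed

end

text \<open>An element is determined by its complex coefficients, which are indexed by a countable
  set of monomials.\<close>

lemma big_ring_embedding: "\<exists>f :: big_ring \<Rightarrow> (nat \<Rightarrow> complex). inj f"
proof -
  define gr where "gr \<alpha> = (\<lambda>k. (k, Poly_Mapping.lookup \<alpha> k)) ` Poly_Mapping.keys \<alpha>" for \<alpha> :: "nat \<Rightarrow>\<^sub>0 nat"
  have "inj gr"
  proof (rule injI)
    fix \<alpha> \<beta> assume eq: "gr \<alpha> = gr \<beta>"
    have iff: "(k, n) \<in> gr \<alpha> \<longleftrightarrow> n \<noteq> 0 \<and> Poly_Mapping.lookup \<alpha> k = n" for k n \<alpha>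
      by (auto simp: gr_def in_keys_iff)
    have "Poly_Mapping.lookup \<alpha> k = Poly_Mapping.lookup \<beta> k" for k using eq iff by metis
    then show "\<alpha> = \<beta>" by (rule poly_mapping_eqI)
  qed
  \<comment> \<open>\<open>gr\<close> sends an exponent to the finite graph of its nonzero values,
    and a countable type has only countably many finite subsets.\<close>
  moreover have "countable (range gr)"
    by (rule countable_subset[OF _ countable_Collect_finite]) (auto simp: gr_def)
  ultimately have "countable (UNIV :: (nat \<Rightarrow>\<^sub>0 nat) set)" by (rule countable_image_inj_on[rotated])
  then obtain e :: "(nat \<Rightarrow>\<^sub>0 nat) \<Rightarrow> nat" where e: "inj e" by (auto simp: countable_def)
  define enc where "enc \<alpha> i j k = to_nat (e \<alpha>, i, j, k)" for \<alpha> and i j k :: nat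
  have enc: "enc \<alpha> i j k = enc \<alpha>' i' j' k' \<longleftrightarrow> \<alpha> = \<alpha>' \<and> i = i' \<and> j = j' \<and> k = k'" for \<alpha> \<alpha>' i i' j j' k k'
    using e by (auto simp: enc_def dest: injD)
  \<comment> \<open>Injectivity of \<open>enc\<close> makes the described coefficient unique;
    numbers that encode no monomial get 0.\<close>
  define f where "f p n = (if \<exists>\<alpha> i j k. n = enc \<alpha> i j k
     then THE c. \<exists>\<alpha> i j k. n = enc \<alpha> i j k \<and> c = coeff (coeff (coeff (Poly_Mapping.lookup p \<alpha>) i) j) k else 0)" for p :: big_ring and n
  have f: "f p (enc \<alpha> i j k) = coeff (coeff (coeff (Poly_Mapping.lookup p \<alpha>) i) j) k" for p \<alpha> i j k
    unfolding f_def by (auto simp: enc)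
  have "inj f"
  proof (rule injI)
    fix p q assume "f p = f q"
    then have "coeff (coeff (coeff (Poly_Mapping.lookup p \<alpha>) i) j) k = coeff (coeff (coeff (Poly_Mapping.lookup q \<alpha>) i) j) k" for \<alpha> i j k
      using f by metis
    then show "p = q" by (intro poly_mapping_eqI poly_eqI)
  qed
  then show ?thesis by blast
qed

lemma counterexample_of_dimension:
  "\<exists>(R :: (nat \<Rightarrow> complex) ring) \<iota> \<delta>.
     complex_affine_algebra R \<iota> \<and> is_derivation R \<iota> \<delta> \<and>
     frac_constants_are_C R \<iota> \<delta> \<and> nonzero_prime_diff_ideals_meet_zero R \<delta> \<and>
     krull_dim_eq R (N + 3)"
proof -
  obtain f :: "big_ring \<Rightarrow> (nat \<Rightarrow> complex)" where "inj f" using big_ring_embedding by blast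
  then obtain g where gf: "\<And>a. g (f a) = a" by (metis inv_f_f)
  define S where "S = big_sub N"
  have S: "subring_of S" unfolding S_def by (rule subring_big_sub)
  define R where "R = transport_ring f g S"
  define \<iota> where "\<iota> c = f (big_const c)" for c
  define \<delta> where "\<delta> x = f (big_deriv (g x))" for x
  have R [simp]: "carrier R = f ` S" "\<And>x y. x \<otimes>\<^bsub>R\<^esub> y = f (g x * g y)" "\<And>x y. x \<oplus>\<^bsub>R\<^esub> y = f (g x + g y)"
    "\<one>\<^bsub>R\<^esub> = f 1" "\<zero>\<^bsub>R\<^esub> = f 0" by (simp_all add: R_def)
  have inj [simp]: "f a = f b \<longleftrightarrow> a = b" for a b using gf by metis
  have dom: "domain R" unfolding R_def by (rule transport_ring_domain[where f = f and g = g and S = S, OF gf S])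
  have const: "big_const c \<in> S" for c unfolding S_def by (rule big_sub_const)
  note hc = unital_hom_rules[OF unital_hom_big_const]
  note dd = derivation_rules[OF derivation_big_deriv]
  have 1: "complex_affine_algebra R \<iota>"
    unfolding complex_affine_algebra_def
  proof (intro conjI allI)
    let ?G = "f ` big_gen ` {..<N + 3}"
    have G: "?G \<subseteq> carrier R" using big_gen_sub by (auto simp: S_def)
    show "\<exists>G. finite G \<and> G \<subseteq> carrier R \<and> generate_ring R (range \<iota> \<union> G) = carrier R"
    proof (intro exI conjI)
      show "finite ?G" by simp
      show "?G \<subseteq> carrier R" by (rule G)
      interpret domain R by (rule dom)
      have H: "range \<iota> \<union> ?G \<subseteq> carrier R" using G const by (auto simp: \<iota>_def)
      define V where "V = {a. f a \<in> generate_ring R (range \<iota> \<union> ?G)}"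
      have "S \<subseteq> V" unfolding S_def
      proof (rule big_sub_generated)
        show "big_const c \<in> V" for c unfolding V_def by (auto intro!: generate_ring.incl simp: \<iota>_def)
        show "big_gen i \<in> V" if "i < N + 3" for i unfolding V_def using that by (auto intro!: generate_ring.incl)
        show "a + b \<in> V \<and> a * b \<in> V" if "a \<in> V" "b \<in> V" for a b
          using generate_ring.eng_add[of "f a" R "range \<iota> \<union> ?G" "f b"]
            generate_ring.eng_mult[of "f a" R "range \<iota> \<union> ?G" "f b"] that by (simp add: V_def gf)
      qed
      then show "generate_ring R (range \<iota> \<union> ?G) = carrier R"
        using generate_ring_in_carrier[OF H] by (auto simp: V_def)
    qed
  qed (use dom const in \<open>auto simp: \<iota>_def gf hc\<close>)
  have 2: "is_derivation R \<iota> \<delta>"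
    unfolding is_derivation_def
    using big_deriv_sub[of _ N] by (auto simp: \<delta>_def \<iota>_def gf dd(1,2) big_deriv_const S_def)
  have 3: "frac_constants_are_C R \<iota> \<delta>"
    unfolding frac_constants_are_C_def
    using big_constants by (auto simp: \<delta>_def \<iota>_def gf)
  have 4: "nonzero_prime_diff_ideals_meet_zero R \<delta>"
  proof -
    obtain P :: "nat \<Rightarrow> big_ring set" where P: "\<And>k. prime_in S (P k)" "\<And>k. P k \<noteq> {0}"
      "\<And>k p. p \<in> P k \<Longrightarrow> big_deriv p \<in> P k" "(\<Inter>k. P k) = {0}"
      unfolding S_def using big_sub_invariant_primes[of N] by metis
    define F where "F = {Q. primeideal Q R \<and> differential_ideal R \<delta> Q \<and> Q \<noteq> {\<zero>\<^bsub>R\<^esub>}}"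
    have "f ` P k \<in> F" for k
    proof -
      have pr: "primeideal (f ` P k) R" unfolding R_def by (rule transport_primeideal[where f = f and g = g and S = S, OF gf S P(1)])
      moreover have "differential_ideal R \<delta> (f ` P k)"
        unfolding differential_ideal_def using pr P(3) by (auto simp: primeideal_def \<delta>_def gf)
      moreover have "f ` P k \<noteq> {\<zero>\<^bsub>R\<^esub>}"
      proof
        assume "f ` P k = {\<zero>\<^bsub>R\<^esub>}"
        then have "f ` P k = f ` {0}" by simp
        then have "P k = {0}" by (simp only: inj_image_eq_iff[OF \<open>inj f\<close>])
        then show False using P(2) by blast
      qed
      ultimately show ?thesis by (simp add: F_def)
    qed
    then have "\<Inter>F \<subseteq> (\<Inter>k. f ` P k)" by blast
    also have "\<dots> = {f 0}"
    proof -
      have "(\<Inter>k. f ` P k) = f ` (\<Inter>k. P k)" using \<open>inj f\<close> by (subst image_INT[of f UNIV UNIV]) auto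
      then show ?thesis using P(4) by simp
    qed
    finally have "\<Inter>F \<subseteq> {\<zero>\<^bsub>R\<^esub>}" by simp
    moreover have "\<zero>\<^bsub>R\<^esub> \<in> Q" if "Q \<in> F" for Q
    proof -
      have "additive_subgroup Q R" using that by (auto simp: F_def differential_ideal_def ideal_def)
      then show ?thesis by (rule additive_subgroup.zero_closed)
    qed
    ultimately show ?thesis unfolding nonzero_prime_diff_ideals_meet_zero_def F_def[symmetric] by blast
  qed
  have 5: "krull_dim_eq R (N + 3)"
    unfolding krull_dim_eq_def
  proof (intro conjI notI)
    obtain P where P: "\<And>i. i \<le> N + 3 \<Longrightarrow> prime_in S (P i)" "\<And>i. i < N + 3 \<Longrightarrow> P i \<subset> P (Suc i)"
      unfolding S_def using big_sub_prime_chain[of N] by metis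
    have "prime_chain R (\<lambda>i. f ` P i) (N + 3)"
      unfolding prime_chain_def R_def
    proof (intro conjI allI impI)
      show "primeideal (f ` P i) (transport_ring f g S)" if "i \<le> N + 3" for i
        by (rule transport_primeideal[where f = f and g = g and S = S, OF gf S P(1)[OF that]])
      show "f ` P i \<subset> f ` P (Suc i)" if "i < N + 3" for i
        using P(2)[OF that] \<open>inj f\<close> by (metis inj_image_subset_iff psubset_eq subset_not_subset_eq)
    qed
    then show "\<exists>P. prime_chain R P (N + 3)" by blast
    assume "\<exists>P. prime_chain R P (Suc (N + 3))"
    then obtain Q where Q: "\<And>i. i \<le> Suc (N + 3) \<Longrightarrow> primeideal (Q i) (transport_ring f g S)"
      "\<And>i. i < Suc (N + 3) \<Longrightarrow> Q i \<subset> Q (Suc i)"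
      by (auto simp: prime_chain_def R_def)
    define P' where "P' i = {a \<in> S. f a \<in> Q i}" for i
    show False
    proof (rule no_long_prime_chain[OF S unital_hom_big_const const])
      show "S \<subseteq> U" if "\<And>c. big_const c \<in> U" "\<And>i. i < N + 3 \<Longrightarrow> big_gen i \<in> U"
        "\<And>a b. a \<in> U \<Longrightarrow> b \<in> U \<Longrightarrow> a + b \<in> U \<and> a * b \<in> U" for U
        unfolding S_def using that by (rule big_sub_generated)
      show "prime_in S (P' i)" if "i \<le> Suc (N + 3)" for i
        unfolding P'_def by (rule prime_in_of_transport(1)[where f = f and g = g and S = S, OF gf S Q(1)[OF that]])
      show "P' i \<subset> P' (Suc i)" if "i \<le> N + 3" for i
      proof -
        have "Q i \<subset> Q (Suc i)" using Q(2) that by simp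
        moreover have "Q (Suc i) \<subseteq> f ` S" using prime_in_of_transport(2)[where f = f and g = g and S = S, OF gf S Q(1)] that by simp
        ultimately show ?thesis unfolding P'_def by blast
      qed
    qed
  qed
  show ?thesis using 1 2 3 4 5 by blast
qed

theorem theorem4p1:
  shows "(\<exists>(R :: (nat \<Rightarrow> complex) ring) \<iota> \<delta>.
            complex_affine_algebra R \<iota> \<and> is_derivation R \<iota> \<delta> \<and>
            frac_constants_are_C R \<iota> \<delta> \<and> nonzero_prime_diff_ideals_meet_zero R \<delta>) \<and>
         (\<forall>n::nat. n \<ge> 3 \<longrightarrow>
            (\<exists>(R :: (nat \<Rightarrow> complex) ring) \<iota> \<delta>.
               complex_affine_algebra R \<iota> \<and> is_derivation R \<iota> \<delta> \<and>
               frac_constants_are_C R \<iota> \<delta> \<and> nonzero_prime_diff_ideals_meet_zero R \<delta> \<and>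
               krull_dim_eq R n))"
proof (intro conjI allI impI)
  fix n :: nat
  assume "n \<ge> 3"
  then show "\<exists>(R :: (nat \<Rightarrow> complex) ring) \<iota> \<delta>.
     complex_affine_algebra R \<iota> \<and> is_derivation R \<iota> \<delta> \<and>
     frac_constants_are_C R \<iota> \<delta> \<and> nonzero_prime_diff_ideals_meet_zero R \<delta> \<and> krull_dim_eq R n"
    using counterexample_of_dimension[of "n - 3"] by simp
qed (use counterexample_of_dimension in blast)

end
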